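(* Let $k\in\mathbb{C}\setminus]-\infty,0]$ with $\mathrm{Im}\,k\ge 0$, let $\alpha\in]0,1[$, and let $\Omega$ be a bounded open subset of $\mathbb{R}^n$ of class $C^{1,\alpha}$. Then the following statements hold. (i) Let $\mu\in V^{-1,\alpha}(\partial\Omega)$. Then the single layer potential $v_\Omega[\tilde S_{n,k;r},\mu]$ satisfies the outgoing $(k)$-radiation condition. More precisely, $$\limsup_{x\to\infty}|x|e^{(\mathrm{Im}\,k)|x|}|x|^{\frac{n-1}{2}}\left|Dv_\Omega[\tilde S_{n,k;r},\mu](x)\frac{x}{|x|}-ik\,v_\Omega[\tilde S_{n,k;r},\mu](x)\right|<+\infty .$$ (ii) Let $\mu\in L^1(\partial\Omega)$. Then the double layer potential $w_\Omega[\tilde S_{n,k;r},\mu]$ satisfies the outgoing $(k)$-radiation condition. More precisely, $$\limsup_{x\to\infty}|x|e^{(\mathrm{Im}\,k)|x|}|x|^{\frac{n-1}{2}}\left|Dw_\Omega[\tilde S_{n,k;r},\mu](x)\frac{x}{|x|}-ik\,w_\Omega[\tilde S_{n,k;r},\mu](x)\right|<+\infty .$$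
   Context: Throughout $n\ge 2$ is an integer, functions are complex valued, dualities $\langle\cdot,\cdot\rangle$ are bilinear, and $]a,b[$ denotes an open interval. $\nu_\Omega$ is the outward unit normal to $\Omega$ on $\partial\Omega$. $Du$ is the Jacobian (row) matrix of $u$. Fundamental solution. With $\log$ the principal branch on $\mathbb{C}\setminus]-\infty,0]$ and $H^{(1)}_\nu=J_\nu+iN_\nu$ the first Hankel function, for $k\in\mathbb{C}\setminus]-\infty,0]$ with $\mathrm{Im}\,k\ge0$, $$\tilde S_{n,k;r}(x)=C_n|x|^{-\frac{n-2}{2}}H^{(1)}_{\frac{n-2}{2}}(k|x|)\quad (x\in\mathbb{R}^n\setminus\{0\}),\qquad C_n=\frac{e^{\frac{n-2}{2}\log k}}{4i(2\pi)^{\frac{n-2}{2}}} .$$ It is a fundamental solution of $\Delta+k^2$ (for $n=3$, $\tilde S_{3,k;r}(x)=-\frac{1}{4\pi|x|}e^{ik|x|}$). Radiation condition. A function $u$ of class $C^1$ in the complement of a compact subset of $\mathbb{R}^n$ satisfies the outgoing $(k)$-radiation condition if $\lim_{x\to\infty}|x|^{\frac{n-1}{2}}\left(Du(x)\frac{x}{|x|}-iku(x)\right)=0$. The space $V^{-1,\alpha}(\partial\Omega)$. For $v\in C^{1,\alpha}(\partial\Omega)$ let $\mathcal{G}_{\Omega,d,+}[v]\in C^{1,\alpha}(\overline\Omega)$ be the unique function harmonic in $\Omega$ with boundary value $v$, and let $S_{\Omega,+}[v]=\frac{\partial}{\partial\nu_\Omega}\mathcal{G}_{\Omega,d,+}[v]\in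 C^{0,\alpha}(\partial\Omega)$. A function $\mu_0\in C^{0,\alpha}(\partial\Omega)$ is identified with the functional $v\mapsto\int_{\partial\Omega}\mu_0v\,d\sigma$ on $C^{1,\alpha}(\partial\Omega)$, and $S_{\Omega,+}^t[\mu_1]$ is the functional $v\mapsto\int_{\partial\Omega}\mu_1S_{\Omega,+}[v]\,d\sigma$. Then $$V^{-1,\alpha}(\partial\Omega)=\{\mu_0+S_{\Omega,+}^t[\mu_1]:\mu_0,\mu_1\in C^{0,\alpha}(\partial\Omega)\}\subseteq (C^{1,\alpha}(\partial\Omega))' .$$ Layer potentials. For $\mu\in(C^{1,\alpha}(\partial\Omega))'$, $v_\Omega[\tilde S_{n,k;r},\mu]$ is the distribution $(r_{|\partial\Omega}^t\mu)\ast\tilde S_{n,k;r}$ in $\mathbb{R}^n$, where $r_{|\partial\Omega}$ is the restriction map from $\mathcal{D}(\mathbb{R}^n)$ to $C^{1,\alpha}(\partial\Omega)$; in $\mathbb{R}^n\setminus\partial\Omega$ it is the function $x\mapsto\langle\mu(y),\tilde S_{n,k;r}(x-y)\rangle$. For $\mu\in L^1(\partial\Omega)$ and $x\in\mathbb{R}^n\setminus\partial\Omega$, $w_\Omega[\tilde S_{n,k;r},\mu](x)=\int_{\partial\Omega}\frac{\partial}{\partial\nu_{\Omega,y}}\left(\tilde S_{n,k;r}(x-y)\right)\mu(y)\,d\sigma_y$, with $\frac{\partial}{\partial\nu_{\Omega,y}}(\tilde S_{n,k;r}(x-y))=-D\tilde S_{n,k;r}(x-y)\nu_\Omega(y)$.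 *)

theory Defs
  imports "HOL-Analysis.Analysis"
begin

section \<open>Bessel functions and the fundamental solution\<close>

text \<open>Principal branches throughout: \<open>z powr \<nu> = exp (\<nu> * Ln z)\<close>.
  The function \<open>rGamma\<close> is the entire reciprocal of the Gamma function, so the series is
  also correct for negative integer orders.\<close>

definition bessel_J :: "complex \<Rightarrow> complex \<Rightarrow> complex" where
  "bessel_J \<nu> z =
     (z / 2) powr \<nu> *
     (\<Sum>m. (- 1) ^ m / fact m * rGamma (\<nu> + of_nat m + 1) * (z / 2) ^ (2 * m))"

definition bessel_N_quot :: "complex \<Rightarrow> complex \<Rightarrow> complex" where
  "bessel_N_quot \<nu> z =
     (bessel_J \<nu> z * cos (\<nu> * of_real pi) - bessel_J (- \<nu>) z) / sin (\<nu> * of_real pi)"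

text \<open>At integer orders the Neumann function is the limit of the quotient in the order.\<close>

definition bessel_N :: "complex \<Rightarrow> complex \<Rightarrow> complex" where
  "bessel_N \<nu> z =
     (if \<nu> \<in> \<int> then Lim (at \<nu>) (\<lambda>\<xi>. bessel_N_quot \<xi> z) else bessel_N_quot \<nu> z)"

definition hankel1 :: "complex \<Rightarrow> complex \<Rightarrow> complex" where
  "hankel1 \<nu> z = bessel_J \<nu> z + \<i> * bessel_N \<nu> z"

text \<open>The dimension is that of the type \<open>'a\<close>; the value at the origin is irrelevant.\<close>

definition fund_sol :: "complex \<Rightarrow> 'a::euclidean_space \<Rightarrow> complex" where
  "fund_sol k x =
     (let h = (real DIM('a) - 2) / 2
      in exp (of_real h * Ln k) / (4 * \<i> * of_real ((2 * pi) powr h))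
           * of_real (norm x powr (- h)) * hankel1 (of_real h) (k * of_real (norm x)))"

section \<open>Radiation condition\<close>

definition C1_on :: "'a::euclidean_space set \<Rightarrow> ('a \<Rightarrow> complex) \<Rightarrow> bool" where
  "C1_on U u \<longleftrightarrow>
     (\<exists>D :: 'a \<Rightarrow> 'a \<Rightarrow>\<^sub>L complex.
        continuous_on U D \<and> (\<forall>x\<in>U. (u has_derivative blinfun_apply (D x)) (at x)))"

definition radiation_defect ::
    "complex \<Rightarrow> ('a::euclidean_space \<Rightarrow> complex) \<Rightarrow> 'a \<Rightarrow> complex" where
  "radiation_defect k u x =
     frechet_derivative u (at x) (x /\<^sub>R norm x) - \<i> * k * u x"

definition outgoing_radiation ::
    "complex \<Rightarrow> ('a::euclidean_space \<Rightarrow> complex) \<Rightarrow> bool" where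
  "outgoing_radiation k u \<longleftrightarrow>
     (\<exists>K. compact K \<and> C1_on (- K) u) \<and>
     ((\<lambda>x. of_real (norm x powr ((real DIM('a) - 1) / 2)) * radiation_defect k u x)
        \<longlongrightarrow> 0) at_infinity"

section \<open>Schauder classes and domains of class \<open>C\<^sup>1\<^sup>,\<^sup>\<alpha>\<close>\<close>

definition holder_on ::
    "real \<Rightarrow> 'a::metric_space set \<Rightarrow> ('a \<Rightarrow> 'b::real_normed_vector) \<Rightarrow> bool" where
  "holder_on \<alpha> S f \<longleftrightarrow>
     (\<exists>C. \<forall>x\<in>S. \<forall>y\<in>S. norm (f x - f y) \<le> C * dist x y powr \<alpha>)"

text \<open>\<open>C1alpha_deriv \<alpha> U f D\<close>: for a bounded open \<open>U\<close>, the function \<open>f\<close> belongs to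
  \<open>C\<^sup>1\<^sup>,\<^sup>\<alpha>\<close> of the closure of \<open>U\<close>, and \<open>D\<close> is the continuous extension of its differential
  to that closure (on which it is uniquely determined).\<close>

definition C1alpha_deriv ::
    "real \<Rightarrow> 'a::euclidean_space set \<Rightarrow> ('a \<Rightarrow> 'b::euclidean_space)
       \<Rightarrow> ('a \<Rightarrow> 'a \<Rightarrow>\<^sub>L 'b) \<Rightarrow> bool" where
  "C1alpha_deriv \<alpha> U f D \<longleftrightarrow>
     continuous_on (closure U) f \<and>
     (\<forall>x\<in>U. (f has_derivative blinfun_apply (D x)) (at x)) \<and>
     holder_on \<alpha> (closure U) D"

definition C1alpha ::
    "real \<Rightarrow> 'a::euclidean_space set \<Rightarrow> ('a \<Rightarrow> 'b::euclidean_space) \<Rightarrow> bool" where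
  "C1alpha \<alpha> U f \<longleftrightarrow> (\<exists>D. C1alpha_deriv \<alpha> U f D)"

definition C1alpha_norm ::
    "real \<Rightarrow> 'a::euclidean_space set \<Rightarrow> ('a \<Rightarrow> 'b::euclidean_space) \<Rightarrow> real" where
  "C1alpha_norm \<alpha> U f =
     (SUP x\<in>U. norm (f x)) +
     (SUP x\<in>U. onorm (frechet_derivative f (at x))) +
     (SUP (x, y)\<in>{(x, y). x \<in> U \<and> y \<in> U \<and> x \<noteq> y}.
        onorm (\<lambda>h. frechet_derivative f (at x) h - frechet_derivative f (at y) h)
          / dist x y powr \<alpha>)"

definition perp :: "'a::euclidean_space \<Rightarrow> 'a \<Rightarrow> 'a" where
  "perp e x = x - (x \<bullet> e) *\<^sub>R e"

text \<open>\<open>Omega\<close> is near \<open>p\<close> a strict hypograph in the direction \<open>e\<close>: inside the coordinate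
  cylinder with axis \<open>e\<close>, radius \<open>r\<close> and half-height \<open>\<delta>\<close> it lies exactly below the graph of
  \<open>\<gamma>\<close>. The space \<open>\<real>\<^sup>n\<^sup>-\<^sup>1\<close> of the usual definition is the hyperplane orthogonal to \<open>e\<close>; functions
  on its balls are handled as functions on balls of the whole space that are constant
  in the direction \<open>e\<close>, which affects neither the Hoelder class nor the norm.\<close>

definition local_hypograph ::
    "real \<Rightarrow> 'a::euclidean_space set \<Rightarrow> 'a \<Rightarrow> 'a \<Rightarrow> real \<Rightarrow> real \<Rightarrow> ('a \<Rightarrow> real) \<Rightarrow> bool" where
  "local_hypograph \<alpha> Omega p e r \<delta> \<gamma> \<longleftrightarrow>
     norm e = 1 \<and> 0 < r \<and> 0 < \<delta> \<and> \<gamma> 0 = 0 \<and>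
     C1alpha \<alpha> (ball 0 r) (\<lambda>x. \<gamma> (perp e x)) \<and>
     (\<forall>h. h \<bullet> e = 0 \<and> norm h \<le> r \<longrightarrow> \<bar>\<gamma> h\<bar> < \<delta>) \<and>
     (\<forall>h s. h \<bullet> e = 0 \<and> norm h < r \<and> \<bar>s\<bar> < \<delta> \<longrightarrow>
        (p + h + s *\<^sub>R e \<in> Omega \<longleftrightarrow> s < \<gamma> h))"

definition class_C1alpha :: "real \<Rightarrow> 'a::euclidean_space set \<Rightarrow> bool" where
  "class_C1alpha \<alpha> Omega \<longleftrightarrow>
     (\<forall>p\<in>frontier Omega. \<exists>e r \<delta> \<gamma>. local_hypograph \<alpha> Omega p e r \<delta> \<gamma>)"

section \<open>Outward normal and surface measure\<close>

definition tangent_vectors :: "'a::euclidean_space set \<Rightarrow> 'a \<Rightarrow> 'a set" where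
  "tangent_vectors S p =
     {w. \<exists>c :: real \<Rightarrow> 'a. c 0 = p \<and> (\<forall>\<^sub>F t in at 0. c t \<in> S) \<and>
          (c has_vector_derivative w) (at 0)}"

definition outward_normal :: "'a::euclidean_space set \<Rightarrow> 'a \<Rightarrow> 'a" where
  "outward_normal Omega p =
     (THE \<nu>. norm \<nu> = 1 \<and> (\<forall>w\<in>tangent_vectors (frontier Omega) p. \<nu> \<bullet> w = 0) \<and>
        (\<forall>\<^sub>F t in at_right 0. p - t *\<^sub>R \<nu> \<in> Omega \<and> p + t *\<^sub>R \<nu> \<notin> closure Omega))"

text \<open>The \<open>m\<close>-dimensional Hausdorff measure (\<open>m \<ge> 1\<close>), with the normalisation under which it
  extends the \<open>m\<close>-dimensional Lebesgue measure. The outer measure is a metric outer measure,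
  hence countably additive on the Borel sets.\<close>

definition hausdorff_content :: "nat \<Rightarrow> real \<Rightarrow> 'a::euclidean_space set \<Rightarrow> ennreal" where
  "hausdorff_content m \<delta> A =
     (INF C\<in>{C :: nat \<Rightarrow> 'a set.
               A \<subseteq> (\<Union>i. C i) \<and> (\<forall>i. bounded (C i) \<and> diameter (C i) \<le> \<delta>)}.
        \<Sum>i. ennreal (unit_ball_vol (real m) * (diameter (C i) / 2) ^ m))"

definition hausdorff_outer :: "nat \<Rightarrow> 'a::euclidean_space set \<Rightarrow> ennreal" where
  "hausdorff_outer m A = (SUP \<delta>\<in>{0<..}. hausdorff_content m \<delta> A)"

definition hausdorff_measure :: "nat \<Rightarrow> 'a::euclidean_space measure" where
  "hausdorff_measure m = measure_of UNIV (sets borel) (hausdorff_outer m)"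

definition surface_measure :: "'a::euclidean_space set \<Rightarrow> 'a measure" where
  "surface_measure Omega =
     completion (restrict_space (hausdorff_measure (DIM('a) - 1)) (frontier Omega))"

section \<open>The space \<open>C\<^sup>1\<^sup>,\<^sup>\<alpha>\<close> on the boundary and its dual\<close>

text \<open>Functions on the boundary are total functions of which only the values on
  \<open>frontier Omega\<close> matter. A boundary patch is the graph parametrisation \<open>\<Phi>\<close> attached to a local
  hypograph, again constant in the direction \<open>e\<close>.\<close>

definition boundary_patch ::
    "real \<Rightarrow> 'a::euclidean_space set \<Rightarrow> real \<Rightarrow> ('a \<Rightarrow> 'a) \<Rightarrow> bool" where
  "boundary_patch \<alpha> Omega r \<Phi> \<longleftrightarrow>
     (\<exists>p\<in>frontier Omega. \<exists>e \<delta> \<gamma>. local_hypograph \<alpha> Omega p e r \<delta> \<gamma> \<and>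
        \<Phi> = (\<lambda>x. p + perp e x + \<gamma> (perp e x) *\<^sub>R e))"

definition boundary_atlas ::
    "real \<Rightarrow> 'a::euclidean_space set \<Rightarrow> (real \<times> ('a \<Rightarrow> 'a)) set \<Rightarrow> bool" where
  "boundary_atlas \<alpha> Omega A \<longleftrightarrow>
     finite A \<and> (\<forall>(r, \<Phi>)\<in>A. boundary_patch \<alpha> Omega r \<Phi>) \<and>
     frontier Omega \<subseteq> (\<Union>(r, \<Phi>)\<in>A. \<Phi> ` ball 0 r)"

definition C1alpha_boundary ::
    "real \<Rightarrow> 'a::euclidean_space set \<Rightarrow> ('a \<Rightarrow> complex) set" where
  "C1alpha_boundary \<alpha> Omega =
     {f. \<forall>r \<Phi>. boundary_patch \<alpha> Omega r \<Phi> \<longrightarrow> C1alpha \<alpha> (ball 0 r) (\<lambda>x. f (\<Phi> x))}"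

definition C1alpha_boundary_norm ::
    "real \<Rightarrow> (real \<times> ('a::euclidean_space \<Rightarrow> 'a)) set \<Rightarrow> ('a \<Rightarrow> complex) \<Rightarrow> real" where
  "C1alpha_boundary_norm \<alpha> A f =
     (\<Sum>(r, \<Phi>)\<in>A. C1alpha_norm \<alpha> (ball 0 r) (\<lambda>x. f (\<Phi> x)))"

text \<open>Finite atlases define equivalent norms, so it does not matter which one is used
  to express continuity.\<close>

definition C1alpha_dual ::
    "real \<Rightarrow> 'a::euclidean_space set \<Rightarrow> (('a \<Rightarrow> complex) \<Rightarrow> complex) set" where
  "C1alpha_dual \<alpha> Omega =
     {T. (\<forall>f\<in>C1alpha_boundary \<alpha> Omega. \<forall>g\<in>C1alpha_boundary \<alpha> Omega.
            T (\<lambda>x. f x + g x) = T f + T g) \<and>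
         (\<forall>c. \<forall>f\<in>C1alpha_boundary \<alpha> Omega. T (\<lambda>x. c * f x) = c * T f) \<and>
         (\<exists>A C. boundary_atlas \<alpha> Omega A \<and>
            (\<forall>f\<in>C1alpha_boundary \<alpha> Omega. cmod (T f) \<le> C * C1alpha_boundary_norm \<alpha> A f))}"

section \<open>The space \<open>V\<^sup>-\<^sup>1\<^sup>,\<^sup>\<alpha>\<close>\<close>

definition harmonic_on :: "'a::euclidean_space set \<Rightarrow> ('a \<Rightarrow> complex) \<Rightarrow> bool" where
  "harmonic_on U u \<longleftrightarrow>
     (\<exists>(D :: 'a \<Rightarrow> 'a \<Rightarrow>\<^sub>L complex) (D2 :: 'a \<Rightarrow> 'a \<Rightarrow>\<^sub>L 'a \<Rightarrow>\<^sub>L complex).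
        (\<forall>x\<in>U. (u has_derivative blinfun_apply (D x)) (at x) \<and>
                (D has_derivative blinfun_apply (D2 x)) (at x)) \<and>
        continuous_on U D2 \<and>
        (\<forall>x\<in>U. (\<Sum>b\<in>Basis. blinfun_apply (blinfun_apply (D2 x) b) b) = 0))"

text \<open>The vanishing outside the closure only singles out one total function.\<close>

definition dirichlet_extension ::
    "real \<Rightarrow> 'a::euclidean_space set \<Rightarrow> ('a \<Rightarrow> complex) \<Rightarrow> 'a \<Rightarrow> complex" where
  "dirichlet_extension \<alpha> Omega v =
     (THE u. C1alpha \<alpha> Omega u \<and> harmonic_on Omega u \<and>
        (\<forall>x\<in>frontier Omega. u x = v x) \<and> (\<forall>x. x \<notin> closure Omega \<longrightarrow> u x = 0))"

definition normal_derivative ::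
    "real \<Rightarrow> 'a::euclidean_space set \<Rightarrow> ('a \<Rightarrow> complex) \<Rightarrow> 'a \<Rightarrow> complex" where
  "normal_derivative \<alpha> Omega u p =
     (THE c. \<exists>D. C1alpha_deriv \<alpha> Omega u D \<and> c = blinfun_apply (D p) (outward_normal Omega p))"

definition S_plus ::
    "real \<Rightarrow> 'a::euclidean_space set \<Rightarrow> ('a \<Rightarrow> complex) \<Rightarrow> 'a \<Rightarrow> complex" where
  "S_plus \<alpha> Omega v = normal_derivative \<alpha> Omega (dirichlet_extension \<alpha> Omega v)"

text \<open>The functionals \<open>\<mu>\<^sub>0 + S\<^sup>t[\<mu>\<^sub>1]\<close> with Hoelder continuous densities, as elements of the dual of
  \<open>C\<^sup>1\<^sup>,\<^sup>\<alpha>\<close>. Every such functional is continuous, by the Schauder estimates for the Dirichlet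
  problem, so membership in the dual is no restriction.\<close>

definition V_minus1 ::
    "real \<Rightarrow> 'a::euclidean_space set \<Rightarrow> (('a \<Rightarrow> complex) \<Rightarrow> complex) set" where
  "V_minus1 \<alpha> Omega =
     {T \<in> C1alpha_dual \<alpha> Omega.
        \<exists>\<mu>\<^sub>0 \<mu>\<^sub>1. holder_on \<alpha> (frontier Omega) \<mu>\<^sub>0 \<and> holder_on \<alpha> (frontier Omega) \<mu>\<^sub>1 \<and>
          (\<forall>v\<in>C1alpha_boundary \<alpha> Omega.
             T v = (LINT y|surface_measure Omega. \<mu>\<^sub>0 y * v y)
                 + (LINT y|surface_measure Omega. \<mu>\<^sub>1 y * S_plus \<alpha> Omega v y))}"

section \<open>Layer potentials\<close>

text \<open>Both potentials are considered off \<open>frontier Omega\<close> only; their values on it are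
  irrelevant.\<close>

definition single_layer ::
    "complex \<Rightarrow> (('a::euclidean_space \<Rightarrow> complex) \<Rightarrow> complex) \<Rightarrow> 'a \<Rightarrow> complex" where
  "single_layer k T x = T (\<lambda>y. fund_sol k (x - y))"

definition double_layer ::
    "complex \<Rightarrow> 'a::euclidean_space set \<Rightarrow> ('a \<Rightarrow> complex) \<Rightarrow> 'a \<Rightarrow> complex" where
  "double_layer k Omega \<mu> x =
     (LINT y|surface_measure Omega.
        - frechet_derivative (fund_sol k) (at (x - y)) (outward_normal Omega y) * \<mu> y)"

end

theory Submission
  imports Defs "HOL-Complex_Analysis.Complex_Analysis" "HOL-Real_Asymp.Real_Asymp"
begin

text \<open>The Hankel function of order \<open>\<nu>\<close> at \<open>z\<close> is, up to a constant, \<open>exp (\<i> z)\<close> times the square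
  root of \<open>w = \<i> / z\<close> times a Laplace type integral in \<open>w\<close> that is holomorphic and bounded near \<open>0\<close>
  in a sector. On the imaginary axis and for non-integer orders this is a rearrangement of the Bessel
  series; analytic continuation in \<open>w\<close> and a limit in \<open>\<nu>\<close> give the general case. Hence the
  fundamental solution is \<open>exp (\<i> k |x|)\<close> times a symbol of order \<open>- (n - 1) / 2\<close>: each radial
  derivative of the symbol gains a factor \<open>1 / |x|\<close>. The radial derivative minus \<open>\<i> k\<close> only hits the
  symbol, and for a source point \<open>y\<close> in a bounded set the direction of \<open>x - y\<close> differs from that of
  \<open>x\<close> by \<open>O(1 / |x|)\<close>, so the radiation defect of the kernel gains \<open>1 / |x|\<close>, together with its
  derivatives in \<open>y\<close>. Both layer potentials are functionals of the kernel in \<open>y\<close> that are bounded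
  by \<open>C\<^sup>1\<close> norms with Lipschitz derivative.\<close>

section \<open>Incomplete Gamma functions\<close>

text \<open>The Hankel function is given by its Bessel series, which says nothing about decay at
  infinity, so an integral has to be extracted from the series. The Gamma integral in the reflected
  series is cut at \<open>r\<close>, the fixed point of \<open>x \<mapsto> r^2 / x\<close>; this
  choice makes the lower part symmetric in the two summation indices, while the upper part sums to
  an exponential. Integer orders, which occur in even dimensions, are reachable only as limits
  because of a factor \<open>1 / sin\<close>. Real \<open>k\<close> puts
  \<open>\<i> / (k * r)\<close> on the boundary of the right half plane; the symbol therefore lives
  on a wider sector, which leaves room for discs of radius proportional to \<open>r\<close> and
  hence for Cauchy's inequality. The functionals are abstract, so derivatives are not moved under
  them by dominated convergence: the Taylor remainder of the kernel is estimated in the test norm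
  instead. Decay comes from the symbol in \<open>norm x\<close>, whereas differentiability is read
  off from a second representation, in \<open>x \<bullet> x\<close>, whose derivatives involve only
  inner products.\<close>

lemma rGamma_shift_bounded:
  fixes R :: real
  shows "\<exists>C. \<forall>\<nu> m. norm (\<nu>::complex) \<le> R \<longrightarrow> norm (rGamma (\<nu> + of_nat m + 1)) \<le> C"
proof -
  \<comment> \<open>Once the index exceeds \<open>N\<close>, the factor
    \<open>w = \<nu> + m + 1\<close> has modulus at least 1, so
    \<open>rGamma w = w * rGamma (w + 1)\<close> makes the moduli nonincreasing; the finitely many
    earlier values are bounded by compactness.\<close>
  define N where "N = nat \<lceil>\<bar>R\<bar>\<rceil> + 1"
  have "\<exists>B. \<forall>\<nu>\<in>cball 0 R. norm (rGamma (\<nu> + of_nat m + 1 :: complex)) \<le> B" for m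
  proof -
    have "compact ((\<lambda>\<nu>. rGamma (\<nu> + of_nat m + 1 :: complex)) ` cball 0 R)"
      by (intro compact_continuous_image continuous_on_compose2[OF continuous_on_rGamma] continuous_intros) auto
    then show ?thesis
      by (meson bounded_iff compact_imp_bounded imageI)
  qed
  then obtain B where B: "\<And>m \<nu>. norm \<nu> \<le> R \<Longrightarrow> norm (rGamma (\<nu> + of_nat m + 1 :: complex)) \<le> B m"
    by (metis mem_cball_0)
  define C where "C = (\<Sum>m\<le>N. \<bar>B m\<bar>) + 1"
  have "norm (rGamma (\<nu> + of_nat m + 1)) \<le> C" if nu: "norm \<nu> \<le> R" for \<nu> :: complex and m
  proof (induction m)
    case 0
    have "B 0 \<le> (\<Sum>m\<le>N. \<bar>B m\<bar>)"
      by (rule order_trans[OF abs_ge_self member_le_sum[of 0 "{..N}" "\<lambda>m. \<bar>B m\<bar>"]]) auto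
    with B[OF nu, of 0] show ?case by (simp add: C_def)
  next
    case (Suc m)
    show ?case
    proof (cases "Suc m \<le> N")
      case True
      have "B (Suc m) \<le> (\<Sum>m\<le>N. \<bar>B m\<bar>)"
        by (rule order_trans[OF abs_ge_self member_le_sum[of "Suc m" "{..N}" "\<lambda>m. \<bar>B m\<bar>"]]) (use True in auto)
      with B[OF nu, of "Suc m"] show ?thesis by (simp add: C_def)
    next
      case False
      define w where "w = \<nu> + of_nat m + 1"
      have "of_nat m + 1 - norm \<nu> \<le> norm w"
        using norm_triangle_ineq2[of "of_nat m + 1" "-\<nu>"] unfolding w_def
        by (metis (no_types, lifting) add.commute add_diff_cancel_right' diff_minus_eq_add norm_minus_cancel
            norm_of_nat of_nat_Suc ab_semigroup_add_class.add_ac(1))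
      moreover have "real m \<ge> R"
        using False unfolding N_def by linarith
      ultimately have w1: "norm w \<ge> 1" using nu by linarith
      have "norm (rGamma (w + 1)) \<le> norm w * norm (rGamma (w + 1))"
        using w1 by (simp add: mult_le_cancel_right1)
      also have "\<dots> = norm (rGamma w)"
        by (metis norm_mult rGamma_plus1)
      also have "\<dots> \<le> C" using Suc by (simp add: w_def)
      finally show ?thesis by (simp add: w_def add_ac)
    qed
  qed
  then show ?thesis by blast
qed

text \<open>Multiplied by \<open>r powr a\<close> this is the lower incomplete Gamma function. The
  series makes sense for every non-integer \<open>a\<close>, also where the integral from 0 to
  \<open>r\<close> diverges.\<close>

definition lower_series :: "complex \<Rightarrow> real \<Rightarrow> complex" where
  "lower_series a r = (\<Sum>j. (- of_real r) ^ j / (fact j * (of_nat j + a)))"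

definition upper_Gamma :: "complex \<Rightarrow> real \<Rightarrow> complex" where
  "upper_Gamma a r = integral {r<..} (\<lambda>t. of_real t powr (a - 1) / of_real (exp t))"

lemma non_int_dist:
  fixes a :: complex
  assumes "a \<notin> \<int>"
  obtains d where "d > 0" "\<And>n. norm (of_int n + a) \<ge> d"
proof -
  have "closed (\<int> :: complex set)" by (rule closed_Ints)
  then obtain d where d: "d > 0" "\<And>y. y \<in> \<int> \<Longrightarrow> d \<le> dist a y"
    using separate_point_closed[OF _ assms] by blast
  have "norm (of_int n + a) \<ge> d" for n
    using d(2)[of "- of_int n"] by (simp add: dist_norm add.commute)
  with d(1) that show thesis by blast
qed

text \<open>The point \<open>a\<close> has positive distance from the closed set of integers, so the
  denominators stay away from 0 and the exponential series dominates.\<close>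

lemma lower_series_summable:
  fixes a z :: complex
  assumes "a \<notin> \<int>"
  shows "summable (\<lambda>j. norm (z ^ j / (fact j * (of_nat j + a))))"
proof -
  obtain d where d: "d > 0" "\<And>n. norm (of_int n + a) \<ge> d"
    using non_int_dist[OF assms] by blast
  have "summable (\<lambda>j. (inverse (fact j) * norm z ^ j) / d)"
    by (intro summable_divide summable_exp)
  then show ?thesis
  proof (rule summable_comparison_test')
    fix j :: nat assume "j \<ge> 0"
    have "norm (of_nat j + a) \<ge> d" using d(2)[of "int j"] by simp
    then have "(inverse (fact j) * norm z ^ j) / norm (of_nat j + a) \<le> (inverse (fact j) * norm z ^ j) / d"
      using d(1) by (intro divide_left_mono mult_pos_pos) auto
    moreover have "norm (norm (z ^ j / (fact j * (of_nat j + a)))) = (inverse (fact j) * norm z ^ j) / norm (of_nat j + a)"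
      by (simp add: norm_divide norm_mult norm_power divide_simps)
    ultimately show "norm (norm (z ^ j / (fact j * (of_nat j + a)))) \<le> inverse (fact j) * norm z ^ j / d"
      by simp
  qed
qed

text \<open>In \<open>a / (j + a) = 1 - j / (j + a)\<close> the first summand gives the exponential
  and the second, after an index shift, the series at \<open>a + 1\<close>. This is integration by
  parts in a form that survives for \<open>Re a \<le> 0\<close>.\<close>

lemma lower_series_step:
  assumes a: "a \<notin> \<int>"
  shows "a * lower_series a r = exp (- of_real r) + of_real r * lower_series (a + 1) r"
proof -
  have nz: "of_nat j + a \<noteq> 0" for j
    using a by (metis Ints_of_nat add.commute add_0 add_diff_cancel_left' diff_zero Ints_minus minus_diff_eq)
  define c where "c j = (- of_real r) ^ j / (fact j * (of_nat j + a))" for j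
  have sc: "summable c"
    using summable_norm_cancel[OF lower_series_summable[OF a, of "- of_real r"]] by (simp add: c_def[abs_def])
  have a1: "a + 1 \<notin> \<int>" using a by (metis Ints_1 Ints_diff add_diff_cancel_right')
  have s1: "summable (\<lambda>j. (- of_real r) ^ j / (fact j * (of_nat j + (a + 1))))"
    using summable_norm_cancel[OF lower_series_summable[OF a1, of "- of_real r"]] by simp
  have e: "of_nat (Suc j) * c (Suc j) = - of_real r * ((- of_real r) ^ j / (fact j * (of_nat j + (a + 1))))" for j
    by (simp add: c_def divide_simps del: of_nat_Suc) (simp add: algebra_simps)
  have s2: "(\<lambda>j. of_nat (Suc j) * c (Suc j)) sums (- of_real r * lower_series (a + 1) r)"
    unfolding e lower_series_def by (intro sums_mult summable_sums s1)
  have s3: "(\<lambda>j. of_nat j * c j) sums (- of_real r * lower_series (a + 1) r)"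
    using sums_Suc[OF s2] by simp
  have s4: "(\<lambda>j. (- of_real r) ^ j /\<^sub>R fact j) sums exp (- of_real r :: complex)"
    by (rule exp_converges)
  have "(\<lambda>j. (- of_real r) ^ j /\<^sub>R fact j - of_nat j * c j) sums (exp (- of_real r) - (- of_real r * lower_series (a + 1) r))"
    by (rule sums_diff[OF s4 s3])
  moreover have "(- of_real r) ^ j /\<^sub>R fact j - of_nat j * c j = a * c j" for j
    using nz[of j] by (simp add: c_def scaleR_conv_of_real divide_simps) (simp add: algebra_simps)
  ultimately have "(\<lambda>j. a * c j) sums (exp (- of_real r) - (- of_real r * lower_series (a + 1) r))"
    by simp
  moreover have "(\<lambda>j. a * c j) sums (a * lower_series a r)"
    unfolding lower_series_def c_def[symmetric] by (intro sums_mult summable_sums sc)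
  ultimately show ?thesis using sums_unique2 by fastforce
qed

lemma upper_Gamma_absolutely_integrable:
  assumes r: "r > 0"
  shows "(\<lambda>t. complex_of_real t powr (a - 1) / of_real (exp t)) absolutely_integrable_on {r<..}"
proof -
  \<comment> \<open>Raising the exponent to \<open>b\<close> makes the Gamma integral converge at 0;
    the remaining factor \<open>t powr (Re a - b)\<close> is nonincreasing, hence at most its value
    at the cut \<open>r\<close>.\<close>
  define b where "b = max 1 (Re a)"
  have m: "set_borel_measurable lebesgue {r<..} (\<lambda>t. complex_of_real t powr (a - 1) / of_real (exp t))"
  proof -
    have "continuous_on {r<..} (\<lambda>t. complex_of_real t powr (a - 1) / of_real (exp t))"
      using r by (intro continuous_intros) auto
    then have "(\<lambda>t. indicator {r<..} t *\<^sub>R (complex_of_real t powr (a - 1) / of_real (exp t)))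
        \<in> borel_measurable borel"
      by (rule borel_measurable_continuous_on_indicator[rotated]) auto
    then show ?thesis unfolding set_borel_measurable_def
      by (simp add: measurable_completion)
  qed
  have i0: "(\<lambda>t. complex_of_real t powr (of_real b - 1) / of_real (exp t)) absolutely_integrable_on {0<..}"
    by (rule absolutely_integrable_Gamma_integral') (simp add: b_def)
  have i1: "(\<lambda>t. complex_of_real t powr (of_real b - 1) / of_real (exp t)) absolutely_integrable_on {r<..}"
    by (rule set_integrable_subset[OF i0]) (use r in auto)
  have i2: "(\<lambda>t. of_real (r powr (Re a - b)) * (complex_of_real t powr (of_real b - 1) / of_real (exp t))) absolutely_integrable_on {r<..}"
    by (rule set_integrable_mult_right[OF i1])
  show ?thesis
  proof (rule set_integrable_bound[OF i2 m], rule AE_I2, rule impI)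
    fix t assume t: "t \<in> {r<..}"
    have "t powr (Re a - 1) = t powr (Re a - b) * t powr (b - 1)"
      by (simp add: powr_add[symmetric])
    also have "\<dots> \<le> r powr (Re a - b) * t powr (b - 1)"
      using r t by (intro mult_right_mono powr_mono2') (auto simp: b_def)
    finally show "norm (complex_of_real t powr (a - 1) / of_real (exp t)) \<le>
        norm (of_real (r powr (Re a - b)) * (complex_of_real t powr (of_real b - 1) / of_real (exp t)))"
      using r t by (simp add: norm_divide norm_mult norm_powr_real_powr divide_right_mono)
  qed
qed

text \<open>Absolute integrability refers to the completed measure, while the fundamental theorem on
  infinite intervals is stated for \<open>lborel\<close>; continuity supplies the Borel
  measurability that links them.\<close>

lemma set_integrable_lborel_of_continuous:
  fixes f :: "real \<Rightarrow> 'b::euclidean_space"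
  assumes "f absolutely_integrable_on S" "continuous_on S f" "S \<in> sets borel"
  shows "set_integrable lborel S f"
proof -
  have "(\<lambda>x. indicator S x *\<^sub>R f x) \<in> borel_measurable borel"
    using borel_measurable_continuous_on_indicator[OF assms(3,2)] .
  then show ?thesis using assms(1) unfolding set_integrable_def
    by (subst (asm) integrable_completion) auto
qed

text \<open>Integration by parts: \<open>F\<close> is an antiderivative of the difference of the two
  integrands and vanishes at infinity, so only the boundary term at \<open>r\<close>
  remains.\<close>

lemma upper_Gamma_step:
  assumes r: "r > 0"
  shows "upper_Gamma (a + 1) r = a * upper_Gamma a r + of_real r powr a * exp (- of_real r)"
proof -
  define F where "F t = - (complex_of_real t powr a / of_real (exp t))" for t
  define f where "f t = complex_of_real t powr a / of_real (exp t) - a * (complex_of_real t powr (a - 1) / of_real (exp t))" for t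
  have i1: "(\<lambda>t. complex_of_real t powr a / of_real (exp t)) absolutely_integrable_on {r<..}"
    using upper_Gamma_absolutely_integrable[OF r, of "a + 1"] by simp
  note i2 = set_integrable_mult_right[OF upper_Gamma_absolutely_integrable[OF r, of a], of a]
  have iF: "f absolutely_integrable_on {r<..}"
    unfolding f_def by (rule set_integral_diff(1)[OF i1 i2])
  have cf: "isCont f t" if "t > r" for t
    unfolding f_def using that r by (intro continuous_intros) auto
  have int: "set_integrable lborel {r<..} f"
    by (rule set_integrable_lborel_of_continuous[OF iF]) (auto intro!: continuous_at_imp_continuous_on cf)
  have dF: "(F has_vector_derivative f t) (at t)" if "t > r" for t
  proof -
    have "((\<lambda>z. - (z powr a * exp (- z))) has_field_derivative
        (of_real t powr a / exp (of_real t) - a * (of_real t powr (a - 1) / exp (of_real t)))) (at (of_real t :: complex))"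
      using that r by (auto intro!: derivative_eq_intros simp: powr_diff exp_minus field_simps)
    from has_vector_derivative_real_field[OF this] show ?thesis
      by (simp add: F_def[abs_def] f_def exp_of_real[symmetric] exp_minus divide_inverse)
  qed
  have l1: "((\<lambda>t. F t) \<longlongrightarrow> F r) (at_right r)"
    unfolding F_def using r by (auto intro!: tendsto_intros)
  have l2: "((\<lambda>t. F t) \<longlongrightarrow> 0) at_top"
  proof (rule tendsto_norm_zero_cancel, rule Lim_transform_eventually)
    show "((\<lambda>t. t powr Re a / exp t) \<longlongrightarrow> 0) at_top" by real_asymp
    show "\<forall>\<^sub>F t in at_top. t powr Re a / exp t = norm (F t)"
      using eventually_gt_at_top[of 0] by eventually_elim (simp add: F_def norm_divide norm_powr_real_powr)
  qed
  have "(LBINT t=ereal r..\<infinity>. f t) = 0 - F r"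
    by (rule interval_integral_FTC_integrable[where F=F])
      (use int dF cf l1 l2 in \<open>simp_all add: ereal_tendsto_simps einterval_eq\<close>)
  then have "integral {r<..} f = - F r"
    using set_borel_integral_eq_integral(2)[OF int] by (simp add: interval_integral_to_infinity_eq)
  moreover have "integral {r<..} f = upper_Gamma (a + 1) r - a * upper_Gamma a r"
    unfolding f_def upper_Gamma_def
    using set_lebesgue_integral_eq_integral(1)[OF i1] set_lebesgue_integral_eq_integral(1)[OF i2]
      by (simp add: Henstock_Kurzweil_Integration.integral_diff del: times_divide_eq_right)
  ultimately show ?thesis
    by (simp add: F_def exp_minus exp_of_real divide_inverse algebra_simps)
qed

text \<open>In place of termwise integration, \<open>S\<close> is recognised as an antiderivative of
  the Gamma integrand for positive \<open>t\<close>, by the differential equation of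
  \<open>P\<close>; \<open>Re a > 0\<close> makes it continuous with value 0 at 0.\<close>

lemma Gamma_split_pos:
  assumes a: "a \<notin> \<int>" "Re a > 0" and r: "r > 0"
  shows "Gamma a = of_real r powr a * lower_series a r + upper_Gamma a r"
proof -
  define c where "c j = (- 1) ^ j / (fact j * (of_nat j + a))" for j :: nat
  have ps: "(\<Sum>j. c j * of_real t ^ j) = lower_series a t" for t
    unfolding lower_series_def c_def by (intro suminf_cong) (simp add: power_minus[of "of_real t"])
  have sm: "summable (\<lambda>j. c j * z ^ j)" for z
    using summable_norm_cancel[OF lower_series_summable[OF a(1), of "- z"]]
    by (simp add: c_def power_minus[of z] mult_ac)
  define P where "P z = (\<Sum>j. c j * z ^ j)" for z
  have dP: "(P has_field_derivative (\<Sum>j. diffs c j * z ^ j)) (at z)" for z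
    unfolding P_def by (rule termdiffs_strong_converges_everywhere[OF sm])
  have "z * (\<Sum>j. diffs c j * z ^ j) + a * P z = exp (- z)" for z
  proof -
    have s1: "(\<lambda>j. of_nat j * c j * z ^ (j - Suc 0)) sums (\<Sum>j. diffs c j * z ^ j)"
      by (rule diffs_equiv[OF termdiff_converges_all[OF sm]])
    have "(\<lambda>j. z * (of_nat j * c j * z ^ (j - Suc 0)) + a * (c j * z ^ j)) sums
        (z * (\<Sum>j. diffs c j * z ^ j) + a * P z)"
      unfolding P_def by (intro sums_add sums_mult s1 summable_sums sm)
    moreover have "z * (of_nat j * c j * z ^ (j - Suc 0)) + a * (c j * z ^ j) = (- z) ^ j /\<^sub>R fact j" for j
    proof -
      have "of_nat j + a \<noteq> 0"
        using a(1) by (metis Ints_of_nat add.commute add_0 add_diff_cancel_left' diff_zero Ints_minus minus_diff_eq)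
      then have "(of_nat j + a) * c j = (- 1) ^ j / fact j" by (simp add: c_def)
      moreover have "z * (of_nat j * c j * z ^ (j - Suc 0)) + a * (c j * z ^ j) = ((of_nat j + a) * c j) * z ^ j"
        by (cases j) (auto simp: algebra_simps)
      ultimately show ?thesis by (simp add: power_minus[of z] scaleR_conv_of_real divide_inverse mult_ac)
    qed
    ultimately show ?thesis using exp_converges[of "- z"] sums_unique2 by fastforce
  qed
  note ode = this
  define S where "S t = complex_of_real t powr a * P (of_real t)" for t
  have dS: "(S has_vector_derivative of_real t powr (a - 1) / of_real (exp t)) (at t)" if "t > 0" for t
  proof -
    have "((\<lambda>z. z powr a * P z) has_field_derivative
        (of_real t powr (a - 1) * exp (- of_real t))) (at (of_real t :: complex))"
      using that unfolding ode[symmetric]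
      by (auto intro!: derivative_eq_intros dP simp: powr_diff field_simps)
    from has_vector_derivative_real_field[OF this] show ?thesis
      by (simp add: S_def[abs_def] exp_of_real[symmetric] exp_minus divide_inverse)
  qed
  have cP: "continuous_on A P" for A
    using dP by (meson DERIV_continuous_on has_field_derivative_at_within)
  have cS: "continuous_on {0..r} S"
    unfolding S_def using a(2)
    by (intro continuous_intros continuous_on_compose2[OF cP[of UNIV]]) auto
  have I1: "((\<lambda>t. of_real t powr (a - 1) / of_real (exp t)) has_integral (S r - S 0)) {0..r}"
    by (rule fundamental_theorem_of_calculus_interior) (use r cS dS in auto)
  have I2: "((\<lambda>t. of_real t powr (a - 1) / of_real (exp t)) has_integral upper_Gamma a r) {r<..}"
    unfolding upper_Gamma_def
    using set_lebesgue_integral_eq_integral(1)[OF upper_Gamma_absolutely_integrable[OF r, of a]]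
    by (rule integrable_integral)
  have "((\<lambda>t. of_real t powr (a - 1) / of_real (exp t)) has_integral (S r - S 0 + upper_Gamma a r)) ({0..r} \<union> {r<..})"
    by (rule has_integral_Un[OF I1 I2]) (auto intro: empty_imp_negligible)
  moreover have "{0..r} \<union> {r<..} = {0..}" using r by auto
  ultimately have "Gamma a = S r - S 0 + upper_Gamma a r"
    using Gamma_integral_complex[OF a(2)] has_integral_unique by metis
  then show ?thesis using ps[of r] by (simp add: S_def P_def)
qed

text \<open>The formula at \<open>a + 1\<close> is \<open>a\<close> times the formula at
  \<open>a\<close>, since the boundary terms \<open>r powr a * exp (- r)\<close> of the two
  recurrences cancel. Each induction step thus extends the half plane of validity by 1 to the
  left.\<close>

lemma Gamma_split:
  assumes "a \<notin> \<int>" and r: "r > 0"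
  shows "Gamma a = of_real r powr a * lower_series a r + upper_Gamma a r"
proof -
  have "a \<notin> \<int> \<Longrightarrow> Re a > - real n \<Longrightarrow> ?thesis" for n
  proof (induction n arbitrary: a)
    case 0
    then show ?case using Gamma_split_pos[OF _ _ r] by simp
  next
    case (Suc n)
    have a0: "a \<noteq> 0" using Suc.prems by auto
    have a1: "a + 1 \<notin> \<int>" using Suc.prems by (metis Ints_1 Ints_diff add_diff_cancel_right')
    have "a * Gamma a = Gamma (a + 1)"
      using Suc.prems(1) by (metis Gamma_plus1 nonpos_Ints_Int)
    also have "\<dots> = of_real r powr (a + 1) * lower_series (a + 1) r + upper_Gamma (a + 1) r"
      using Suc.prems a1 by (intro Suc.IH) auto
    also have "\<dots> = of_real r powr a * (of_real r * lower_series (a + 1) r + exp (- of_real r)) + a * upper_Gamma a r"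
      using r by (simp add: upper_Gamma_step[OF r] powr_add algebra_simps del: add.commute)
    also have "\<dots> = a * (of_real r powr a * lower_series a r + upper_Gamma a r)"
      unfolding distrib_left[of a] mult.left_commute[of a] lower_series_step[OF Suc.prems(1), of r]
      by (simp add: algebra_simps)
    finally show ?case using a0 by simp
  qed
  moreover obtain n :: nat where "real n > - Re a" using reals_Archimedean2 by blast
  ultimately show ?thesis using assms by (metis minus_less_iff)
qed

section \<open>The connection formula for modified Bessel functions\<close>

text \<open>Splitting \<open>Gamma (- \<nu> - m)\<close> at \<open>r\<close> in the reflected Bessel series gives this double series and an
  integral. Exchanging the two summation indices shows that the double series is odd in \<open>\<nu>\<close>, so it
  drops out of the difference of the Bessel functions of orders \<open>- \<nu>\<close> and \<open>\<nu>\<close>.\<close>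

definition double_series :: "complex \<Rightarrow> real \<Rightarrow> complex" where
  "double_series \<nu> r = (\<Sum>m. (- of_real r) ^ m / fact m * lower_series (- \<nu> - of_nat m) r)"

text \<open>With \<open>x = r * exp s\<close> this is the integral of
  \<open>exp (- 2 * r * cosh s) * exp (- \<nu> * s)\<close> over \<open>s > 0\<close>. Adding the
  value at \<open>- \<nu>\<close> gives twice the Macdonald function of order \<open>\<nu>\<close>
  at \<open>2 * r\<close>.\<close>

definition upper_int :: "complex \<Rightarrow> real \<Rightarrow> complex" where
  "upper_int \<nu> r =
     integral {r<..} (\<lambda>x. of_real (exp (- x - r\<^sup>2 / x) / x) * of_real (r / x) powr \<nu>)"

text \<open>The modified Bessel function of the first kind, of order \<open>\<nu>\<close>, at
  \<open>2 * r\<close>.\<close>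

definition bessel_I_series :: "complex \<Rightarrow> real \<Rightarrow> complex" where
  "bessel_I_series \<nu> r =
     of_real r powr \<nu> * (\<Sum>m. of_real r ^ (2 * m) / fact m * rGamma (\<nu> + of_nat m + 1))"

lemma int_shift_not_Ints:
  fixes \<nu> :: complex
  assumes "\<nu> \<notin> \<int>"
  shows "- \<nu> - of_nat m \<notin> \<int>"
  using assms by (metis Ints_minus Ints_of_nat Ints_add diff_add_cancel minus_minus)

lemma double_series_terms:
  assumes nu: "\<nu> \<notin> \<int>"
  shows "summable (\<lambda>m. norm ((- of_real r) ^ m / fact m * lower_series (- \<nu> - of_nat m) r))" (is "?A \<nu>")
    and "double_series (- \<nu>) r = - double_series \<nu> r"
proof -
  define x where "x m = ((- of_real r) ^ m / fact m :: complex)" for m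
  have sx: "summable (\<lambda>m. norm (x m))"
    using summable_exp[of "\<bar>r\<bar>"] by (simp add: x_def norm_divide norm_power norm_mult norm_inverse divide_inverse mult_ac)
  \<comment> \<open>The indices enter through a symmetric product and the difference
    \<open>j - m\<close>, so swapping them while negating \<open>\<nu>\<close> flips the sign. As
    \<open>\<nu>\<close> keeps a distance \<open>d\<close> from the integers, the family is
    dominated by a product of two exponential series, which justifies the exchange.\<close>
  define f where "f \<nu> m j = x m * x j / (of_int (int j - int m) - \<nu>)" for \<nu> m j
  have fb: "\<exists>d>0. \<forall>m j. norm (f \<nu> m j) \<le> norm (x m) * norm (x j) / d" if "\<nu> \<notin> \<int>" for \<nu>
  proof -
    have "- \<nu> \<notin> \<int>" using that Ints_minus[of "-\<nu>"] by auto
    then obtain d where d: "d > 0" "\<And>n. norm (of_int n + (-\<nu>)) \<ge> d"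
      using non_int_dist[of "-\<nu>"] by blast
    have "norm (f \<nu> m j) \<le> norm (x m) * norm (x j) / d" for m j
      unfolding f_def norm_divide norm_mult
      by (intro divide_left_mono mult_pos_pos) (use d(1) d(2)[of "int j - int m"] in \<open>auto simp: less_le_trans\<close>)
    with d(1) show ?thesis by blast
  qed
  have fi: "infsum (f \<nu> m) UNIV = x m * lower_series (- \<nu> - of_nat m) r"
    if nu: "\<nu> \<notin> \<int>" for \<nu> m
  proof -
    have e: "f \<nu> m j = x m * ((- of_real r) ^ j / (fact j * (of_nat j + (- \<nu> - of_nat m))))" for j
      by (simp add: f_def x_def algebra_simps)
    have s: "summable (\<lambda>j. norm (f \<nu> m j))"
      unfolding e norm_mult[of "x m"]
      by (intro summable_mult lower_series_summable int_shift_not_Ints nu)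
    have "infsum (f \<nu> m) UNIV = suminf (f \<nu> m)"
      using norm_summable_imp_has_sum[OF s summable_sums[OF summable_norm_cancel[OF s]]] by (rule infsumI)
    also have "suminf (f \<nu> m) = x m * lower_series (- \<nu> - of_nat m) r"
      unfolding e lower_series_def
      using summable_norm_cancel[OF lower_series_summable[OF int_shift_not_Ints[OF nu]]] by (rule suminf_mult)
    finally show ?thesis .
  qed
  have A: "?A \<nu>" if nu: "\<nu> \<notin> \<int>" for \<nu>
  proof -
    obtain d where d: "d > 0" "\<And>m j. norm (f \<nu> m j) \<le> norm (x m) * norm (x j) / d"
      using fb[OF nu] by blast
    have "summable (\<lambda>m. norm (x m) * (suminf (\<lambda>j. norm (x j)) / d))"
      by (intro summable_mult2 sx)
    moreover have "norm ((- of_real r) ^ m / fact m * lower_series (- \<nu> - of_nat m) r) \<le>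
        norm (x m) * (suminf (\<lambda>j. norm (x j)) / d)" for m
    proof -
    have sj: "summable (\<lambda>j. norm (x m) * norm (x j) / d)"
      by (intro summable_divide summable_mult sx)
    have s: "summable (\<lambda>j. norm (f \<nu> m j))"
      by (rule summable_comparison_test'[OF sj, of 0]) (use d in auto)
    have "infsum (f \<nu> m) UNIV = suminf (f \<nu> m)"
      using norm_summable_imp_has_sum[OF s summable_sums[OF summable_norm_cancel[OF s]]] by (rule infsumI)
    then have "norm (infsum (f \<nu> m) UNIV) \<le> suminf (\<lambda>j. norm (f \<nu> m j))"
      using summable_norm[OF s] by simp
    also have "\<dots> \<le> (\<Sum>j. norm (x m) * norm (x j) / d)"
      by (rule suminf_le[OF d(2) s sj])
    also have "\<dots> = norm (x m) * (suminf (\<lambda>j. norm (x j)) / d)"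
      using suminf_mult[OF sx, of "norm (x m) / d"] by (simp add: mult_ac)
    finally show ?thesis
      unfolding fi[OF nu] x_def .
    qed
    ultimately show ?thesis
      using summable_comparison_test'[of "\<lambda>m. norm (x m) * (suminf (\<lambda>j. norm (x j)) / d)" 0
          "\<lambda>m. norm ((- of_real r) ^ m / fact m * lower_series (- \<nu> - of_nat m) r)"] by simp
  qed
  show "?A \<nu>" by (rule A[OF nu])
  have ds: "double_series \<nu> r = infsum (\<lambda>m. infsum (f \<nu> m) UNIV) UNIV" if nu: "\<nu> \<notin> \<int>" for \<nu>
    unfolding fi[OF nu] double_series_def x_def
    using norm_summable_imp_has_sum[OF A[OF nu] summable_sums[OF summable_norm_cancel[OF A[OF nu]]]]
    by (rule infsumI[symmetric])
  have ff: "f (- \<nu>) m j = - f \<nu> j m" for m j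
    unfolding f_def by (simp add: minus_divide_right algebra_simps)
  have fs: "(\<lambda>(m, j). f \<nu> j m) summable_on (UNIV \<times> UNIV)"
  proof -
    obtain d where d: "d > 0" "\<And>m j. norm (f \<nu> m j) \<le> norm (x m) * norm (x j) / d"
      using fb[OF nu] by blast
    have xs: "((\<lambda>m. norm (x m)) has_sum X) UNIV" if "X = suminf (\<lambda>m. norm (x m))" for X
      using norm_summable_imp_has_sum[of "\<lambda>m. norm (x m)" X] sx that by (simp add: summable_sums)
    have sxx: "(\<lambda>(m, j). norm (x m) * norm (x j) / d) summable_on (UNIV \<times> UNIV)"
    proof (rule summable_on_SigmaI[where g = "\<lambda>m. norm (x m) * suminf (\<lambda>m. norm (x m)) / d"], goal_cases)
      case (1 m)
      show ?case using has_sum_cmult_right[OF xs[OF refl], of "norm (x m) / d"] by (simp add: mult_ac)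
    next
      case 2
      show ?case using has_sum_imp_summable[OF has_sum_cmult_right[OF xs[OF refl], of "suminf (\<lambda>m. norm (x m)) / d"]]
        by (simp add: mult_ac)
    qed (use d(1) in auto)
    have "(\<lambda>(m, j). f \<nu> m j) summable_on (UNIV \<times> UNIV)"
      by (rule abs_summable_summable, rule summable_on_comparison_test[OF sxx]) (use d in auto)
    then show ?thesis
      using summable_on_swap[of "\<lambda>(m, j). f \<nu> m j" UNIV UNIV] by simp
  qed
  have nu': "- \<nu> \<notin> \<int>" using nu Ints_minus[of "-\<nu>"] by auto
  have "double_series (- \<nu>) r = - infsum (\<lambda>m. infsum (\<lambda>j. f \<nu> j m) UNIV) UNIV"
  proof -
    have "f (- \<nu>) m = (\<lambda>j. - f \<nu> j m)" for m using ff by blast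
    then show ?thesis by (simp add: ds[OF nu'] infsum_uminus)
  qed
  also have "infsum (\<lambda>m. infsum (\<lambda>j. f \<nu> j m) UNIV) UNIV = double_series \<nu> r"
    unfolding ds[OF nu] by (rule infsum_swap_banach[OF fs])
  finally show "double_series (- \<nu>) r = - double_series \<nu> r" .
qed

text \<open>Under the integral the sum over \<open>m\<close> is the exponential series of
  \<open>- r^2 / x\<close>. Sum and integral may be exchanged because \<open>x > r\<close> bounds
  \<open>r^(2 * m) / x^m\<close> by \<open>r^m\<close>, so that an exponential series times the
  integrable \<open>h\<close> is a majorant.\<close>

lemma upper_Gamma_sums:
  assumes r: "r > 0"
  shows "(\<lambda>m. (- 1) ^ m * of_real r powr \<nu> * of_real r ^ (2 * m) / fact m * upper_Gamma (- \<nu> - of_nat m) r)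
     sums upper_int \<nu> r"
    and "(\<lambda>x. of_real (exp (- x - r\<^sup>2 / x) / x) * of_real (r / x) powr \<nu>) absolutely_integrable_on {r<..}"
proof -
  define g where "g m x = (- 1) ^ m * of_real r powr \<nu> * of_real r ^ (2 * m) / fact m *
      (complex_of_real x powr ((- \<nu> - of_nat m) - 1) / of_real (exp x))" for m x
  define h where "h x = norm (complex_of_real r powr \<nu> * (of_real x powr (- \<nu> - 1) / of_real (exp x)))" for x
  have int: "set_integrable lebesgue {r<..} (g m)" for m
    unfolding g_def by (intro set_integrable_mult_right upper_Gamma_absolutely_integrable r)
  have inth: "set_integrable lebesgue {r<..} h"
    unfolding h_def using upper_Gamma_absolutely_integrable[OF r, of "-\<nu>"]
    by (intro set_integrable_norm set_integrable_mult_right) simp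
  have geq: "g m x = ((- of_real (r\<^sup>2 / x)) ^ m /\<^sub>R fact m) * (of_real (exp (- x) / x) * of_real (r / x) powr \<nu>)"
    if "x > r" for m x
  proof -
    have e1: "complex_of_real x powr ((- \<nu> - of_nat m) - 1) = (of_real x powr - \<nu>) / of_real x ^ m / of_real x"
      using that r by (simp add: powr_diff powr_minus powr_nat)
    have e2: "of_real (r / x) powr \<nu> = of_real r powr \<nu> * complex_of_real x powr - \<nu>"
      using that r by (simp add: powr_def Ln_of_real ln_div exp_add[symmetric] right_diff_distrib flip: of_real_divide)
    have e3: "(- complex_of_real (r\<^sup>2 / x)) ^ m = (- 1) ^ m * (of_real r ^ (2 * m) / of_real x ^ m)"
      unfolding power_minus[of "complex_of_real (r\<^sup>2 / x)"] by (simp add: power_divide power_mult)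
    have e4: "complex_of_real (exp (- x) / x) = 1 / of_real (exp x) / of_real x"
      by (simp add: exp_minus field_simps)
    show ?thesis
      unfolding g_def e1 e2 e3 e4 scaleR_conv_of_real by (simp add: field_simps)
  qed
  have gb: "norm (g m x) \<le> (r ^ m / fact m) * h x" if "x > r" for m x
  proof -
    have x: "x > 0" using that r by simp
    have "r ^ (2 * m) * inverse (x ^ m) \<le> r ^ m"
    proof -
      have "r ^ m * r ^ m \<le> r ^ m * x ^ m" using that r by (intro mult_left_mono power_mono) auto
      then show ?thesis using x by (simp add: power_mult power2_eq_square power_mult_distrib field_simps)
    qed
    moreover have "norm (g m x) = (r ^ (2 * m) * inverse (x ^ m)) / fact m * h x"
    proof -
      have "complex_of_real x powr ((- \<nu> - of_nat m) - 1) = of_real x powr (- \<nu> - 1) * inverse (of_real x ^ m)"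
        using x by (simp add: powr_diff powr_minus powr_nat divide_inverse mult_ac)
      then show ?thesis using r x by (simp add: g_def h_def norm_mult norm_divide norm_power norm_inverse divide_inverse mult_ac)
    qed
    moreover have "h x \<ge> 0" by (simp add: h_def)
    ultimately show ?thesis by (simp add: divide_right_mono mult_right_mono)
  qed
  define G where "G m x = indicator {r<..} x *\<^sub>R g m x" for m x
  have se: "summable (\<lambda>m. r ^ m / fact m * c)" for c
    using summable_exp[of r] by (intro summable_mult2) (simp add: divide_inverse mult_ac)
  have c1: "integrable lebesgue (G m)" for m
    using int[of m] unfolding set_integrable_def G_def .
  have c2: "AE x in lebesgue. summable (\<lambda>m. norm (G m x))"
  proof (rule AE_I2)
    fix x :: real
    show "summable (\<lambda>m. norm (G m x))"
      by (rule summable_comparison_test'[OF se[of "h x"], of 0])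
        (use gb r in \<open>auto simp: indicator_def h_def G_def\<close>)
  qed
  have c3: "summable (\<lambda>m. LINT x|lebesgue. norm (G m x))"
  proof (rule summable_comparison_test'[OF se[of "LINT x:{r<..}|lebesgue. h x"], of 0])
    fix m :: nat
    have "(LINT x|lebesgue. norm (G m x)) \<le> (LINT x|lebesgue. (r ^ m / fact m) * (indicator {r<..} x *\<^sub>R h x))"
    proof (rule integral_mono)
      show "integrable lebesgue (\<lambda>x. norm (G m x))" using c1[of m] by (rule integrable_norm)
      show "integrable lebesgue (\<lambda>x. (r ^ m / fact m) * (indicator {r<..} x *\<^sub>R h x))"
        using inth unfolding set_integrable_def by (rule integrable_mult_right)
      show "norm (G m x) \<le> (r ^ m / fact m) * (indicator {r<..} x *\<^sub>R h x)" for x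
        using gb[of x m] by (auto simp: indicator_def G_def)
    qed
    then show "norm (LINT x|lebesgue. norm (G m x)) \<le> (r ^ m / fact m) * (LINT x:{r<..}|lebesgue. h x)"
      by (simp add: set_lebesgue_integral_def)
  qed
  have "integral\<^sup>L lebesgue (G m) =
      (- 1) ^ m * of_real r powr \<nu> * of_real r ^ (2 * m) / fact m * upper_Gamma (- \<nu> - of_nat m) r" for m
  proof -
    have "integral\<^sup>L lebesgue (G m) = (LINT x:{r<..}|lebesgue. g m x)"
      by (simp add: set_lebesgue_integral_def G_def[abs_def])
    also have "\<dots> = (- 1) ^ m * of_real r powr \<nu> * of_real r ^ (2 * m) / fact m * upper_Gamma (- \<nu> - of_nat m) r"
      unfolding g_def upper_Gamma_def
      using set_lebesgue_integral_eq_integral(2)[OF upper_Gamma_absolutely_integrable[OF r, of "- \<nu> - of_nat m"]]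
      by (subst set_integral_mult_right) simp
    finally show ?thesis .
  qed
  moreover have "(LINT x|lebesgue. (\<Sum>m. G m x)) = upper_int \<nu> r"
    and *: "(\<lambda>x. of_real (exp (- x - r\<^sup>2 / x) / x) * of_real (r / x) powr \<nu>) absolutely_integrable_on {r<..}"
  proof -
    define f where "f x = of_real (exp (- x - r\<^sup>2 / x) / x) * of_real (r / x) powr \<nu>" for x
    have s: "(\<Sum>m. g m x) = f x" if "x > r" for x
    proof -
      have "(\<lambda>m. g m x) sums (exp (- of_real (r\<^sup>2 / x)) * (of_real (exp (- x) / x) * of_real (r / x) powr \<nu>))"
        unfolding geq[OF that] by (intro sums_mult2 exp_converges)
      moreover have "exp (- complex_of_real (r\<^sup>2 / x)) * of_real (exp (- x)) = of_real (exp (- x - r\<^sup>2 / x))"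
        unfolding of_real_minus[symmetric] exp_of_real of_real_mult[symmetric] exp_add[symmetric]
        by (simp add: algebra_simps)
      ultimately show ?thesis
        by (simp add: sums_iff f_def divide_inverse mult_ac)
    qed
    have eq: "(\<Sum>m. G m x) = indicator {r<..} x *\<^sub>R f x" for x
      using s[of x] by (auto simp: G_def indicator_def)
    have "integrable lebesgue (\<lambda>x. indicator {r<..} x *\<^sub>R f x)"
      using integrable_suminf[OF c1 c2 c3] unfolding eq .
    then have int: "f absolutely_integrable_on {r<..}" by (simp add: set_integrable_def)
    then show "(\<lambda>x. of_real (exp (- x - r\<^sup>2 / x) / x) * of_real (r / x) powr \<nu>) absolutely_integrable_on {r<..}"
      by (simp add: f_def[abs_def])
    show "(LINT x|lebesgue. (\<Sum>m. G m x)) = upper_int \<nu> r"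
      using set_lebesgue_integral_eq_integral(2)[OF int]
      unfolding eq upper_int_def f_def by (simp add: set_lebesgue_integral_def)
  qed
  ultimately show "(\<lambda>m. (- 1) ^ m * of_real r powr \<nu> * of_real r ^ (2 * m) / fact m * upper_Gamma (- \<nu> - of_nat m) r)
     sums upper_int \<nu> r" using sums_integral[OF c1 c2 c3] by simp
  show "(\<lambda>x. of_real (exp (- x - r\<^sup>2 / x) / x) * of_real (r / x) powr \<nu>) absolutely_integrable_on {r<..}"
    by (rule *)
qed

lemma sin_shift_nat: "sin (of_real pi * (z + of_nat m) :: complex) = (- 1) ^ m * sin (of_real pi * z)"
proof (induction m)
  case (Suc m)
  have "sin (of_real pi * (z + of_nat (Suc m)) :: complex) = sin (of_real pi * (z + of_nat m) + of_real pi)"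
    by (simp add: algebra_simps)
  also have "\<dots> = - sin (of_real pi * (z + of_nat m))"
    by (simp add: sin_add)
  finally show ?case using Suc by simp
qed simp

text \<open>Euler's reflection formula turns each reciprocal Gamma value into a sine times
  \<open>Gamma (- \<nu> - m)\<close>, which is split at \<open>r\<close>. In the lower part the
  powers of \<open>r\<close> collapse to \<open>r^m\<close>, matching the \<open>r^j\<close> inside
  the series; this gives the double series its symmetry.\<close>

lemma bessel_I_series_split:
  assumes nu: "\<nu> \<notin> \<int>" and r: "r > 0"
  shows "bessel_I_series \<nu> r = - (sin (of_real pi * \<nu>) / of_real pi) * (double_series \<nu> r + upper_int \<nu> r)"
proof -
  define S where "S = - (sin (of_real pi * \<nu>) / of_real pi)"
  define t1 where "t1 m = (- of_real r) ^ m / fact m * lower_series (- \<nu> - of_nat m) r" for m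
  define t2 where "t2 m = (- 1) ^ m * of_real r powr \<nu> * of_real r ^ (2 * m) / fact m * upper_Gamma (- \<nu> - of_nat m) r" for m
  have "of_real r powr \<nu> * (of_real r ^ (2 * m) / fact m * rGamma (\<nu> + of_nat m + 1)) = S * (t1 m + t2 m)" for m
  proof -
    define a where "a = - \<nu> - of_nat m"
    have a: "a \<notin> \<int>" unfolding a_def by (rule int_shift_not_Ints[OF nu])
    have "rGamma a \<noteq> 0" using a by (metis nonpos_Ints_Int rGamma_eq_zero_iff)
    moreover have "rGamma a * rGamma (\<nu> + of_nat m + 1) = sin (of_real pi * a) / of_real pi"
      using rGamma_reflection_complex[of a] by (simp add: a_def algebra_simps)
    ultimately have "rGamma (\<nu> + of_nat m + 1) = Gamma a * (sin (of_real pi * a) / of_real pi)"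
      by (simp add: Gamma_def field_simps)
    also have "sin (of_real pi * a) = - ((- 1) ^ m * sin (of_real pi * \<nu>))"
      using sin_shift_nat[of \<nu> m] using sin_minus[of "of_real pi * (\<nu> + of_nat m)"] by (simp add: a_def algebra_simps)
    also have "Gamma a = of_real r powr a * lower_series a r + upper_Gamma a r"
      by (rule Gamma_split[OF a r])
    finally have *: "rGamma (\<nu> + of_nat m + 1) = S * (- 1) ^ m * (of_real r powr a * lower_series a r + upper_Gamma a r)"
      by (simp add: S_def)
    have **: "of_real r powr \<nu> * of_real r ^ (2 * m) * of_real r powr a = (of_real r ^ m :: complex)"
      using r by (simp add: a_def powr_diff powr_minus powr_nat mult_2 power_add)
    have "of_real r powr \<nu> * (of_real r ^ (2 * m) / fact m * rGamma (\<nu> + of_nat m + 1)) =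
       S * ((- 1) ^ m * (of_real r powr \<nu> * of_real r ^ (2 * m) * of_real r powr a) / fact m * lower_series a r
         + (- 1) ^ m * of_real r powr \<nu> * of_real r ^ (2 * m) / fact m * upper_Gamma a r)"
      unfolding * by (simp add: algebra_simps divide_inverse)
    then show ?thesis
      unfolding ** by (simp add: t1_def t2_def a_def power_minus[of "of_real r"])
  qed
  moreover have "(\<lambda>m. S * (t1 m + t2 m)) sums (S * (double_series \<nu> r + upper_int \<nu> r))"
    using summable_sums[OF summable_norm_cancel[OF double_series_terms(1)[OF nu, of r]]] upper_Gamma_sums(1)[OF r, of \<nu>]
    unfolding double_series_def t1_def t2_def by (intro sums_mult sums_add)
  ultimately have "(\<lambda>m. of_real r powr \<nu> * (of_real r ^ (2 * m) / fact m * rGamma (\<nu> + of_nat m + 1)))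
     sums (S * (double_series \<nu> r + upper_int \<nu> r))" by simp
  moreover have "of_real r powr \<nu> \<noteq> (0::complex)" using r by simp
  ultimately have "(\<lambda>m. of_real r ^ (2 * m) / fact m * rGamma (\<nu> + of_nat m + 1))
     sums (S * (double_series \<nu> r + upper_int \<nu> r) / of_real r powr \<nu>)"
    using sums_divide[of "\<lambda>m. of_real r powr \<nu> * (of_real r ^ (2 * m) / fact m * rGamma (\<nu> + of_nat m + 1))"
        _ "of_real r powr \<nu>"] by simp
  from sums_unique[OF this] show ?thesis
    using r by (simp add: bessel_I_series_def S_def field_simps)
qed

text \<open>The sine and the double series are both odd in \<open>\<nu>\<close>, so the product is
  even and cancels in the difference. The result is the classical formula for the Macdonald
  function, with that function given by its integral.\<close>

lemma bessel_I_series_connection: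
  assumes nu: "\<nu> \<notin> \<int>" and r: "r > 0"
  shows "bessel_I_series (- \<nu>) r - bessel_I_series \<nu> r =
    sin (of_real pi * \<nu>) / of_real pi * (upper_int \<nu> r + upper_int (- \<nu>) r)"
proof -
  have nu': "- \<nu> \<notin> \<int>" using nu Ints_minus[of "-\<nu>"] by auto
  show ?thesis
    unfolding bessel_I_series_split[OF nu r] bessel_I_series_split[OF nu' r]
      double_series_terms(2)[OF nu]
    by (simp add: field_simps)
qed

section \<open>An integral representation of the Hankel function\<close>

text \<open>The sector where the argument is below \<open>2 * pi / 3\<close> in modulus. It contains
  the closed right half plane without 0, with an angular margin, and keeps \<open>2 + w\<close> away
  from 0.\<close>

definition slit_sector :: "complex set" where
  "slit_sector = {w. Re w > - norm w / 2}"

lemma slit_sectorD: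
  assumes "w \<in> slit_sector"
  shows "w \<noteq> 0" "w \<notin> \<real>\<^sub>\<le>\<^sub>0" "2 + w \<notin> \<real>\<^sub>\<le>\<^sub>0" "norm (2 + w) \<ge> 1"
proof -
  have w: "2 * Re w > - norm w" using assms by (simp add: slit_sector_def)
  show "w \<noteq> 0" using w by auto
  show *: "w \<notin> \<real>\<^sub>\<le>\<^sub>0"
  proof
    assume "w \<in> \<real>\<^sub>\<le>\<^sub>0"
    then have "norm w = - Re w" "Re w \<le> 0"
      by (auto elim!: nonpos_Reals_cases)
    with w show False by simp
  qed
  then show "2 + w \<notin> \<real>\<^sub>\<le>\<^sub>0"
    by (auto simp: complex_nonpos_Reals_iff)
  have "(norm (2 + w))\<^sup>2 = 4 + 4 * Re w + (norm w)\<^sup>2"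
    by (simp add: cmod_power2) (simp add: power2_eq_square algebra_simps)
  also have "\<dots> \<ge> 4 - 2 * norm w + (norm w)\<^sup>2" using w by simp
  also have "4 - 2 * norm w + (norm w)\<^sup>2 = (norm w - 1)\<^sup>2 + 3"
    by (simp add: power2_eq_square algebra_simps)
  finally have "(norm (2 + w))\<^sup>2 \<ge> 1" using zero_le_power2[of "norm w - 1"] by linarith
  then show "norm (2 + w) \<ge> 1" using power2_le_imp_le[of 1 "norm (2 + w)"] by simp
qed

lemma slit_sector_scale: "w \<in> slit_sector \<Longrightarrow> u > 0 \<Longrightarrow> of_real u * w \<in> slit_sector"
proof -
  assume "w \<in> slit_sector" "u > 0"
  then have "u * Re w > u * (- norm w / 2)"
    by (intro mult_strict_left_mono) (auto simp: slit_sector_def)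
  then show ?thesis using \<open>u > 0\<close> by (simp add: slit_sector_def norm_mult)
qed

lemma open_slit_sector: "open slit_sector"
  unfolding slit_sector_def by (intro open_Collect_less continuous_intros) auto

text \<open>The branch of \<open>s\<close> with \<open>(s + 1 / s) / 2 = 1 + t\<close> that lies outside the unit disc, i.e.
  the exponential of the inverse hyperbolic cosine of \<open>1 + t\<close>.\<close>

definition joukowski :: "complex \<Rightarrow> complex" where
  "joukowski t = 1 + t + csqrt t * csqrt (2 + t)"

lemma joukowski_inverse: "joukowski t * (1 + t - csqrt t * csqrt (2 + t)) = 1"
proof -
  have "joukowski t * (1 + t - csqrt t * csqrt (2 + t)) = (1 + t)\<^sup>2 - (csqrt t)\<^sup>2 * (csqrt (2 + t))\<^sup>2"
    by (simp add: joukowski_def power2_eq_square algebra_simps)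
  also have "\<dots> = 1" unfolding power2_csqrt by (simp add: power2_eq_square algebra_simps)
  finally show ?thesis .
qed

lemma joukowski_nz: "joukowski t \<noteq> 0"
  using joukowski_inverse[of t] by auto

lemma inverse_joukowski: "inverse (joukowski t) = 1 + t - csqrt t * csqrt (2 + t)"
  using joukowski_inverse[of t] by (metis inverse_unique)

lemma norm_joukowski_le:
  "norm (joukowski t) \<le> 2 + 2 * norm t" "norm (inverse (joukowski t)) \<le> 2 + 2 * norm t"
proof -
  have "norm (csqrt t * csqrt (2 + t)) = sqrt (norm t * norm (2 + t))"
    by (simp add: norm_mult real_sqrt_mult)
  also have "\<dots> \<le> sqrt ((1 + norm t)\<^sup>2)"
  proof -
    have "norm t * norm (2 + t) \<le> norm t * (2 + norm t)"
      using norm_triangle_ineq[of 2 t] by (intro mult_left_mono) auto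
    also have "\<dots> \<le> (1 + norm t)\<^sup>2" by (simp add: power2_eq_square algebra_simps)
    finally show ?thesis by (rule real_sqrt_le_mono)
  qed
  finally have 1: "norm (csqrt t * csqrt (2 + t)) \<le> 1 + norm t" by simp
  have 2: "norm (1 + t) \<le> 1 + norm t" using norm_triangle_ineq[of 1 t] by simp
  show "norm (joukowski t) \<le> 2 + 2 * norm t"
    using norm_triangle_ineq[of "1 + t" "csqrt t * csqrt (2 + t)"] 1 2 unfolding joukowski_def by linarith
  show "norm (inverse (joukowski t)) \<le> 2 + 2 * norm t"
    using norm_triangle_ineq4[of "1 + t" "csqrt t * csqrt (2 + t)"] 1 2 unfolding inverse_joukowski by linarith
qed

text \<open>A nonpositive real value \<open>s\<close> would make
  \<open>t = (s + 1 / s) / 2 - 1\<close> real and nonpositive, which the sector excludes. Hence the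
  complex powers in the density are holomorphic there.\<close>

lemma joukowski_not_nonpos:
  assumes "t \<in> slit_sector"
  shows "joukowski t \<notin> \<real>\<^sub>\<le>\<^sub>0"
proof
  assume "joukowski t \<in> \<real>\<^sub>\<le>\<^sub>0"
  then obtain x where x: "joukowski t = of_real x" "x \<le> 0" by (elim nonpos_Reals_cases)
  have "2 * (1 + t) = joukowski t + inverse (joukowski t)"
    unfolding inverse_joukowski by (simp add: joukowski_def)
  also have "\<dots> = of_real (x + inverse x)" using x by simp
  finally have "t = of_real ((x + inverse x) / 2 - 1)"
    by (simp add: field_simps)
  moreover have "(x + y) / 2 - 1 \<le> 0" if "y \<le> 0" for y using x that by simp
  then have "(x + inverse x) / 2 - 1 \<le> 0" using x(2) inverse_nonpositive_iff_nonpositive by blast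
  ultimately have "t \<in> \<real>\<^sub>\<le>\<^sub>0" by (metis nonpos_Reals_of_real_iff)
  with slit_sectorD(2)[OF assms] show False by simp
qed

lemma norm_powr_bound:
  fixes z \<nu> :: complex
  assumes "z \<noteq> 0" "norm z \<le> B" "norm (inverse z) \<le> B"
  shows "norm (z powr \<nu>) \<le> B powr \<bar>Re \<nu>\<bar> * exp (pi * \<bar>Im \<nu>\<bar>)"
proof -
  have B: "B > 0" using assms by (meson less_le_trans zero_less_norm_iff)
  have 1: "ln (norm z) \<le> ln B" using assms B by simp
  have "ln (norm (inverse z)) \<le> ln B" using assms(1,3) B by (subst ln_le_cancel_iff) auto
  then have 2: "- ln (norm z) \<le> ln B" using assms(1) by (simp add: norm_inverse ln_inverse)
  have "Re \<nu> * ln (norm z) \<le> \<bar>Re \<nu>\<bar> * \<bar>ln (norm z)\<bar>" by (metis abs_ge_self abs_mult)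
  also have "\<dots> \<le> \<bar>Re \<nu>\<bar> * ln B" using 1 2 by (intro mult_left_mono) auto
  finally have 3: "Re \<nu> * ln (norm z) \<le> \<bar>Re \<nu>\<bar> * ln B" .
  have "- (Im \<nu> * Im (Ln z)) \<le> \<bar>Im \<nu>\<bar> * \<bar>Im (Ln z)\<bar>" by (metis abs_ge_minus_self abs_mult)
  also have "\<dots> \<le> \<bar>Im \<nu>\<bar> * pi"
    using mpi_less_Im_Ln[OF assms(1)] Im_Ln_le_pi[OF assms(1)] by (intro mult_left_mono) auto
  finally have 4: "- (Im \<nu> * Im (Ln z)) \<le> pi * \<bar>Im \<nu>\<bar>" by (simp add: mult.commute)
  have "norm (z powr \<nu>) = exp (Re \<nu> * ln (norm z) - Im \<nu> * Im (Ln z))"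
    using assms(1) by (simp add: powr_def)
  also have "\<dots> \<le> exp (\<bar>Re \<nu>\<bar> * ln B + pi * \<bar>Im \<nu>\<bar>)" using 3 4 by simp
  finally show ?thesis using B by (simp add: powr_def exp_add)
qed

text \<open>With \<open>cosh s = 1 + t\<close> the numerator is \<open>2 * cosh (\<nu> * s)\<close>.
  Since \<open>ds = dt / sqrt (t * (2 + t))\<close>, the factor \<open>sqrt (2 + t)\<close> ends up
  in the denominator; the singular \<open>sqrt t\<close> goes into the weight of
  \<open>hankel_symbol\<close>.\<close>

definition hankel_density :: "complex \<Rightarrow> complex \<Rightarrow> complex" where
  "hankel_density \<nu> t = (joukowski t powr \<nu> + joukowski t powr (- \<nu>)) / csqrt (2 + t)"

lemma hankel_density_bound:
  assumes "t \<in> slit_sector"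
  shows "norm (hankel_density \<nu> t) \<le> 2 * (2 + 2 * norm t) powr \<bar>Re \<nu>\<bar> * exp (pi * \<bar>Im \<nu>\<bar>)"
proof -
  define B where "B = (2 + 2 * norm t) powr \<bar>Re \<nu>\<bar> * exp (pi * \<bar>Im \<nu>\<bar>)"
  have B0: "B \<ge> 0" by (simp add: B_def)
  have "norm (joukowski t powr \<nu> + joukowski t powr (- \<nu>)) \<le> norm (joukowski t powr \<nu>) + norm (joukowski t powr (- \<nu>))"
    by (rule norm_triangle_ineq)
  also have "\<dots> \<le> 2 * B"
    using norm_powr_bound[OF joukowski_nz norm_joukowski_le, of t \<nu>]
      norm_powr_bound[OF joukowski_nz norm_joukowski_le, of t "-\<nu>"] by (simp add: B_def)
  finally have 1: "norm (joukowski t powr \<nu> + joukowski t powr (- \<nu>)) \<le> 2 * B" .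
  have "norm (csqrt (2 + t)) \<ge> 1" using slit_sectorD(4)[OF assms] by simp
  then have "norm (hankel_density \<nu> t) \<le> 2 * B / 1"
    unfolding hankel_density_def norm_divide using 1 B0 by (intro frac_le) auto
  then show ?thesis by (simp add: B_def)
qed

lemma holomorphic_hankel_density: "hankel_density \<nu> holomorphic_on slit_sector"
proof -
  have "joukowski holomorphic_on slit_sector"
    unfolding joukowski_def by (intro holomorphic_intros) (auto dest: slit_sectorD)
  then show ?thesis
    unfolding hankel_density_def
    by (intro holomorphic_intros) (auto dest: slit_sectorD joukowski_not_nonpos)
qed

text \<open>Polynomial growth is paid for by half of the available exponential decay;
  \<open>c = 1 + 2 * N * M\<close> is chosen to make \<open>N * (u * M / c)\<close> at most
  \<open>u / 2\<close>.\<close>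

lemma powr_le_exp_half:
  fixes M N u :: real
  assumes "M \<ge> 0" "N \<ge> 0" "u \<ge> 0"
  shows "(2 + 2 * (u * M)) powr N \<le> (2 * (1 + 2 * N * M)) powr N * exp (u / 2)"
proof -
  define c where "c = 1 + 2 * N * M"
  have c: "c \<ge> 1" using assms by (simp add: c_def)
  have "1 + u * M / c \<le> exp (u * M / c)" by (rule exp_ge_add_one_self)
  moreover have "1 + u * M \<le> c * (1 + u * M / c)" using c by (simp add: field_simps)
  ultimately have "1 + u * M \<le> c * exp (u * M / c)"
    using c by (smt (verit) mult_left_mono)
  then have "(2 + 2 * (u * M)) powr N \<le> (2 * c * exp (u * M / c)) powr N"
    using assms by (intro powr_mono2) auto
  also have "\<dots> = (2 * c) powr N * exp (N * (u * M / c))"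
    using c by (simp add: powr_def ln_mult distrib_left exp_add)
  also have "(2 * c) powr N * exp (N * (u * M / c)) \<le> (2 * c) powr N * exp (u / 2)"
  proof -
    have "N * (u * M / c) \<le> u / 2"
    proof -
    have "u * (2 * N * M) \<le> u * c" using assms by (intro mult_left_mono) (auto simp: c_def)
    then show ?thesis using c by (simp add: field_simps)
    qed
    then show ?thesis by (intro mult_left_mono) auto
  qed
  finally show ?thesis by (simp add: c_def)
qed

section \<open>Holomorphic parameter integrals and the Laplace type integral\<close>

lemma holomorphic_on_integral:
  fixes f :: "complex \<Rightarrow> 'b \<Rightarrow> complex"
  assumes "open P"
    and hol: "\<And>u. u \<in> space M \<Longrightarrow> (\<lambda>w. f w u) holomorphic_on P"
    and meas: "\<And>w. w \<in> P \<Longrightarrow> f w \<in> borel_measurable M"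
    and dom: "\<And>w0. w0 \<in> P \<Longrightarrow> \<exists>r>0. \<exists>G. integrable M G \<and> ball w0 r \<subseteq> P \<and>
       (\<forall>w\<in>ball w0 r. \<forall>u\<in>space M. norm (f w u) \<le> G u)"
  shows "(\<lambda>w. integral\<^sup>L M (f w)) holomorphic_on P"
proof -
  have "(\<lambda>w. integral\<^sup>L M (f w)) field_differentiable (at w0)" if w0: "w0 \<in> P" for w0
  proof -
    obtain r G where r: "r > 0" "integrable M G" "ball w0 r \<subseteq> P"
      and b: "\<And>w u. w \<in> ball w0 r \<Longrightarrow> u \<in> space M \<Longrightarrow> norm (f w u) \<le> G u"
      using dom[OF w0] by metis
    have int: "integrable M (f w)" if "w \<in> ball w0 r" for w
      by (rule Bochner_Integration.integrable_bound[OF r(2) meas])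
        (use that r b in \<open>auto intro!: AE_I2 intro: order_trans[OF _ abs_ge_self]\<close>)
    \<comment> \<open>Cauchy's inequality on circles around \<open>w\<close> of radius below
      \<open>r / 2\<close>, where \<open>G\<close> still dominates, yields an integrable majorant
      for the derivative and then, by the mean value inequality, for the difference
      quotients.\<close>
    have db: "norm (deriv (\<lambda>w. f w u) w) \<le> 2 * G u / r" if u: "u \<in> space M" and w: "w \<in> ball w0 (r / 2)" for u w
    proof -
      have sub: "cball w (r / 2 - \<epsilon>) \<subseteq> ball w0 r" if "\<epsilon> > 0" for \<epsilon>
        using w that by (simp add: cball_subset_ball_iff dist_commute)
      have "norm ((deriv ^^ 1) (\<lambda>w. f w u) w) \<le> fact 1 * G u / \<rho> ^ 1" if \<rho>: "0 < \<rho>" "\<rho> < r / 2" for \<rho>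
      proof (rule Cauchy_inequality)
        have s: "cball w \<rho> \<subseteq> ball w0 r" using sub[of "r / 2 - \<rho>"] \<rho> by simp
        show "(\<lambda>w. f w u) holomorphic_on ball w \<rho>"
          using hol[OF u] s r(3) by (meson ball_subset_cball holomorphic_on_subset order_trans)
        show "continuous_on (cball w \<rho>) (\<lambda>w. f w u)"
          using hol[OF u] s r(3) by (meson holomorphic_on_imp_continuous_on holomorphic_on_subset order_trans)
        show "norm (f x u) \<le> G u" if "norm (w - x) = \<rho>" for x
          using b[of x u] s that u by (auto simp: subset_iff dist_norm)
      qed (use \<rho> in auto)
      then have ev: "\<forall>\<^sub>F \<rho> in at_left (r / 2). norm (deriv (\<lambda>w. f w u) w) \<le> G u / \<rho>"
        using r(1) by (auto simp: eventually_at_left[of 0 "r / 2"] intro!: exI[of _ 0])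
      have "((\<lambda>\<rho>. G u / \<rho>) \<longlongrightarrow> G u / (r / 2)) (at_left (r / 2))"
        using r(1) by (intro tendsto_intros) auto
      from tendsto_lowerbound[OF this ev] show ?thesis by (simp add: mult.commute)
    qed
    have quot: "norm ((f (w0 + h) u - f w0 u) / h) \<le> 2 * G u / r"
      if u: "u \<in> space M" and h: "norm h < r / 2" "h \<noteq> 0" for u h
    proof -
      have "norm (f (w0 + h) u - f w0 u) \<le> (2 * G u / r) * norm (w0 + h - w0)"
      proof (rule field_differentiable_bound[of "ball w0 (r / 2)"])
        show "((\<lambda>w. f w u) has_field_derivative deriv (\<lambda>w. f w u) z) (at z within ball w0 (r / 2))"
          if "z \<in> ball w0 (r / 2)" for z
        proof -
          have "z \<in> P" using that r by auto
          then show ?thesis using hol[OF u] assms(1) by (meson DERIV_subset holomorphic_derivI subset_UNIV has_field_derivative_at_within)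
        qed
      qed (use db[OF u] h r in \<open>auto simp: dist_norm\<close>)
      then show ?thesis using h by (simp add: norm_divide field_simps)
    qed
    define L where "L = (LINT u|M. deriv (\<lambda>w. f w u) w0)"
    have "((\<lambda>h. (integral\<^sup>L M (f (w0 + h)) - integral\<^sup>L M (f w0)) / h) \<longlongrightarrow> L) (at 0)"
      unfolding tendsto_at_iff_sequentially comp_def
    proof (intro allI impI)
      fix X :: "nat \<Rightarrow> complex" assume X: "\<forall>i. X i \<in> UNIV - {0}" "X \<longlonglongrightarrow> 0"
      have "\<forall>\<^sub>F i in sequentially. norm (X i) < r / 2"
        using tendstoD[OF X(2), of "r / 2"] r(1) by simp
      then obtain N where N: "\<And>i. i \<ge> N \<Longrightarrow> norm (X i) < r / 2"
        by (auto simp: eventually_sequentially)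
      define h where "h i = X (i + N)" for i
      have h: "h i \<noteq> 0" "norm (h i) < r / 2" for i using X(1) N[of "i + N"] by (auto simp: h_def)
      have hl: "h \<longlonglongrightarrow> 0" unfolding h_def by (rule LIMSEQ_ignore_initial_segment[OF X(2)])
      have wh: "w0 + h i \<in> ball w0 r" for i
        using h(2)[of i] r(1) by (simp add: dist_norm)
      define q where "q i u = (f (w0 + h i) u - f w0 u) / h i" for i u
      have qm: "q i \<in> borel_measurable M" for i
        unfolding q_def using meas[of "w0 + h i"] meas[OF w0] wh[of i] r(3) by (intro borel_measurable_divide borel_measurable_diff) auto
      have ql: "(\<lambda>i. q i u) \<longlonglongrightarrow> deriv (\<lambda>w. f w u) w0" if u: "u \<in> space M" for u
      proof -
        have "((\<lambda>w. f w u) has_field_derivative deriv (\<lambda>w. f w u) w0) (at w0)"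
          using hol[OF u] assms(1) w0 by (meson holomorphic_derivI)
        then have "((\<lambda>h. (f (w0 + h) u - f w0 u) / h) \<longlongrightarrow> deriv (\<lambda>w. f w u) w0) (at 0)"
          by (simp add: DERIV_def)
        then show ?thesis unfolding q_def using hl h(1)
          by (simp add: tendsto_at_iff_sequentially comp_def)
      qed
      have dm: "(\<lambda>u. deriv (\<lambda>w. f w u) w0) \<in> borel_measurable M"
        by (rule borel_measurable_LIMSEQ_metric[OF qm ql])
      have "(\<lambda>i. integral\<^sup>L M (q i)) \<longlonglongrightarrow> L"
        unfolding L_def
      proof (rule integral_dominated_convergence[where w="\<lambda>u. 2 * G u / r"])
        show "integrable M (\<lambda>u. 2 * G u / r)" using r(2) by simp
        show "AE u in M. norm (q i u) \<le> 2 * G u / r" for i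
          using quot h by (auto simp: q_def)
      qed (use qm dm ql in auto)
      moreover have "integral\<^sup>L M (q i) = (integral\<^sup>L M (f (w0 + h i)) - integral\<^sup>L M (f w0)) / h i" for i
        unfolding q_def using int[OF wh[of i]] int[of w0] r(1) by simp
      ultimately have "(\<lambda>i. (integral\<^sup>L M (f (w0 + X (i + N))) - integral\<^sup>L M (f w0)) / X (i + N)) \<longlonglongrightarrow> L"
        by (simp add: h_def)
      then show "(\<lambda>i. (integral\<^sup>L M (f (w0 + X i)) - integral\<^sup>L M (f w0)) / X i) \<longlonglongrightarrow> L"
        by (rule LIMSEQ_offset)
    qed
    then show ?thesis unfolding field_differentiable_def DERIV_def by blast
  qed
  then show ?thesis
    using assms(1) by (auto simp: holomorphic_on_open field_differentiable_def)
qed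

text \<open>The scaling \<open>t = u * w\<close> with \<open>w = 1 / (2 * r)\<close> extracts
  \<open>exp (- 2 * r) / sqrt (2 * r)\<close> from the Macdonald integral. What is left depends on
  \<open>r\<close> only through \<open>w\<close>, and large arguments correspond to \<open>w\<close>
  near 0.\<close>

definition hankel_symbol :: "complex \<Rightarrow> complex \<Rightarrow> complex" where
  "hankel_symbol \<nu> w =
     (LINT u:{0<..}|lborel. of_real (exp (- u) / sqrt u) * hankel_density \<nu> (of_real u * w))"

lemma integrable_exp_sqrt: "set_integrable lborel {0<..} (\<lambda>u::real. exp (- u / 2) / sqrt u)"
proof (rule set_integrable_lborel_of_continuous)
  have "(\<lambda>u. norm (complex_of_real u powr (1 / 2 - 1) / of_real (exp (1 / 2 * u)))) absolutely_integrable_on {0<..}"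
    by (intro set_integrable_norm absolutely_integrable_Gamma_integral) auto
  then show "(\<lambda>u::real. exp (- u / 2) / sqrt u) absolutely_integrable_on {0<..}"
  proof (rule set_integrable_cong[OF refl refl, THEN iffD1, rotated])
    fix u :: real assume "u \<in> {0<..}"
    then have u: "u > 0" by simp
    have "norm (complex_of_real u powr (1 / 2 - 1)) = u powr - (1 / 2)"
      using u by (subst norm_powr_real_powr) auto
    also have "\<dots> = inverse (sqrt u)"
      using u by (simp only: powr_minus powr_half_sqrt[OF less_imp_le])
    finally have e: "norm (complex_of_real u powr (1 / 2 - 1)) = inverse (sqrt u)" .
    have "norm (complex_of_real (exp (1 / 2 * u))) = exp (u / 2)" by simp
    moreover have "exp (- u / 2) = inverse (exp (u / 2))"
      unfolding exp_minus[symmetric] by simp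
    ultimately show "norm (complex_of_real u powr (1 / 2 - 1) / of_real (exp (1 / 2 * u))) = exp (- u / 2) / sqrt u"
      unfolding norm_divide e by (simp only: divide_inverse mult.commute)
  qed
  show "continuous_on {0<..} (\<lambda>u::real. exp (- u / 2) / sqrt u)"
    by (intro continuous_on_divide continuous_intros) auto
qed auto

text \<open>The majorant depends only on bounds for \<open>w\<close> and for the order, so it serves
  three times: for holomorphy in \<open>w\<close>, for boundedness near \<open>w = 0\<close> and for
  the limit in the order.\<close>

lemma hankel_integrand_bound:
  assumes w: "w \<in> slit_sector" "norm w \<le> M" and u: "u > 0"
    and nu: "\<bar>Re \<nu>\<bar> \<le> N" "\<bar>Im \<nu>\<bar> \<le> I"
  shows "norm (of_real (exp (- u) / sqrt u) * hankel_density \<nu> (of_real u * w)) \<le>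
     2 * (2 * (1 + 2 * N * M)) powr N * exp (pi * I) * (exp (- u / 2) / sqrt u)"
proof -
  have M: "M \<ge> 0" using w(2) norm_ge_zero order_trans by blast
  have N: "N \<ge> 0" using nu(1) by linarith
  have "norm (hankel_density \<nu> (of_real u * w)) \<le>
      2 * (2 + 2 * norm (of_real u * w)) powr \<bar>Re \<nu>\<bar> * exp (pi * \<bar>Im \<nu>\<bar>)"
    by (rule hankel_density_bound[OF slit_sector_scale[OF w(1) u]])
  also have "\<dots> \<le> 2 * (2 + 2 * (u * M)) powr N * exp (pi * I)"
  proof -
    have "(2 + 2 * norm (of_real u * w)) powr \<bar>Re \<nu>\<bar> \<le> (2 + 2 * norm (of_real u * w)) powr N"
      using nu(1) by (intro powr_mono) auto
    also have "\<dots> \<le> (2 + 2 * (u * M)) powr N"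
      using u w(2) N by (intro powr_mono2) (auto simp: norm_mult)
    finally show ?thesis using nu(2) by (intro mult_mono) auto
  qed
  also have "\<dots> \<le> 2 * ((2 * (1 + 2 * N * M)) powr N * exp (u / 2)) * exp (pi * I)"
    using powr_le_exp_half[OF M N, of u] u by (intro mult_right_mono mult_left_mono) auto
  finally have "norm (of_real (exp (- u) / sqrt u) * hankel_density \<nu> (of_real u * w)) \<le>
     exp (- u) / sqrt u * (2 * ((2 * (1 + 2 * N * M)) powr N * exp (u / 2)) * exp (pi * I))"
    unfolding norm_mult norm_of_real
    using mult_left_mono[of _ _ "\<bar>exp (- u) / sqrt u\<bar>"] u by simp
  also have "\<dots> = 2 * (2 * (1 + 2 * N * M)) powr N * exp (pi * I) * (exp (- u) * exp (u / 2) / sqrt u)"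
    by simp
  also have "exp (- u) * exp (u / 2) = exp (- u / 2)"
    by (simp flip: exp_add)
  finally show ?thesis .
qed

lemma hankel_integrand_measurable:
  assumes w: "w \<in> slit_sector"
  shows "(\<lambda>u. indicator {0<..} u *\<^sub>R (of_real (exp (- u) / sqrt u) * hankel_density \<nu> (of_real u * w)))
     \<in> borel_measurable borel"
proof (rule borel_measurable_continuous_on_indicator)
  show "continuous_on {0<..} (\<lambda>u::real. of_real (exp (- u) / sqrt u) * hankel_density \<nu> (of_real u * w))"
    using slit_sector_scale[OF w]
    by (intro continuous_intros continuous_on_compose2[OF holomorphic_on_imp_continuous_on[OF holomorphic_hankel_density]]) auto
qed auto

lemma integrable_exp_sqrt':
  "integrable lborel (\<lambda>u::real. c * (indicator {0<..} u * (exp (- u / 2) / sqrt u)))"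
  using integrable_exp_sqrt unfolding set_integrable_def by (intro integrable_mult_right) simp

lemma holomorphic_hankel_symbol: "hankel_symbol \<nu> holomorphic_on slit_sector"
proof -
  define f where "f w u = indicator {0<..} u *\<^sub>R (of_real (exp (- u) / sqrt u) * hankel_density \<nu> (of_real u * w))"
    for w and u :: real
  have "(\<lambda>w. integral\<^sup>L lborel (f w)) holomorphic_on slit_sector"
  proof (rule holomorphic_on_integral[OF open_slit_sector])
    show "(\<lambda>w. f w u) holomorphic_on slit_sector" for u
    proof (cases "u > 0")
      case True
      have "(\<lambda>w. hankel_density \<nu> (of_real u * w)) holomorphic_on slit_sector"
        using holomorphic_on_compose_gen[of "\<lambda>w. of_real u * w" slit_sector "hankel_density \<nu>" slit_sector]
          slit_sector_scale[OF _ True] holomorphic_hankel_density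
        by (auto simp: comp_def intro!: holomorphic_intros)
      then show ?thesis using True unfolding f_def by (auto intro!: holomorphic_intros)
    qed (simp add: f_def)
    show "f w \<in> borel_measurable lborel" if "w \<in> slit_sector" for w
      using hankel_integrand_measurable[OF that] by (simp add: f_def[abs_def])
    show "\<exists>r>0. \<exists>G. integrable lborel G \<and> ball w0 r \<subseteq> slit_sector \<and>
       (\<forall>w\<in>ball w0 r. \<forall>u\<in>space lborel. norm (f w u) \<le> G u)" if w0: "w0 \<in> slit_sector" for w0
    proof -
      obtain r where r: "r > 0" "ball w0 r \<subseteq> slit_sector"
        using open_slit_sector w0 openE by blast
      define c where "c = 2 * (2 * (1 + 2 * \<bar>Re \<nu>\<bar> * (norm w0 + r))) powr \<bar>Re \<nu>\<bar> * exp (pi * \<bar>Im \<nu>\<bar>)"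
      have "norm (f w u) \<le> c * (indicator {0<..} u * (exp (- u / 2) / sqrt u))" if w: "w \<in> ball w0 r" for w u
      proof (cases "u > 0")
        case True
        have "norm w \<le> norm w0 + r"
          using w norm_triangle_ineq2[of w w0] by (auto simp: dist_norm norm_minus_commute)
        from hankel_integrand_bound[OF _ this True order_refl order_refl] show ?thesis
          using w r True by (auto simp: f_def c_def)
      qed (simp add: f_def)
      with r integrable_exp_sqrt'[of c] show ?thesis by blast
    qed
  qed
  then show ?thesis by (simp add: hankel_symbol_def[abs_def] f_def[abs_def] set_lebesgue_integral_def)
qed

lemma hankel_symbol_bound:
  assumes "w \<in> slit_sector" "norm w \<le> M"
  shows "norm (hankel_symbol \<nu> w) \<le>
     (LINT u|lborel. 2 * (2 * (1 + 2 * \<bar>Re \<nu>\<bar> * M)) powr \<bar>Re \<nu>\<bar> * exp (pi * \<bar>Im \<nu>\<bar>) *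
        (indicator {0<..} u * (exp (- u / 2) / sqrt u)))"
  unfolding hankel_symbol_def set_lebesgue_integral_def
proof (rule Bochner_Integration.integral_norm_bound_integral)
  show "integrable lborel (\<lambda>u. 2 * (2 * (1 + 2 * \<bar>Re \<nu>\<bar> * M)) powr \<bar>Re \<nu>\<bar> * exp (pi * \<bar>Im \<nu>\<bar>) *
        (indicator {0<..} u * (exp (- u / 2) / sqrt u)))"
    by (rule integrable_exp_sqrt')
  show *: "norm (indicator {0<..} u *\<^sub>R (of_real (exp (- u) / sqrt u) * hankel_density \<nu> (of_real u * w))) \<le>
     2 * (2 * (1 + 2 * \<bar>Re \<nu>\<bar> * M)) powr \<bar>Re \<nu>\<bar> * exp (pi * \<bar>Im \<nu>\<bar>) *
        (indicator {0<..} u * (exp (- u / 2) / sqrt u))" for u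
    using hankel_integrand_bound[OF assms _ order_refl order_refl, of u \<nu>] by (auto simp: indicator_def)
  show "integrable lborel (\<lambda>u. indicator {0<..} u *\<^sub>R (of_real (exp (- u) / sqrt u) * hankel_density \<nu> (of_real u * w)))"
  proof (rule Bochner_Integration.integrable_bound[OF integrable_exp_sqrt'[of
        "2 * (2 * (1 + 2 * \<bar>Re \<nu>\<bar> * M)) powr \<bar>Re \<nu>\<bar> * exp (pi * \<bar>Im \<nu>\<bar>)"]])
    show "(\<lambda>u. indicator {0<..} u *\<^sub>R (of_real (exp (- u) / sqrt u) * hankel_density \<nu> (of_real u * w)))
        \<in> borel_measurable lborel"
      using hankel_integrand_measurable[OF assms(1)] by simp
    show "AE u in lborel. norm (indicator {0<..} u *\<^sub>R (of_real (exp (- u) / sqrt u) * hankel_density \<nu> (of_real u * w))) \<le>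
        norm (2 * (2 * (1 + 2 * \<bar>Re \<nu>\<bar> * M)) powr \<bar>Re \<nu>\<bar> * exp (pi * \<bar>Im \<nu>\<bar>) *
        (indicator {0<..} u * (exp (- u / 2) / sqrt u)))"
      unfolding real_norm_def by (intro AE_I2 order_trans[OF * abs_ge_self])
  qed
qed

lemma tendsto_hankel_symbol:
  assumes w: "w \<in> slit_sector"
  shows "((\<lambda>\<xi>. hankel_symbol \<xi> w) \<longlongrightarrow> hankel_symbol \<nu> w) (at \<nu>)"
  unfolding tendsto_at_iff_sequentially comp_def
proof (intro allI impI)
  fix X :: "nat \<Rightarrow> complex" assume X: "\<forall>i. X i \<in> UNIV - {\<nu>}" "X \<longlonglongrightarrow> \<nu>"
  obtain B where B: "\<And>i. norm (X i) \<le> B"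
    using convergent_imp_Bseq[of X] X(2) by (auto simp: convergent_def Bseq_def)
  define c where "c = 2 * (2 * (1 + 2 * B * norm w)) powr B * exp (pi * B)"
  show "(\<lambda>i. hankel_symbol (X i) w) \<longlonglongrightarrow> hankel_symbol \<nu> w"
    unfolding hankel_symbol_def set_lebesgue_integral_def
  proof (rule integral_dominated_convergence[where w="\<lambda>u. c * (indicator {0<..} u * (exp (- u / 2) / sqrt u))"])
    show "integrable lborel (\<lambda>u. c * (indicator {0<..} u * (exp (- u / 2) / sqrt u)))"
      by (rule integrable_exp_sqrt')
    show "AE u in lborel. norm (indicator {0<..} u *\<^sub>R (of_real (exp (- u) / sqrt u) * hankel_density (X i) (of_real u * w)))
        \<le> c * (indicator {0<..} u * (exp (- u / 2) / sqrt u))" for i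
    proof (rule AE_I2)
      fix u :: real
      have "\<bar>Re (X i)\<bar> \<le> B" "\<bar>Im (X i)\<bar> \<le> B"
        using B[of i] abs_Re_le_cmod[of "X i"] abs_Im_le_cmod[of "X i"] by linarith+
      then show "norm (indicator {0<..} u *\<^sub>R (of_real (exp (- u) / sqrt u) * hankel_density (X i) (of_real u * w)))
        \<le> c * (indicator {0<..} u * (exp (- u / 2) / sqrt u))"
        using hankel_integrand_bound[OF w order_refl, of u "X i" B B] by (auto simp: indicator_def c_def)
    qed
    have "(\<lambda>i. hankel_density (X i) t) \<longlonglongrightarrow> hankel_density \<nu> t" if "t \<in> slit_sector" for t
      unfolding hankel_density_def using that joukowski_nz[of t] joukowski_not_nonpos[OF that] slit_sectorD[OF that] X(2)
      by (intro tendsto_intros) (auto intro: tendsto_powr_complex simp: add_eq_0_iff)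
    then show "AE u in lborel. (\<lambda>i. indicator {0<..} u *\<^sub>R (of_real (exp (- u) / sqrt u) * hankel_density (X i) (of_real u * w)))
        \<longlonglongrightarrow> indicator {0<..} u *\<^sub>R (of_real (exp (- u) / sqrt u) * hankel_density \<nu> (of_real u * w))"
      using slit_sector_scale[OF w] by (intro AE_I2) (auto simp: indicator_def intro!: tendsto_intros)
  qed (use hankel_integrand_measurable[OF w] in auto)
qed

lemma slit_sectorI: "Re w > 0 \<Longrightarrow> w \<in> slit_sector"
  using norm_ge_zero[of w] unfolding slit_sector_def mem_Collect_eq by linarith

text \<open>The substitution is \<open>x = r * \<sigma> t\<close> with
  \<open>t = u / (2 * r)\<close>. Since \<open>\<sigma> t\<close> and its reciprocal
  \<open>\<tau> t\<close> add up to \<open>2 * (1 + t)\<close>, the exponent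
  \<open>x + r^2 / x\<close> becomes \<open>2 * r + u\<close>.\<close>

lemma upper_int_substitution:
  assumes r: "r > 0"
  shows "(\<lambda>u. of_real (exp (- 2 * r) / sqrt (2 * r)) * (of_real (exp (- u) / sqrt u) *
           (joukowski (of_real (u / (2 * r))) powr (- \<mu>) / csqrt (2 + of_real (u / (2 * r))))))
           absolutely_integrable_on {0<..}" (is "?F absolutely_integrable_on _")
    and "integral {0<..} (\<lambda>u. of_real (exp (- 2 * r) / sqrt (2 * r)) * (of_real (exp (- u) / sqrt u) *
           (joukowski (of_real (u / (2 * r))) powr (- \<mu>) / csqrt (2 + of_real (u / (2 * r)))))) = upper_int \<mu> r" (is "integral _ ?G = _")
proof -
  define \<sigma> where "\<sigma> t = 1 + t + sqrt (t * (2 + t))" for t :: real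
  define \<tau> where "\<tau> t = 1 + t - sqrt (t * (2 + t))" for t :: real
  define G where "G u = r * \<sigma> (u / (2 * r))" for u
  define h where "h u = G u / (2 * r) / sqrt (u / (2 * r) * (2 + u / (2 * r)))" for u
  define f where "f x = of_real (exp (- x - r\<^sup>2 / x) / x) * complex_of_real (r / x) powr \<mu>" for x
  have s1: "\<sigma> t > 1" if "t > 0" for t
    using that unfolding \<sigma>_def by (simp add: add_pos_nonneg)
  have st: "\<sigma> t * \<tau> t = 1" if "t > 0" for t
  proof -
    have "\<sigma> t * \<tau> t = (1 + t)\<^sup>2 - (sqrt (t * (2 + t)))\<^sup>2"
      by (simp add: \<sigma>_def \<tau>_def power2_eq_square algebra_simps)
    also have "(sqrt (t * (2 + t)))\<^sup>2 = t * (2 + t)" using that by (intro real_sqrt_pow2) auto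
    finally show ?thesis by (simp add: power2_eq_square algebra_simps)
  qed
  have dG: "(G has_field_derivative h u) (at u within {0<..})" if "u \<in> {0<..}" for u
  proof -
    define t where "t = u / (2 * r)"
    have t: "t > 0" using that r by (simp add: t_def)
    have p: "t * (2 + t) > 0" using t by simp
    have "(\<sigma> has_field_derivative (1 + (2 + 2 * t) * (inverse (sqrt (t * (2 + t))) / 2))) (at t)"
      unfolding \<sigma>_def using p by (auto intro!: derivative_eq_intros simp: algebra_simps)
    also have "1 + (2 + 2 * t) * (inverse (sqrt (t * (2 + t))) / 2) = \<sigma> t / sqrt (t * (2 + t))"
      using p by (simp add: \<sigma>_def field_simps)
    finally have d: "(\<sigma> has_field_derivative \<sigma> t / sqrt (t * (2 + t))) (at t)" .
    have "((\<lambda>u. r * \<sigma> (u / (2 * r))) has_field_derivative (r * (\<sigma> t / sqrt (t * (2 + t)) * (1 / (2 * r))))) (at u)"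
      by (rule DERIV_cmult, rule DERIV_chain2[where f=\<sigma>]) (use d r in \<open>auto simp: t_def intro!: derivative_eq_intros\<close>)
    moreover have "r * (\<sigma> t / sqrt (t * (2 + t)) * (1 / (2 * r))) = h u"
      by (simp add: h_def G_def t_def)
    ultimately show ?thesis
      unfolding G_def by (metis has_field_derivative_at_within)
  qed
  \<comment> \<open>For surjectivity the parameter is recovered from \<open>x\<close> as
    \<open>t = (x / r + r / x) / 2 - 1\<close>; then \<open>t * (2 + t)\<close> is a perfect square,
    which makes the root in \<open>\<sigma>\<close> explicit.\<close>
  have img: "G ` {0<..} = {r<..}"
  proof (intro equalityI subsetI)
    fix x assume "x \<in> G ` {0<..}"
    then show "x \<in> {r<..}" using s1 r by (auto simp: G_def)
  next
    fix x assume "x \<in> {r<..}"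
    then have x: "x > r" "x > 0" using r by auto
    define t where "t = (x / r + r / x) / 2 - 1"
    have "t = (x - r)\<^sup>2 / (2 * x * r)" using x r by (simp add: t_def power2_eq_square field_simps)
    then have t: "t > 0" using x r by simp
    have "((a + b) / 2 - 1) * (2 + ((a + b) / 2 - 1)) - ((a - b) / 2)\<^sup>2 = a * b - 1" for a b :: real
      by (simp add: power2_eq_square field_simps)
    from this[of "x / r" "r / x"] have "t * (2 + t) = ((x / r - r / x) / 2)\<^sup>2"
      using x r by (simp add: t_def)
    moreover have "r / x \<le> x / r" using x r by (simp add: field_simps mult_mono)
    ultimately have sq: "sqrt (t * (2 + t)) = (x / r - r / x) / 2" by simp
    have "\<sigma> t = 1 + t + (x / r - r / x) / 2" by (simp only: \<sigma>_def sq)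
    also have "\<dots> = x / r" unfolding t_def by (simp add: field_simps)
    finally have "\<sigma> t = x / r" .
    then have "G (2 * r * t) = x" using r by (simp add: G_def)
    then show "x \<in> G ` {0<..}" using t r by (intro image_eqI[of _ _ "2 * r * t"]) auto
  qed
  have inj: "inj_on G {0<..}"
  proof (rule linorder_inj_onI)
    fix a b :: real assume ab: "a < b" "a \<in> {0<..}" "b \<in> {0<..}"
    then have "a / (2 * r) < b / (2 * r)" using r by (simp add: divide_strict_right_mono)
    moreover have "sqrt (a / (2 * r) * (2 + a / (2 * r))) \<le> sqrt (b / (2 * r) * (2 + b / (2 * r)))"
      using ab r calculation by (intro real_sqrt_le_mono mult_mono) auto
    ultimately have "\<sigma> (a / (2 * r)) < \<sigma> (b / (2 * r))" unfolding \<sigma>_def by linarith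
    then show "G a \<noteq> G b" using r by (simp add: G_def)
  qed auto
  have F: "\<bar>h u\<bar> *\<^sub>R f (G u) = ?F u" if "u \<in> {0<..}" for u
  proof -
    define t where "t = u / (2 * r)"
    have t: "t > 0" using that r by (simp add: t_def)
    have u: "u = 2 * r * t" using r by (simp add: t_def)
    have G: "G u > 0" using s1[OF t] r by (simp add: G_def t_def)
    have c1: "csqrt (of_real t) = of_real (sqrt t)"
      using t by (simp add: csqrt_of_real_nonneg)
    have c2: "csqrt (2 + of_real t) = of_real (sqrt (2 + t))"
      using t csqrt_of_real_nonneg[of "2 + t"] by simp
    have jt: "joukowski (of_real t) = of_real (\<sigma> t)"
      by (simp add: joukowski_def \<sigma>_def c1 c2 real_sqrt_mult)
    have p1: "of_real (r / G u) powr \<mu> = joukowski (of_real t) powr (- \<mu>)"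
      using r s1[OF t] unfolding jt G_def t_def[symmetric]
      by (simp add: powr_def Ln_of_real ln_div flip: of_real_divide)
    have inv: "1 / \<sigma> t = \<tau> t" using st[OF t] s1[OF t] by (simp add: field_simps)
    have "G u + r\<^sup>2 / G u = r * (\<sigma> t + 1 / \<sigma> t)"
      unfolding G_def t_def[symmetric] using r s1[OF t] by (simp add: power2_eq_square field_simps)
    also have "\<dots> = 2 * r + u" unfolding inv by (simp add: \<sigma>_def \<tau>_def u algebra_simps)
    finally have ex: "- G u - r\<^sup>2 / G u = - 2 * r + (- u)" by linarith
    have h0: "h u > 0" using G r t by (simp add: h_def t_def[symmetric])
    have sq: "sqrt (t * (2 + t)) * (2 * r) = sqrt u * sqrt (2 * r) * sqrt (2 + t)"
    proof -
      have "sqrt u = sqrt (2 * r) * sqrt t" by (simp add: u real_sqrt_mult)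
      moreover have "sqrt (2 * r) * sqrt (2 * r) = 2 * r" using r by simp
      moreover have "sqrt (t * (2 + t)) = sqrt t * sqrt (2 + t)" by (rule real_sqrt_mult)
      ultimately show ?thesis by (metis (no_types) mult.assoc mult.commute)
    qed
    have "\<bar>h u\<bar> *\<^sub>R f (G u) = of_real (h u / G u * exp (- G u - r\<^sup>2 / G u)) * of_real (r / G u) powr \<mu>"
      using h0 by (simp add: f_def scaleR_conv_of_real mult_ac)
    also have "h u / G u = 1 / (sqrt (t * (2 + t)) * (2 * r))"
      unfolding h_def t_def[symmetric] using G by simp
    also have "\<dots> = 1 / (sqrt u * sqrt (2 * r) * sqrt (2 + t))" unfolding sq ..
    finally have "\<bar>h u\<bar> *\<^sub>R f (G u) =
       of_real (1 / (sqrt u * sqrt (2 * r) * sqrt (2 + t)) * (exp (- 2 * r) * exp (- u))) * joukowski (of_real t) powr (- \<mu>)"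
      unfolding ex exp_add p1 .
    then show ?thesis unfolding t_def[symmetric] c2 by (simp add: field_simps)
  qed
  have "f absolutely_integrable_on (G ` {0<..}) \<and> integral (G ` {0<..}) f = upper_int \<mu> r"
    unfolding img upper_int_def f_def using upper_Gamma_sums(2)[OF r, of \<mu>] by simp
  then have *: "(\<lambda>u. \<bar>h u\<bar> *\<^sub>R f (G u)) absolutely_integrable_on {0<..} \<and>
      integral {0<..} (\<lambda>u. \<bar>h u\<bar> *\<^sub>R f (G u)) = upper_int \<mu> r"
    by (subst has_absolute_integral_change_of_variables_real[OF _ dG inj]) auto
  show "?F absolutely_integrable_on {0<..}"
    by (rule set_integrable_cong[OF refl refl F, THEN iffD1, OF _ conjunct1[OF *]])
  have "integral {0<..} ?G = integral {0<..} (\<lambda>u. \<bar>h u\<bar> *\<^sub>R f (G u))"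
    by (rule Henstock_Kurzweil_Integration.integral_cong) (rule F[symmetric])
  then show "integral {0<..} ?G = upper_int \<mu> r" using * by simp
qed

lemma upper_int_eq_hankel_symbol:
  assumes r: "r > 0"
  shows "upper_int \<nu> r + upper_int (- \<nu>) r =
    of_real (exp (- 2 * r) / sqrt (2 * r)) * hankel_symbol \<nu> (of_real (1 / (2 * r)))"
proof -
  define c where "c = complex_of_real (exp (- 2 * r) / sqrt (2 * r))"
  define F where "F \<mu> u = c * (of_real (exp (- u) / sqrt u) *
           (joukowski (of_real (u / (2 * r))) powr (- \<mu>) / csqrt (2 + of_real (u / (2 * r)))))" for \<mu> u
  define g where "g u = c * (of_real (exp (- u) / sqrt u) * hankel_density \<nu> (of_real u * of_real (1 / (2 * r))))" for u :: real
  have w: "of_real (1 / (2 * r)) \<in> slit_sector" using r by (intro slit_sectorI) (simp only: Re_complex_of_real, simp)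
  have i1: "F \<nu> absolutely_integrable_on {0<..}" "integral {0<..} (F \<nu>) = upper_int \<nu> r"
    and i2: "F (- \<nu>) absolutely_integrable_on {0<..}" "integral {0<..} (F (- \<nu>)) = upper_int (- \<nu>) r"
    using upper_int_substitution[OF r, of \<nu>] upper_int_substitution[OF r, of "- \<nu>"]
    unfolding F_def[abs_def] c_def by blast+
  have g: "g = (\<lambda>u. F \<nu> u + F (- \<nu>) u)"
    by (rule ext) (simp add: g_def F_def hankel_density_def add_divide_distrib algebra_simps)
  have ig: "g absolutely_integrable_on {0<..}" unfolding g by (rule set_integral_add(1)[OF i1(1) i2(1)])
  have m: "(\<lambda>u. indicator {0<..} u *\<^sub>R g u) \<in> borel_measurable lborel"
  proof -
    have "(\<lambda>u. indicator {0<..} u *\<^sub>R g u) = (\<lambda>u. c * (indicator {0<..} u *\<^sub>R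
       (of_real (exp (- u) / sqrt u) * hankel_density \<nu> (of_real u * of_real (1 / (2 * r))))))"
      by (simp add: g_def)
    moreover have "(\<lambda>u. indicator {0<..} u *\<^sub>R
       (of_real (exp (- u) / sqrt u) * hankel_density \<nu> (of_real u * of_real (1 / (2 * r))))) \<in> borel_measurable lborel"
      using hankel_integrand_measurable[OF w, of \<nu>] by simp
    ultimately show ?thesis by (simp only: borel_measurable_times borel_measurable_const)
  qed
  have "c * hankel_symbol \<nu> (of_real (1 / (2 * r))) = (LINT u:{0<..}|lborel. g u)"
    unfolding hankel_symbol_def g_def by (rule set_integral_mult_right[symmetric])
  also have "\<dots> = (LINT u:{0<..}|lebesgue. g u)"
    unfolding set_lebesgue_integral_def by (rule integral_completion[symmetric, OF m])
  also have "\<dots> = integral {0<..} g"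
    by (rule set_lebesgue_integral_eq_integral(2)[OF ig])
  also have "\<dots> = upper_int \<nu> r + upper_int (- \<nu>) r"
    unfolding g using i1 i2 set_lebesgue_integral_eq_integral(1)
    by (subst Henstock_Kurzweil_Integration.integral_add) auto
  finally show ?thesis by (simp add: c_def)
qed

text \<open>The alternating signs of the Bessel series cancel against \<open>\<i>^(2 * m)\<close>;
  the phase comes from the principal argument \<open>pi / 2\<close> of
  \<open>\<i> * r\<close>.\<close>

lemma bessel_J_imaginary:
  assumes r: "r > 0"
  shows "bessel_J \<nu> (2 * \<i> * of_real r) = exp (\<i> * of_real pi * \<nu> / 2) * bessel_I_series \<nu> r"
proof -
  have "Ln (\<i> * of_real r) = of_real (ln r) + \<i> * of_real pi / 2"
    using Ln_times_of_real[OF r, of \<i>] r by (simp add: mult.commute Ln_of_real)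
  then have e1: "(2 * \<i> * of_real r / 2) powr \<nu> = exp (\<i> * of_real pi * \<nu> / 2) * of_real r powr \<nu>"
    using r by (simp add: powr_def Ln_of_real exp_add[symmetric] algebra_simps)
  have e2: "(- 1) ^ m / fact m * rGamma (\<nu> + of_nat m + 1) * (2 * \<i> * of_real r / 2) ^ (2 * m) =
      of_real r ^ (2 * m) / fact m * rGamma (\<nu> + of_nat m + 1)" for m
  proof -
    have "(- 1) ^ m * (\<i> * complex_of_real r) ^ (2 * m) = of_real r ^ (2 * m)"
      unfolding power_mult_distrib power_mult[of \<i>] by (simp flip: mult.assoc power_mult_distrib)
    then show ?thesis by (simp add: mult_ac)
  qed
  show ?thesis unfolding bessel_J_def bessel_I_series_def e1 e2 by (rule mult.assoc)
qed

lemma sin_pi_nonint: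
  assumes "\<nu> \<notin> \<int>"
  shows "sin (of_real pi * \<nu>) \<noteq> (0::complex)"
proof
  assume "sin (of_real pi * \<nu>) = 0"
  then obtain n :: int where "of_real pi * \<nu> = of_real (of_int n * pi)"
    by (auto simp: Complex_Transcendental.sin_eq_0)
  then have "\<nu> = of_int n" by simp
  with assms show False by simp
qed

lemma hankel1_nonint:
  assumes "\<nu> \<notin> \<int>"
  shows "hankel1 \<nu> z =
    (bessel_J (- \<nu>) z - exp (- \<i> * of_real pi * \<nu>) * bessel_J \<nu> z) / (\<i> * sin (of_real pi * \<nu>))"
proof -
  have e: "exp (- \<i> * of_real pi * \<nu>) = cos (of_real pi * \<nu>) - \<i> * sin (of_real pi * \<nu>)"
    using exp_Euler[of "- (of_real pi * \<nu>)"] by (simp add: mult_ac)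
  have *: "J + \<i> * ((J * c - K) / s) = (K - (c - \<i> * s) * J) / (\<i> * s)" if "s \<noteq> 0" for J K c s :: complex
  proof -
    have "\<i> * s * (J + \<i> * ((J * c - K) / s)) = \<i> * s * J + (\<i> * \<i>) * ((J * c - K) / s * s)"
      by (simp only: algebra_simps)
    also have "(J * c - K) / s * s = J * c - K" using that by simp
    also have "\<i> * s * J + (\<i> * \<i>) * (J * c - K) = \<i> * s * J - (J * c - K)" by simp
    also have "\<dots> = K - (c - \<i> * s) * J" by (simp add: algebra_simps)
    finally show ?thesis using that by (simp add: eq_divide_eq mult.commute)
  qed
  show ?thesis
    using assms *[OF sin_pi_nonint[OF assms]] unfolding e
    by (simp add: hankel1_def bessel_N_def bessel_N_quot_def mult.commute[of \<nu>])
qed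

text \<open>The factor \<open>exp (- \<i> * pi * \<nu>)\<close> in front of
  \<open>bessel_J \<nu>\<close> aligns its phase with that of \<open>bessel_J (- \<nu>)\<close>. The
  numerator is then this phase times the difference in the connection formula, whose sine cancels
  the denominator.\<close>

lemma hankel1_imaginary_axis:
  assumes nu: "\<nu> \<notin> \<int>" and w: "w > 0"
  shows "hankel1 \<nu> (\<i> / of_real w) = exp (- \<i> * of_real pi * \<nu> / 2) / (\<i> * of_real pi) *
     exp (- 1 / of_real w) * csqrt (of_real w) * hankel_symbol \<nu> (of_real w)"
proof -
  define r where "r = 1 / (2 * w)"
  have r: "r > 0" using w by (simp add: r_def)
  have z: "\<i> / of_real w = 2 * \<i> * of_real r" using w by (simp add: r_def)
  have e1: "exp (- \<i> * of_real pi * \<nu>) * exp (\<i> * of_real pi * \<nu> / 2) = exp (- \<i> * of_real pi * \<nu> / 2)"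
    unfolding exp_add[symmetric] by (rule arg_cong[of _ _ exp]) (simp add: field_simps)
  have e2: "exp (\<i> * of_real pi * (- \<nu>) / 2) = exp (- \<i> * of_real pi * \<nu> / 2)"
    by (simp add: mult_ac)
  have "hankel1 \<nu> (\<i> / of_real w) =
      (exp (- \<i> * of_real pi * \<nu> / 2) * (bessel_I_series (- \<nu>) r - bessel_I_series \<nu> r)) / (\<i> * sin (of_real pi * \<nu>))"
    unfolding z hankel1_nonint[OF nu] bessel_J_imaginary[OF r] e2 mult.assoc[symmetric] e1
    by (simp add: right_diff_distrib)
  also have "\<dots> = exp (- \<i> * of_real pi * \<nu> / 2) / (\<i> * of_real pi) *
      (of_real (exp (- 2 * r) / sqrt (2 * r)) * hankel_symbol \<nu> (of_real (1 / (2 * r))))"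
    unfolding bessel_I_series_connection[OF nu r] upper_int_eq_hankel_symbol[OF r]
    using sin_pi_nonint[OF nu] by (simp add: field_simps)
  also have "1 / (2 * r) = w" using w by (simp add: r_def)
  also have "exp (- 2 * r) / sqrt (2 * r) = exp (- 1 / w) * sqrt w"
    using w by (simp add: r_def real_sqrt_divide)
  also have "complex_of_real (exp (- 1 / w) * sqrt w) = exp (- 1 / of_real w) * csqrt (of_real w)"
  proof -
    have "- 1 / complex_of_real w = of_real (- 1 / w)" by simp
    then have "exp (- 1 / complex_of_real w) = of_real (exp (- 1 / w))" by (simp only: exp_of_real)
    then show ?thesis using w by (simp add: csqrt_of_real_nonneg)
  qed
  finally show ?thesis by (simp only: mult.assoc)
qed


section \<open>Extension off the imaginary axis and to integer orders\<close>

lemma bessel_J_series_summable: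
  "summable (\<lambda>m. norm ((- 1) ^ m / fact m * rGamma (\<nu> + of_nat m + 1) * q ^ m :: complex))"
proof -
  obtain C where C: "\<And>m. norm (rGamma (\<nu> + of_nat m + 1)) \<le> C"
    using rGamma_shift_bounded[of "norm \<nu>"] by auto
  show ?thesis
  proof (rule summable_comparison_test'[where N=0])
    show "summable (\<lambda>m. C * (inverse (fact m) * norm q ^ m))"
      by (intro summable_mult summable_exp)
    fix m :: nat
    show "norm (norm ((- 1) ^ m / fact m * rGamma (\<nu> + of_nat m + 1) * q ^ m)) \<le> C * (inverse (fact m) * norm q ^ m)"
      using mult_right_mono[OF C[of m], of "inverse (fact m) * norm q ^ m"]
      by (simp add: norm_mult norm_divide norm_inverse norm_power divide_inverse mult_ac)
  qed
qed

lemma holomorphic_bessel_J: "bessel_J \<nu> holomorphic_on - \<real>\<^sub>\<le>\<^sub>0"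
proof -
  define c where "c m = (- 1) ^ m / fact m * rGamma (\<nu> + of_nat m + 1)" for m
  define P where "P q = (\<Sum>m. c m * q ^ m)" for q
  have "(P has_field_derivative (\<Sum>m. diffs c m * q ^ m)) (at q)" for q
    unfolding P_def using summable_norm_cancel[OF bessel_J_series_summable]
    by (intro termdiffs_strong_converges_everywhere) (simp add: c_def)
  then have hP: "P holomorphic_on UNIV"
    by (auto simp: holomorphic_on_open)
  have eq: "bessel_J \<nu> = (\<lambda>z. (z / 2) powr \<nu> * P ((z / 2)\<^sup>2))"
    by (rule ext) (simp add: bessel_J_def P_def c_def power_mult)
  have "z / 2 \<notin> \<real>\<^sub>\<le>\<^sub>0" if "z \<notin> \<real>\<^sub>\<le>\<^sub>0" for z :: complex
    using that by (auto simp: complex_nonpos_Reals_iff)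
  then have "(\<lambda>z. (z / 2) powr \<nu>) holomorphic_on - \<real>\<^sub>\<le>\<^sub>0"
    by (intro holomorphic_intros) auto
  moreover have "(\<lambda>z. P ((z / 2)\<^sup>2)) holomorphic_on - \<real>\<^sub>\<le>\<^sub>0"
  proof -
    have "(\<lambda>z. (z / 2)\<^sup>2) holomorphic_on - \<real>\<^sub>\<le>\<^sub>0" by (intro holomorphic_intros) auto
    from holomorphic_on_compose_gen[OF this hP] show ?thesis by (simp add: comp_def)
  qed
  ultimately show ?thesis unfolding eq by (rule holomorphic_on_mult)
qed

text \<open>The bound on reciprocal Gamma values is uniform for orders in a ball, so the series
  converges uniformly there. Continuity in the order matters at integers, where the Neumann function
  is a limit.\<close>

lemma tendsto_bessel_J:
  assumes "z \<noteq> 0"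
  shows "((\<lambda>\<xi>. bessel_J \<xi> z) \<longlongrightarrow> bessel_J \<nu> z) (at \<nu>)"
proof -
  obtain C where C: "\<And>\<xi> m. norm (\<xi>::complex) \<le> norm \<nu> + 1 \<Longrightarrow> norm (rGamma (\<xi> + of_nat m + 1)) \<le> C"
    using rGamma_shift_bounded[of "norm \<nu> + 1"] by blast
  define q where "q = (z / 2)\<^sup>2"
  define t where "t m \<xi> = (- 1) ^ m / fact m * rGamma (\<xi> + of_nat m + 1) * q ^ m" for m and \<xi> :: complex
  have "uniform_limit (cball 0 (norm \<nu> + 1)) (\<lambda>n \<xi>. \<Sum>m<n. t m \<xi>) (\<lambda>\<xi>. \<Sum>m. t m \<xi>) sequentially"
  proof (rule Weierstrass_m_test)
    show "summable (\<lambda>m. C * (inverse (fact m) * norm q ^ m))"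
      by (intro summable_mult summable_exp)
    show "norm (t m \<xi>) \<le> C * (inverse (fact m) * norm q ^ m)" if "\<xi> \<in> cball 0 (norm \<nu> + 1)" for m \<xi>
      using mult_right_mono[OF C[of \<xi> m], of "inverse (fact m) * norm q ^ m"] that
      by (simp add: t_def norm_mult norm_divide norm_inverse norm_power divide_inverse mult_ac)
  qed
  then have "continuous_on (cball 0 (norm \<nu> + 1)) (\<lambda>\<xi>. \<Sum>m. t m \<xi>)"
    by (rule uniform_limit_theorem[rotated])
      (auto simp: t_def intro!: always_eventually continuous_intros continuous_on_compose2[OF continuous_on_rGamma])
  then have "isCont (\<lambda>\<xi>. \<Sum>m. t m \<xi>) \<nu>"
    by (rule continuous_on_interior) (simp add: interior_cball)
  then have "((\<lambda>\<xi>. (z / 2) powr \<xi> * (\<Sum>m. t m \<xi>)) \<longlongrightarrow> (z / 2) powr \<nu> * (\<Sum>m. t m \<nu>)) (at \<nu>)"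
    using assms by (intro tendsto_mult) (auto simp: isCont_def powr_def intro!: tendsto_intros)
  then show ?thesis by (simp add: bessel_J_def t_def q_def power_mult)
qed

text \<open>The domain is chosen so that the symbol, evaluated at \<open>w = \<i> / z\<close>, and the Bessel
  functions, evaluated at \<open>z\<close>, are both away from their cuts.\<close>

definition hankel_region :: "complex set" where
  "hankel_region = {w. Re w > 0} \<union> {w. 2 * Re w + Im w > 0}"

lemma hankel_region_slit_sector: "w \<in> hankel_region \<Longrightarrow> w \<in> slit_sector"
proof -
  have "2 * Re w + Im w > 0 \<Longrightarrow> w \<in> slit_sector"
    using abs_Im_le_cmod[of w] unfolding slit_sector_def mem_Collect_eq by linarith
  then show "w \<in> hankel_region \<Longrightarrow> w \<in> slit_sector"
    by (auto simp: hankel_region_def slit_sectorI)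
qed

text \<open>The quotient meets the cut only for \<open>w\<close> on the negative imaginary axis, and
  both half planes avoid that axis.\<close>

lemma hankel_region_inverse:
  assumes "w \<in> hankel_region"
  shows "\<i> / w \<notin> \<real>\<^sub>\<le>\<^sub>0"
proof
  assume "\<i> / w \<in> \<real>\<^sub>\<le>\<^sub>0"
  then obtain x where x: "\<i> / w = of_real x" "x \<le> 0" by (elim nonpos_Reals_cases)
  have w0: "w \<noteq> 0" using assms by (auto simp: hankel_region_def)
  then have "\<i> = of_real x * w" using x(1) by (simp add: field_simps)
  then have e: "x * Re w = 0" "x * Im w = 1"
    by (simp_all add: complex_eq_iff)
  then have "Re w = 0" by auto
  moreover have "Im w < 0"
    using e(2) x(2) mult_nonpos_nonneg[of x "Im w"] by (intro notI[THEN linorder_not_le[THEN iffD1]]) auto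
  ultimately have "Re w = 0" "Im w < 0" by auto
  then show False using assms by (auto simp: hankel_region_def)
qed

lemma connected_hankel_region: "connected hankel_region"
  unfolding hankel_region_def
proof (rule connected_Un)
  show "connected {w. Re w > 0}"
    using convex_halfspace_Re_gt convex_connected by blast
  have "{w. 2 * Re w + Im w > 0} = {w. inner (Complex 2 1) w > 0}"
    by (simp add: inner_complex_def)
  then show "connected {w. 2 * Re w + Im w > 0}"
    using convex_halfspace_gt convex_connected by metis
  have "1 \<in> {w. Re w > 0} \<inter> {w. 2 * Re w + Im w > 0}" by simp
  then show "{w. Re w > 0} \<inter> {w. 2 * Re w + Im w > 0} \<noteq> {}" by blast
qed

lemma open_hankel_region: "open hankel_region"
  unfolding hankel_region_def by (intro open_Un open_Collect_less continuous_intros)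

lemma hankel1_representation_nonint:
  assumes nu: "\<nu> \<notin> \<int>" and w: "w \<in> hankel_region"
  shows "hankel1 \<nu> (\<i> / w) = exp (- \<i> * of_real pi * \<nu> / 2) / (\<i> * of_real pi) *
     exp (- 1 / w) * csqrt w * hankel_symbol \<nu> w"
proof -
  define F where "F w = hankel1 \<nu> (\<i> / w) - exp (- \<i> * of_real pi * \<nu> / 2) / (\<i> * of_real pi) *
     exp (- 1 / w) * csqrt w * hankel_symbol \<nu> w" for w
  have w0: "w \<noteq> 0" "w \<notin> \<real>\<^sub>\<le>\<^sub>0" if "w \<in> hankel_region" for w
    using slit_sectorD[OF hankel_region_slit_sector[OF that]] by auto
  have hJ: "(\<lambda>w. bessel_J \<mu> (\<i> / w)) holomorphic_on hankel_region" for \<mu>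
  proof -
    have "(\<lambda>w. \<i> / w) holomorphic_on hankel_region" using w0 by (intro holomorphic_intros) auto
    from holomorphic_on_compose_gen[OF this holomorphic_bessel_J] show ?thesis
      using hankel_region_inverse by (auto simp: comp_def image_subset_iff)
  qed
  have hS: "hankel_symbol \<nu> holomorphic_on hankel_region"
    using holomorphic_hankel_symbol holomorphic_on_subset hankel_region_slit_sector by blast
  have hF: "F holomorphic_on hankel_region"
    unfolding F_def hankel1_nonint[OF nu]
    using sin_pi_nonint[OF nu] w0 by (intro holomorphic_intros hJ hS) auto
  \<comment> \<open>The two sides already agree on the positive reals; the identity theorem asks for
    an accumulation point of that set inside the region.\<close>
  have lim: "1 islimpt (complex_of_real ` {0<..})"
  proof -
    have "(\<lambda>n. complex_of_real (1 + 1 / real (Suc n))) \<longlonglongrightarrow> of_real (1 + 0)"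
      by (intro tendsto_of_real tendsto_add tendsto_const LIMSEQ_inverse_real_of_nat[unfolded inverse_eq_divide])
    moreover have "complex_of_real (1 + 1 / real (Suc n)) \<in> complex_of_real ` {0<..} - {1}" for n
    proof -
      have "1 + 1 / real (Suc n) > 1" by simp
      then show ?thesis by (metis (no_types, lifting) DiffI greaterThan_iff imageI less_irrefl of_real_eq_1_iff order.strict_trans singletonD zero_less_one)
    qed
    ultimately show ?thesis unfolding islimpt_sequential
      by (intro exI[of _ "\<lambda>n. complex_of_real (1 + 1 / real (Suc n))"]) simp
  qed
  have "F w = 0"
  proof (rule analytic_continuation[OF hF open_hankel_region connected_hankel_region _ _ lim _ w])
    show "complex_of_real ` {0<..} \<subseteq> hankel_region" "1 \<in> hankel_region"
      by (auto simp: hankel_region_def)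
    show "F z = 0" if "z \<in> complex_of_real ` {0<..}" for z
      using that hankel1_imaginary_axis[OF nu] by (auto simp: F_def)
  qed
  then show ?thesis by (simp add: F_def)
qed

text \<open>At an integer, \<open>Lim\<close> can be evaluated only after convergence is known. The
  formula at nearby non-integers expresses the Neumann quotient through functions that are
  continuous in the order, which gives existence and value of the limit together.\<close>

theorem hankel1_representation:
  assumes w: "w \<in> hankel_region"
  shows "hankel1 \<nu> (\<i> / w) = exp (- \<i> * of_real pi * \<nu> / 2) / (\<i> * of_real pi) *
     exp (- 1 / w) * csqrt w * hankel_symbol \<nu> w"
proof (cases "\<nu> \<in> \<int>")
  case True
  define z where "z = \<i> / w"
  define R where "R \<xi> = exp (- \<i> * of_real pi * \<xi> / 2) / (\<i> * of_real pi) *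
     exp (- 1 / w) * csqrt w * hankel_symbol \<xi> w" for \<xi>
  have z0: "z \<noteq> 0" using slit_sectorD(1)[OF hankel_region_slit_sector[OF w]] by (simp add: z_def)
  \<comment> \<open>The other integers form a closed set, so a punctured neighbourhood of the
    integer \<open>\<nu>\<close> contains none of them.\<close>
  have "\<forall>\<^sub>F \<xi> in at \<nu>. \<xi> \<notin> \<int>"
  proof -
    have "open (- (\<int> - {\<nu>}))"
      by (intro open_Compl closed_subset_Ints) auto
    then have "\<forall>\<^sub>F \<xi> in nhds \<nu>. \<xi> \<in> - (\<int> - {\<nu>})"
      by (rule eventually_nhds_in_open) auto
    then show ?thesis unfolding eventually_at_filter by eventually_elim auto
  qed
  then have ev: "\<forall>\<^sub>F \<xi> in at \<nu>. (R \<xi> - bessel_J \<xi> z) / \<i> = bessel_N_quot \<xi> z"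
  proof eventually_elim
    case (elim \<xi>)
    have "R \<xi> = hankel1 \<xi> z" unfolding R_def z_def by (rule hankel1_representation_nonint[OF elim w, symmetric])
    also have "\<dots> = bessel_J \<xi> z + \<i> * bessel_N_quot \<xi> z" using elim by (simp add: hankel1_def bessel_N_def)
    finally show ?case by simp
  qed
  have "((\<lambda>\<xi>. (R \<xi> - bessel_J \<xi> z) / \<i>) \<longlongrightarrow> (R \<nu> - bessel_J \<nu> z) / \<i>) (at \<nu>)"
    unfolding R_def
    by (intro tendsto_intros tendsto_bessel_J[OF z0] tendsto_hankel_symbol hankel_region_slit_sector w) auto
  then have "((\<lambda>\<xi>. bessel_N_quot \<xi> z) \<longlongrightarrow> (R \<nu> - bessel_J \<nu> z) / \<i>) (at \<nu>)"
    by (rule Lim_transform_eventually[OF _ ev])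
  then have "Lim (at \<nu>) (\<lambda>\<xi>. bessel_N_quot \<xi> z) = (R \<nu> - bessel_J \<nu> z) / \<i>"
    by (intro tendsto_Lim) auto
  then show ?thesis using True by (simp add: hankel1_def bessel_N_def R_def z_def)
qed (rule hankel1_representation_nonint[OF _ w])

section \<open>Asymptotics of the fundamental solution\<close>

text \<open>Up to a positive factor, dividing by \<open>q\<close> is multiplying by
  \<open>cnj q\<close>. This lowers the real part by at most \<open>norm w / 8\<close>, while the
  sector tolerates anything below \<open>norm w * norm q / 2\<close>, and
  \<open>norm q > 7 / 8\<close>.\<close>

lemma slit_sector_perturb:
  assumes "Re w \<ge> 0" "w \<noteq> 0" "norm (q - 1) < 1 / 8"
  shows "w / q \<in> slit_sector"
proof -
  have q: "norm q > 7 / 8" using norm_triangle_ineq3[of q 1] assms(3) by simp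
  then have q0: "q \<noteq> 0" by auto
  have "norm (w * cnj (q - 1)) < norm w * (1 / 8)"
    unfolding norm_mult complex_mod_cnj using assms by (intro mult_strict_left_mono) auto
  then have "Re (w * cnj (q - 1)) \<ge> - norm w / 8"
    using abs_Re_le_cmod[of "w * cnj (q - 1)"] by linarith
  moreover have "Re (w * cnj q) = Re w + Re (w * cnj (q - 1))"
    by (simp add: algebra_simps)
  ultimately have "Re (w * cnj q) \<ge> - norm w / 8" using assms(1) by linarith
  moreover have "norm w * norm q > norm w * (7 / 8)"
    using q assms(2) by (intro mult_strict_left_mono) auto
  ultimately have *: "Re (w * cnj q) > - (norm w * norm q) / 2"
    using assms(2) zero_less_norm_iff[of w] by linarith
  have "w / q = (w * cnj q) / of_real ((norm q)\<^sup>2)"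
    using q0 by (simp add: complex_norm_square field_simps flip: of_real_power)
  then have "Re (w / q) = Re (w * cnj q) / (norm q)\<^sup>2"
    by (simp only: Re_divide_of_real)
  also have "\<dots> > (- (norm w * norm q) / 2) / (norm q)\<^sup>2"
    using * q0 by (intro divide_strict_right_mono) auto
  also have "(- (norm w * norm q) / 2) / (norm q)\<^sup>2 = - norm (w / q) / 2"
    using q0 by (simp add: norm_divide power2_eq_square field_simps)
  finally show ?thesis by (simp add: slit_sector_def)
qed

text \<open>The real part of \<open>\<i> / k\<close> has the sign of \<open>Im k\<close>. If
  \<open>Im k = 0\<close> then \<open>k\<close> is positive, and \<open>\<i> / k\<close> lies on the
  positive imaginary axis, inside the second half plane of \<open>hankel_region\<close>.\<close>

lemma inverse_frequency:
  assumes "k \<notin> \<real>\<^sub>\<le>\<^sub>0" "Im k \<ge> 0"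
  shows "k \<noteq> 0" "Re (\<i> / k) \<ge> 0" "\<And>r. r > 0 \<Longrightarrow> (\<i> / k) / of_real r \<in> hankel_region"
proof -
  show k0: "k \<noteq> 0" using assms by auto
  have n: "(Re k)\<^sup>2 + (Im k)\<^sup>2 > 0" using k0 by (simp add: complex_neq_0)
  have re: "Re (\<i> / k) = Im k / ((Re k)\<^sup>2 + (Im k)\<^sup>2)" by (simp add: Re_divide)
  have im: "Im (\<i> / k) = Re k / ((Re k)\<^sup>2 + (Im k)\<^sup>2)" by (simp add: Im_divide)
  show "Re (\<i> / k) \<ge> 0" unfolding re using assms(2) by simp
  show "(\<i> / k) / of_real r \<in> hankel_region" if r: "r > 0" for r
  proof (cases "Im k > 0")
    case True
    then have "Re (\<i> / k) / r > 0" unfolding re using n r by (intro divide_pos_pos) auto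
    then show ?thesis unfolding hankel_region_def Un_iff mem_Collect_eq Re_divide_of_real by blast
  next
    case False
    then have "Im k = 0" "Re k > 0" using assms by (auto simp: complex_nonpos_Reals_iff)
    then have "Re (\<i> / k) / r = 0" "Im (\<i> / k) / r > 0"
      unfolding re im using n r by (auto intro!: divide_pos_pos)
    then show ?thesis unfolding hankel_region_def Un_iff mem_Collect_eq Re_divide_of_real Im_divide_of_real by linarith
  qed
qed

lemma csqrt_divide_of_real:
  assumes "r > 0"
  shows "csqrt (w / of_real r) = csqrt w / of_real (sqrt r)"
proof (cases "w = 0")
  case False
  have "csqrt (w / of_real r) = exp (Ln (w / of_real r) / 2)"
    using False assms by (simp add: csqrt_exp_Ln)
  also have "Ln (w / of_real r) / 2 = Ln w / 2 - of_real (ln (sqrt r))"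
    using False assms by (simp add: Ln_divide_of_real ln_sqrt diff_divide_distrib)
  also have "exp \<dots> = csqrt w / of_real (sqrt r)"
    using False assms by (simp add: exp_diff csqrt_exp_Ln exp_of_real)
  finally show ?thesis .
qed simp

text \<open>The radius is complex so that the derivatives can be bounded by Cauchy's inequality.\<close>

definition radial_symbol :: "complex \<Rightarrow> real \<Rightarrow> complex \<Rightarrow> complex" where
  "radial_symbol k h \<rho> = exp (of_real h * Ln k) / (4 * \<i> * of_real ((2 * pi) powr h)) *
     (exp (- \<i> * of_real pi * of_real h / 2) / (\<i> * of_real pi)) * csqrt (\<i> / k) *
     (\<rho> powr (- of_real (h + 1 / 2)) * hankel_symbol (of_real h) ((\<i> / k) / \<rho>))"

text \<open>With \<open>w = \<i> / (k * r)\<close> the factor \<open>exp (- 1 / w)\<close> is the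
  outgoing wave, and \<open>csqrt w\<close> contributes \<open>r powr (- 1 / 2)\<close>, which turns
  the exponent \<open>- h\<close> into \<open>- (n - 1) / 2\<close> in dimension
  \<open>n\<close>.\<close>

lemma fund_sol_eq_radial_symbol:
  fixes x :: "'a::euclidean_space"
  assumes k: "k \<notin> \<real>\<^sub>\<le>\<^sub>0" "Im k \<ge> 0" and x: "x \<noteq> 0" and h: "h = (real DIM('a) - 2) / 2"
  shows "fund_sol k x = exp (\<i> * k * of_real (norm x)) * radial_symbol k h (of_real (norm x))"
proof -
  define r where "r = norm x"
  have r: "r > 0" using x by (simp add: r_def)
  define w where "w = (\<i> / k) / of_real r"
  have k0: "k \<noteq> 0" using inverse_frequency[OF k] by auto
  have w: "\<i> / w = k * of_real r" "- 1 / w = \<i> * k * of_real r"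
    using k0 r by (simp_all add: w_def field_simps)
  have h1: "hankel1 (of_real h) (k * of_real r) = exp (- \<i> * of_real pi * of_real h / 2) / (\<i> * of_real pi) *
     exp (\<i> * k * of_real r) * (csqrt (\<i> / k) / of_real (sqrt r)) * hankel_symbol (of_real h) ((\<i> / k) / of_real r)"
    using hankel1_representation[OF inverse_frequency(3)[OF k r], of "of_real h"]
    unfolding w_def[symmetric] w(1) w(2)
    unfolding w_def csqrt_divide_of_real[OF r] .
  have p: "complex_of_real r powr (- of_real (h + 1 / 2)) = of_real (r powr (- h)) / of_real (sqrt r)"
  proof -
    have "complex_of_real r powr (- of_real (h + 1 / 2)) = of_real (r powr (- (h + 1 / 2)))"
      using r by (metis of_real_minus powr_of_real less_imp_le)
    also have "r powr (- (h + 1 / 2)) = r powr (- h) / sqrt r"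
    proof -
      have "r powr (- (h + 1 / 2)) = r powr (- h) * r powr (- (1 / 2))"
        unfolding powr_add[symmetric] by simp
      also have "r powr (- (1 / 2)) = inverse (sqrt r)"
        unfolding powr_minus using powr_half_sqrt[of r] r by (simp only: less_imp_le)
      finally show ?thesis by (simp only: divide_inverse)
    qed
    finally show ?thesis by simp
  qed
  show ?thesis
    unfolding fund_sol_def Let_def h[symmetric] r_def[symmetric] h1 radial_symbol_def p
    by (simp only: divide_inverse mult_ac)
qed

definition radial_region :: "complex \<Rightarrow> complex set" where
  "radial_region k = {\<rho>. Re \<rho> > 0 \<and> (\<i> / k) / \<rho> \<in> slit_sector}"

lemma open_radial_region: "open (radial_region k)"
proof -
  have "continuous_on {\<rho>. Re \<rho> > 0} (\<lambda>\<rho>. (\<i> / k) / \<rho>)"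
    by (intro continuous_intros) auto
  moreover have "open {\<rho>. Re \<rho> > 0}" by (rule open_halfspace_Re_gt)
  ultimately have "open ((\<lambda>\<rho>. (\<i> / k) / \<rho>) -` slit_sector \<inter> {\<rho>. Re \<rho> > 0})"
    using open_slit_sector continuous_on_open_vimage by blast
  moreover have "(\<lambda>\<rho>. (\<i> / k) / \<rho>) -` slit_sector \<inter> {\<rho>. Re \<rho> > 0} = radial_region k"
    by (auto simp: radial_region_def)
  ultimately show ?thesis by simp
qed

text \<open>The sector is invariant under positive scaling, so the disc of holomorphy grows linearly
  with \<open>r\<close>. This is the source of the gain \<open>1 / r\<close> per derivative.\<close>

lemma radial_region_ball:
  assumes k: "k \<notin> \<real>\<^sub>\<le>\<^sub>0" "Im k \<ge> 0" and r: "r > 0"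
  shows "ball (of_real r) (r / 8) \<subseteq> radial_region k"
proof
  fix \<rho> assume "\<rho> \<in> ball (complex_of_real r) (r / 8)"
  then have \<rho>: "norm (\<rho> - of_real r) < r / 8" by (simp add: dist_norm norm_minus_commute)
  define q where "q = \<rho> / of_real r"
  have "q - 1 = (\<rho> - of_real r) / of_real r" using r by (simp add: q_def diff_divide_distrib)
  then have "norm (q - 1) = norm (\<rho> - of_real r) / r" using r by (simp add: norm_divide)
  also have "\<dots> < 1 / 8" using \<rho> r by (simp add: field_simps)
  finally have q: "norm (q - 1) < 1 / 8" .
  have "Re (\<i> / k / of_real r) \<ge> 0" using inverse_frequency(2)[OF k] r unfolding Re_divide_of_real by simp
  then have "\<i> / k / of_real r / q \<in> slit_sector"
    using inverse_frequency(1)[OF k] r q by (intro slit_sector_perturb) auto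
  then have "\<i> / k / \<rho> \<in> slit_sector" using r by (simp add: q_def)
  moreover have "Re \<rho> > 0"
    using abs_Re_le_cmod[of "\<rho> - of_real r"] \<rho> r by simp
  ultimately show "\<rho> \<in> radial_region k" by (simp add: radial_region_def)
qed

lemma of_real_radial_region:
  assumes k: "k \<notin> \<real>\<^sub>\<le>\<^sub>0" "Im k \<ge> 0" and r: "r > 0"
  shows "of_real r \<in> radial_region k"
  using radial_region_ball[OF assms] r centre_in_ball[of "complex_of_real r" "r / 8"] by auto

lemma holomorphic_radial_symbol: "radial_symbol k h holomorphic_on radial_region k"
proof -
  have 1: "(\<lambda>\<rho>. (\<i> / k) / \<rho>) holomorphic_on radial_region k"
    by (intro holomorphic_intros) (auto simp: radial_region_def)
  have 2: "(\<lambda>\<rho>. hankel_symbol (of_real h) ((\<i> / k) / \<rho>)) holomorphic_on radial_region k"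
    using holomorphic_on_compose_gen[OF 1 holomorphic_hankel_symbol, of "of_real h"]
    by (auto simp: comp_def radial_region_def)
  show ?thesis unfolding radial_symbol_def
    by (intro holomorphic_intros 2) (auto simp: radial_region_def complex_nonpos_Reals_iff)
qed

text \<open>On this disc \<open>norm \<rho> \<ge> r / 2\<close>, so for \<open>r \<ge> 1\<close> the
  argument of \<open>hankel_symbol\<close> has modulus at most \<open>2 * norm (\<i> / k)\<close>
  and the symbol is bounded; the decay is that of the explicit power. The radius
  \<open>r / 16\<close> keeps the closed disc inside the disc of radius
  \<open>r / 8\<close>.\<close>

lemma radial_symbol_bound:
  assumes k: "k \<notin> \<real>\<^sub>\<le>\<^sub>0" "Im k \<ge> 0" and h: "h \<ge> 0"
  shows "\<exists>K. \<forall>r\<ge>1. \<forall>\<rho>\<in>cball (of_real r) (r / 16). norm (radial_symbol k h \<rho>) \<le> K * r powr (- (h + 1 / 2))"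
proof -
  define c where "c = exp (of_real h * Ln k) / (4 * \<i> * of_real ((2 * pi) powr h)) *
     (exp (- \<i> * of_real pi * of_real h / 2) / (\<i> * of_real pi)) * csqrt (\<i> / k)"
  have "\<exists>B. \<forall>w\<in>slit_sector. norm w \<le> 2 * norm (\<i> / k) \<longrightarrow> norm (hankel_symbol (of_real h) w) \<le> B"
    using hankel_symbol_bound by blast
  then obtain B where B: "\<And>w. w \<in> slit_sector \<Longrightarrow> norm w \<le> 2 * norm (\<i> / k) \<Longrightarrow> norm (hankel_symbol (of_real h) w) \<le> B"
    by blast
  have "norm (radial_symbol k h \<rho>) \<le> (norm c * (2 powr (h + 1 / 2) * B)) * r powr (- (h + 1 / 2))"
    if r: "r \<ge> 1" and \<rho>: "\<rho> \<in> cball (of_real r) (r / 16)" for r \<rho>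
  proof -
    have "\<rho> \<in> ball (of_real r) (r / 8)" using \<rho> r by auto
    then have reg: "Re \<rho> > 0" "(\<i> / k) / \<rho> \<in> slit_sector"
      using radial_region_ball[OF k, of r] r by (auto simp: radial_region_def)
    have "norm (\<rho> - of_real r) \<le> r / 16" using \<rho> by (simp add: dist_norm norm_minus_commute)
    then have n: "norm \<rho> \<ge> r / 2"
      using norm_triangle_ineq3[of \<rho> "of_real r"] r by simp
    then have "norm \<rho> \<ge> 1 / 2" using r by simp
    then have "norm (\<i> / k) / norm \<rho> \<le> norm (\<i> / k) / (1 / 2)"
      by (intro divide_left_mono) auto
    then have b1: "norm (hankel_symbol (of_real h) ((\<i> / k) / \<rho>)) \<le> B"
      using reg by (intro B) (simp_all only: norm_divide[of _ \<rho>] divide_divide_eq_right mult.commute mult_1 div_by_1)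
    have "norm (\<rho> powr (- of_real (h + 1 / 2))) = norm \<rho> powr (- (h + 1 / 2))"
      by (subst norm_powr_real_powr') (auto simp flip: of_real_minus)
    also have "\<dots> \<le> (r / 2) powr (- (h + 1 / 2))"
      using n r h by (intro powr_mono2') auto
    also have "\<dots> = 2 powr (h + 1 / 2) * r powr (- (h + 1 / 2))"
      using r by (simp add: powr_divide powr_minus field_simps)
    finally have "norm (\<rho> powr (- of_real (h + 1 / 2))) \<le> 2 powr (h + 1 / 2) * r powr (- (h + 1 / 2))" .
    then have "norm (\<rho> powr (- of_real (h + 1 / 2)) * hankel_symbol (of_real h) ((\<i> / k) / \<rho>)) \<le>
        (2 powr (h + 1 / 2) * r powr (- (h + 1 / 2))) * B"
      unfolding norm_mult using b1 by (intro mult_mono) auto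
    then have "norm (radial_symbol k h \<rho>) \<le> norm c * ((2 powr (h + 1 / 2) * r powr (- (h + 1 / 2))) * B)"
      unfolding radial_symbol_def c_def[symmetric] norm_mult[of c] by (intro mult_left_mono) auto
    then show ?thesis by (simp add: mult_ac)
  qed
  then show ?thesis by blast
qed

lemma vector_derivative_higher_deriv:
  assumes "f holomorphic_on S" "open S" "of_real r \<in> S"
  shows "((\<lambda>r. (deriv ^^ j) f (of_real r)) has_vector_derivative (deriv ^^ Suc j) f (of_real r)) (at r)"
proof -
  have "((deriv ^^ j) f has_field_derivative deriv ((deriv ^^ j) f) (of_real r)) (at (of_real r))"
    using holomorphic_higher_deriv[OF assms(1,2), of j] assms(2,3) holomorphic_derivI by blast
  then show ?thesis using has_vector_derivative_real_field by fastforce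
qed

text \<open>Cauchy's inequality on the disc of radius \<open>r / 16\<close> costs a factor
  \<open>fact j * 16^j / r^j\<close> for the derivative of order \<open>j\<close>.\<close>

theorem fund_sol_symbol:
  assumes k: "k \<notin> \<real>\<^sub>\<le>\<^sub>0" "Im k \<ge> 0" and dim: "DIM('a::euclidean_space) \<ge> 2"
  shows "\<exists>\<sigma> :: nat \<Rightarrow> real \<Rightarrow> complex.
    (\<forall>x::'a. x \<noteq> 0 \<longrightarrow> fund_sol k x = exp (\<i> * k * of_real (norm x)) * \<sigma> 0 (norm x)) \<and>
    (\<forall>j r. r > 0 \<longrightarrow> (\<sigma> j has_vector_derivative \<sigma> (Suc j) r) (at r)) \<and>
    (\<forall>j. \<exists>K. \<forall>r\<ge>1. norm (\<sigma> j r) \<le> K * r powr (- (real DIM('a) - 1) / 2 - real j))"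
proof -
  define h where "h = (real DIM('a) - 2) / 2"
  have h0: "h \<ge> 0" using dim by (simp add: h_def)
  define \<sigma> where "\<sigma> j r = (deriv ^^ j) (radial_symbol k h) (of_real r)" for j r
  have "fund_sol k x = exp (\<i> * k * of_real (norm x)) * \<sigma> 0 (norm x)" if "x \<noteq> 0" for x :: 'a
    using fund_sol_eq_radial_symbol[OF k that h_def] by (simp add: \<sigma>_def)
  moreover have "(\<sigma> j has_vector_derivative \<sigma> (Suc j) r) (at r)" if "r > 0" for j r
    unfolding \<sigma>_def
    by (rule vector_derivative_higher_deriv[OF holomorphic_radial_symbol open_radial_region of_real_radial_region[OF k that]])
  moreover have "\<exists>K. \<forall>r\<ge>1. norm (\<sigma> j r) \<le> K * r powr (- (real DIM('a) - 1) / 2 - real j)" for j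
  proof -
    obtain K where K: "\<And>r \<rho>. r \<ge> 1 \<Longrightarrow> \<rho> \<in> cball (of_real r) (r / 16) \<Longrightarrow>
        norm (radial_symbol k h \<rho>) \<le> K * r powr (- (h + 1 / 2))"
      using radial_symbol_bound[OF k h0] by blast
    have "norm (\<sigma> j r) \<le> (fact j * K * 16 ^ j) * r powr (- (real DIM('a) - 1) / 2 - real j)" if r: "r \<ge> 1" for r
    proof -
      have sub: "cball (of_real r) (r / 16) \<subseteq> radial_region k"
        using radial_region_ball[OF k, of r] r by (force simp: subset_iff)
      have hol: "radial_symbol k h holomorphic_on cball (of_real r) (r / 16)"
        using holomorphic_on_subset[OF holomorphic_radial_symbol sub] .
      have "norm ((deriv ^^ j) (radial_symbol k h) (of_real r)) \<le> fact j * (K * r powr (- (h + 1 / 2))) / (r / 16) ^ j"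
      proof (rule Cauchy_inequality)
        show "radial_symbol k h holomorphic_on ball (of_real r) (r / 16)"
          using hol holomorphic_on_subset ball_subset_cball by blast
        show "continuous_on (cball (of_real r) (r / 16)) (radial_symbol k h)"
          using hol by (rule holomorphic_on_imp_continuous_on)
      qed (use r K in \<open>auto simp: dist_norm\<close>)
      also have "\<dots> = (fact j * K * 16 ^ j) * (r powr (- (h + 1 / 2)) / r ^ j)"
        by (simp add: power_divide)
      also have "r powr (- (h + 1 / 2)) / r ^ j = r powr (- (real DIM('a) - 1) / 2 - real j)"
      proof -
        have "r powr (- (h + 1 / 2)) / r powr real j = r powr (- (real DIM('a) - 1) / 2 - real j)"
          unfolding powr_diff[symmetric] by (simp add: h_def field_simps)
        then show ?thesis using r by (simp add: powr_realpow)
      qed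
      finally show ?thesis by (simp add: \<sigma>_def)
    qed
    then show ?thesis by blast
  qed
  ultimately show ?thesis by blast
qed

text \<open>A function of \<open>x \<bullet> x\<close> is differentiated by the product rule alone,
  without derivatives of the norm. This form serves for differentiability of the potentials at
  bounded distances, the symbol for decay.\<close>

theorem fund_sol_smooth:
  assumes k: "k \<notin> \<real>\<^sub>\<le>\<^sub>0" "Im k \<ge> 0"
  shows "\<exists>\<Phi> :: nat \<Rightarrow> real \<Rightarrow> complex.
    (\<forall>x::'a::euclidean_space. x \<noteq> 0 \<longrightarrow> fund_sol k x = \<Phi> 0 (x \<bullet> x)) \<and>
    (\<forall>j q. q > 0 \<longrightarrow> (\<Phi> j has_vector_derivative \<Phi> (Suc j) q) (at q))"
proof -
  define h where "h = (real DIM('a) - 2) / 2"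
  define S where "S = csqrt -` radial_region k \<inter> - \<real>\<^sub>\<le>\<^sub>0"
  have cc: "continuous_on (- \<real>\<^sub>\<le>\<^sub>0) csqrt"
    by (intro holomorphic_on_imp_continuous_on holomorphic_intros) auto
  have S: "open S"
    unfolding S_def using cc continuous_on_open_vimage[of "- \<real>\<^sub>\<le>\<^sub>0" csqrt] open_radial_region
      closed_nonpos_Reals_complex by (simp add: open_Compl)
  define F where "F q = exp (\<i> * k * csqrt q) * radial_symbol k h (csqrt q)" for q
  have c: "csqrt holomorphic_on S" unfolding S_def by (intro holomorphic_intros) auto
  have hF: "F holomorphic_on S"
    unfolding F_def using holomorphic_on_compose_gen[OF c holomorphic_radial_symbol, of k h]
    by (intro holomorphic_intros c) (auto simp: S_def comp_def)
  define \<Phi> where "\<Phi> j q = (deriv ^^ j) F (of_real q)" for j q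
  have inS: "of_real q \<in> S" if "q > 0" for q
    using that of_real_radial_region[OF k, of "sqrt q"] by (auto simp: S_def csqrt_of_real_nonneg)
  have "fund_sol k x = \<Phi> 0 (x \<bullet> x)" if "x \<noteq> 0" for x :: 'a
    using fund_sol_eq_radial_symbol[OF k that h_def]
    by (simp add: \<Phi>_def F_def csqrt_of_real_nonneg norm_eq_sqrt_inner[symmetric])
  moreover have "(\<Phi> j has_vector_derivative \<Phi> (Suc j) q) (at q)" if "q > 0" for j q
    unfolding \<Phi>_def by (rule vector_derivative_higher_deriv[OF hF S inS[OF that]])
  ultimately show ?thesis by blast
qed

section \<open>Functions with bounded Lipschitz derivative\<close>

text \<open>These functions serve as a common test space: they restrict to \<open>C\<^sup>1\<^sup>,\<^sup>\<alpha>\<close> functions on the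
  boundary, and unlike Hoelder norms their bounds are immediate under products and compositions.\<close>

definition c11_deriv ::
    "'a::euclidean_space set \<Rightarrow> ('a \<Rightarrow> 'b::real_normed_vector) \<Rightarrow> ('a \<Rightarrow> 'a \<Rightarrow> 'b) \<Rightarrow> real \<Rightarrow> bool" where
  "c11_deriv W f D M \<longleftrightarrow>
     (\<forall>y\<in>W. (f has_derivative D y) (at y) \<and> norm (f y) \<le> M \<and> (\<forall>v. norm (D y v) \<le> M * norm v)) \<and>
     (\<forall>y\<in>W. \<forall>y'\<in>W. \<forall>v. norm (D y v - D y' v) \<le> M * norm (y - y') * norm v)"

definition c11 :: "'a::euclidean_space set \<Rightarrow> ('a \<Rightarrow> 'b::real_normed_vector) \<Rightarrow> real \<Rightarrow> bool" where
  "c11 W f M \<longleftrightarrow> (\<exists>D. c11_deriv W f D M)"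

lemma c11_derivD:
  assumes "c11_deriv W f D M" "y \<in> W"
  shows "(f has_derivative D y) (at y)" "norm (f y) \<le> M" "norm (D y v) \<le> M * norm v"
    "y' \<in> W \<Longrightarrow> norm (D y v - D y' v) \<le> M * norm (y - y') * norm v" "M \<ge> 0"
proof -
  show "(f has_derivative D y) (at y)" and n: "norm (f y) \<le> M" and "norm (D y v) \<le> M * norm v"
    using assms unfolding c11_deriv_def by blast+
  show "norm (D y v - D y' v) \<le> M * norm (y - y') * norm v" if "y' \<in> W"
    using assms that unfolding c11_deriv_def by blast
  show "M \<ge> 0" using n norm_ge_zero order_trans by blast
qed

lemma c11_imp_c11_deriv:
  assumes "c11 W f M" "\<And>y. y \<in> W \<Longrightarrow> (f has_derivative D y) (at y)"
  shows "c11_deriv W f D M"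
proof -
  obtain D' where D': "c11_deriv W f D' M" using assms by (auto simp: c11_def)
  have "D' y = D y" if "y \<in> W" for y
    using has_derivative_unique[OF c11_derivD(1)[OF D' that] assms(2)[OF that]] .
  then show ?thesis using D' by (simp add: c11_deriv_def)
qed

lemma c11_mono: "c11 W f M \<Longrightarrow> M \<le> N \<Longrightarrow> c11 W f N"
proof -
  assume "c11 W f M" and MN: "M \<le> N"
  then obtain D where D: "c11_deriv W f D M" by (auto simp: c11_def)
  have "c11_deriv W f D N"
    unfolding c11_deriv_def
  proof (intro ballI conjI allI)
    fix y v assume y: "y \<in> W"
    show "(f has_derivative D y) (at y)" "norm (f y) \<le> N"
      using c11_derivD(1,2)[OF D y] MN by auto
    show "norm (D y v) \<le> N * norm v"
      using c11_derivD(3)[OF D y, of v] mult_right_mono[OF MN, of "norm v"] by simp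
    show "norm (D y v - D y' v) \<le> N * norm (y - y') * norm v" if "y' \<in> W" for y'
      using c11_derivD(4)[OF D y that, of v] mult_right_mono[OF MN, of "norm (y - y') * norm v"]
      by (simp add: mult.assoc)
  qed
  then show "c11 W f N" by (auto simp: c11_def)
qed

lemma c11_const: "norm c \<le> M \<Longrightarrow> c11 W (\<lambda>_. c) M"
  unfolding c11_def c11_deriv_def
  using order_trans[OF norm_ge_zero[of c]] by (intro exI[of _ "\<lambda>_ _. 0"]) auto

lemma c11_add:
  assumes "c11 W f M" "c11 W g N"
  shows "c11 W (\<lambda>y. f y + g y) (M + N)"
proof -
  obtain D E where D: "c11_deriv W f D M" and E: "c11_deriv W g E N" using assms by (auto simp: c11_def)
  have "c11_deriv W (\<lambda>y. f y + g y) (\<lambda>y v. D y v + E y v) (M + N)"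
    unfolding c11_deriv_def
  proof (intro ballI conjI allI)
    fix y v assume y: "y \<in> W"
    show "((\<lambda>y. f y + g y) has_derivative (\<lambda>v. D y v + E y v)) (at y)"
      by (intro has_derivative_add c11_derivD[OF D y] c11_derivD[OF E y])
    show "norm (f y + g y) \<le> M + N" "norm (D y v + E y v) \<le> (M + N) * norm v"
      using c11_derivD(2,3)[OF D y] c11_derivD(2,3)[OF E y] unfolding distrib_right
      by (meson norm_triangle_mono)+
    fix y' assume y': "y' \<in> W"
    have "D y v + E y v - (D y' v + E y' v) = (D y v - D y' v) + (E y v - E y' v)" by simp
    also have "norm \<dots> \<le> M * norm (y - y') * norm v + N * norm (y - y') * norm v"
      by (rule norm_triangle_mono[OF c11_derivD(4)[OF D y y'] c11_derivD(4)[OF E y y']])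
    finally show "norm (D y v + E y v - (D y' v + E y' v)) \<le> (M + N) * norm (y - y') * norm v"
      by (simp add: distrib_right)
  qed
  then show ?thesis by (auto simp: c11_def)
qed

lemma c11_lipschitz:
  assumes D: "c11_deriv W f D M" and W: "convex W" "y \<in> W" "y' \<in> W"
  shows "norm (f y - f y') \<le> M * norm (y - y')"
proof (rule differentiable_bound[OF W(1)])
  show "onorm (D x) \<le> M" if "x \<in> W" for x
    using c11_derivD(3,5)[OF D that] by (intro onorm_bound) auto
qed (use W c11_derivD(1)[OF D] in \<open>auto intro: has_derivative_at_withinI\<close>)

text \<open>The increment of the derivative of a product splits into four terms, each bounded by
  \<open>M * N * norm (y - y') * norm v\<close>, whence the constant 4.\<close>

lemma c11_mult:
  fixes f g :: "'a::euclidean_space \<Rightarrow> 'b::real_normed_algebra"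
  assumes "c11 W f M" "c11 W g N" "convex W"
  shows "c11 W (\<lambda>y. f y * g y) (4 * M * N)"
proof -
  obtain D E where D: "c11_deriv W f D M" and E: "c11_deriv W g E N" using assms by (auto simp: c11_def)
  have le: "norm (a * b) \<le> A * B" if "norm a \<le> A" "norm b \<le> B" for a b :: 'b and A B
    using that norm_mult_ineq[of a b] mult_mono[OF that] order_trans[OF norm_ge_zero that(1)] by fastforce
  have "c11_deriv W (\<lambda>y. f y * g y) (\<lambda>y v. f y * E y v + D y v * g y) (4 * M * N)"
    unfolding c11_deriv_def
  proof (intro ballI conjI allI)
    fix y v assume y: "y \<in> W"
    have MN: "M * N \<ge> 0" using c11_derivD(5)[OF D y] c11_derivD(5)[OF E y] by simp
    show "((\<lambda>y. f y * g y) has_derivative (\<lambda>v. f y * E y v + D y v * g y)) (at y)"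
      by (intro has_derivative_mult c11_derivD[OF D y] c11_derivD[OF E y])
    show "norm (f y * g y) \<le> 4 * M * N"
      using le[OF c11_derivD(2)[OF D y] c11_derivD(2)[OF E y]] MN by linarith
    have "norm (f y * E y v) \<le> M * (N * norm v)" "norm (D y v * g y) \<le> M * norm v * N"
      by (intro le c11_derivD[OF D y] c11_derivD[OF E y])+
    then have "norm (f y * E y v + D y v * g y) \<le> 2 * (M * N) * norm v"
      by (intro order_trans[OF norm_triangle_ineq]) (simp add: mult_ac)
    also have "\<dots> \<le> 4 * M * N * norm v" using MN by (intro mult_right_mono) auto
    finally show "norm (f y * E y v + D y v * g y) \<le> 4 * M * N * norm v" .
    fix y' assume y': "y' \<in> W"
    have "f y * E y v + D y v * g y - (f y' * E y' v + D y' v * g y') =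
       (f y - f y') * E y v + f y' * (E y v - E y' v) + ((D y v - D y' v) * g y + D y' v * (g y - g y'))"
      by (simp add: algebra_simps)
    also have "norm \<dots> \<le> (M * norm (y - y') * (N * norm v) + M * (N * norm (y - y') * norm v)) +
        (M * norm (y - y') * norm v * N + M * norm v * (N * norm (y - y')))"
      by (intro norm_triangle_mono le c11_derivD(2,3)[OF D y] c11_derivD(2,3)[OF E y]
          c11_derivD(2,3)[OF D y'] c11_derivD(4)[OF D y y'] c11_derivD(4)[OF E y y']
          c11_lipschitz[OF D assms(3) y y'] c11_lipschitz[OF E assms(3) y y'])
    also have "\<dots> = 4 * M * N * norm (y - y') * norm v" by (simp add: algebra_simps)
    finally show "norm (f y * E y v + D y v * g y - (f y' * E y' v + D y' v * g y')) \<le> \<dots>" .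
  qed
  then show ?thesis by (auto simp: c11_def)
qed

lemma c11_cmult:
  fixes f :: "'a::euclidean_space \<Rightarrow> 'b::real_normed_algebra"
  assumes "c11 W f M" "convex W"
  shows "c11 W (\<lambda>y. c * f y) (4 * norm c * M)"
  using c11_mult[OF c11_const[OF order_refl] assms] .

lemma onorm_scaleR_left_le:
  assumes "norm c \<le> M"
  shows "onorm (\<lambda>h::real. h *\<^sub>R c) \<le> M"
  using assms mult_left_mono[OF assms, of "\<bar>h\<bar>" for h] order_trans[OF norm_ge_zero assms]
  by (intro onorm_bound) (simp_all add: mult.commute)

text \<open>In the constant, \<open>A\<close> controls the first derivative of the composition,
  \<open>A\<^sup>2\<close> accompanies \<open>\<psi>''\<close>, and \<open>B\<close> comes from the
  variation of the derivative of \<open>\<rho>\<close>. Convexity of \<open>J\<close> is for the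
  mean value inequality applied to \<open>\<psi>'\<close>.\<close>

lemma c11_compose_real:
  fixes \<psi> \<psi>' \<psi>'' :: "real \<Rightarrow> complex" and \<rho> :: "'a::euclidean_space \<Rightarrow> real"
  assumes W: "convex W"
    and \<rho>: "\<And>y. y \<in> W \<Longrightarrow> (\<rho> has_derivative D y) (at y)"
    and A: "\<And>y v. y \<in> W \<Longrightarrow> \<bar>D y v\<bar> \<le> A * norm v"
    and B: "\<And>y y' v. y \<in> W \<Longrightarrow> y' \<in> W \<Longrightarrow> \<bar>D y v - D y' v\<bar> \<le> B * norm (y - y') * norm v"
    and AB: "A \<ge> 0" "B \<ge> 0"
    and J: "convex J" "\<And>y. y \<in> W \<Longrightarrow> \<rho> y \<in> J"
    and d1: "\<And>r. r \<in> J \<Longrightarrow> (\<psi> has_vector_derivative \<psi>' r) (at r)"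
    and d2: "\<And>r. r \<in> J \<Longrightarrow> (\<psi>' has_vector_derivative \<psi>'' r) (at r)"
    and M: "\<And>r. r \<in> J \<Longrightarrow> norm (\<psi> r) \<le> M" "\<And>r. r \<in> J \<Longrightarrow> norm (\<psi>' r) \<le> M" "\<And>r. r \<in> J \<Longrightarrow> norm (\<psi>'' r) \<le> M"
  shows "c11 W (\<lambda>y. \<psi> (\<rho> y)) (M * (1 + A + A\<^sup>2 + B))"
proof -
  have "c11_deriv W (\<lambda>y. \<psi> (\<rho> y)) (\<lambda>y v. D y v *\<^sub>R \<psi>' (\<rho> y)) (M * (1 + A + A\<^sup>2 + B))"
    unfolding c11_deriv_def
  proof (intro ballI conjI allI)
    fix y v assume y: "y \<in> W"
    have M0: "M \<ge> 0" using M(1)[OF J(2)[OF y]] norm_ge_zero order_trans by blast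
    show "((\<lambda>y. \<psi> (\<rho> y)) has_derivative (\<lambda>v. D y v *\<^sub>R \<psi>' (\<rho> y))) (at y)"
      using has_derivative_compose[OF \<rho>[OF y] d1[OF J(2)[OF y], unfolded has_vector_derivative_def]] .
    have "norm (\<psi> (\<rho> y)) \<le> M * 1" using M(1)[OF J(2)[OF y]] by simp
    also have "\<dots> \<le> M * (1 + A + A\<^sup>2 + B)" using M0 AB by (intro mult_left_mono) auto
    finally show "norm (\<psi> (\<rho> y)) \<le> M * (1 + A + A\<^sup>2 + B)" .
    have "norm (D y v *\<^sub>R \<psi>' (\<rho> y)) \<le> (A * norm v) * M"
      using A[OF y, of v] M(2)[OF J(2)[OF y]] AB by (auto intro!: mult_mono)
    also have "\<dots> = M * A * norm v" by simp
    also have "\<dots> \<le> M * (1 + A + A\<^sup>2 + B) * norm v"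
      using M0 AB by (intro mult_right_mono mult_left_mono) auto
    finally show "norm (D y v *\<^sub>R \<psi>' (\<rho> y)) \<le> M * (1 + A + A\<^sup>2 + B) * norm v" .
    fix y' assume y': "y' \<in> W"
    have "norm (\<psi>' (\<rho> y) - \<psi>' (\<rho> y')) \<le> M * norm (\<rho> y - \<rho> y')"
    proof (rule differentiable_bound[OF J(1), of \<psi>' "\<lambda>r h. h *\<^sub>R \<psi>'' r"])
      show "(\<psi>' has_derivative (\<lambda>h. h *\<^sub>R \<psi>'' r)) (at r within J)" if "r \<in> J" for r
        using d2[OF that] by (simp add: has_vector_derivative_def has_derivative_at_withinI)
      show "onorm (\<lambda>h. h *\<^sub>R \<psi>'' r) \<le> M" if "r \<in> J" for r
        using M(3)[OF that] by (rule onorm_scaleR_left_le)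
    qed (use J y y' in auto)
    also have "norm (\<rho> y - \<rho> y') \<le> A * norm (y - y')"
    proof (rule differentiable_bound[OF W])
      show "onorm (D x) \<le> A" if "x \<in> W" for x
        using A[OF that] AB by (intro onorm_bound) auto
    qed (use y y' \<rho> in \<open>auto intro: has_derivative_at_withinI\<close>)
    finally have L: "norm (\<psi>' (\<rho> y) - \<psi>' (\<rho> y')) \<le> M * (A * norm (y - y'))"
      using M0 by (simp add: mult_left_mono)
    have "D y v *\<^sub>R \<psi>' (\<rho> y) - D y' v *\<^sub>R \<psi>' (\<rho> y') =
       D y v *\<^sub>R (\<psi>' (\<rho> y) - \<psi>' (\<rho> y')) + (D y v - D y' v) *\<^sub>R \<psi>' (\<rho> y')"
      by (simp add: algebra_simps)
    also have "norm \<dots> \<le> (A * norm v) * (M * (A * norm (y - y'))) + (B * norm (y - y') * norm v) * M"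
      unfolding norm_scaleR[symmetric]
      by (rule norm_triangle_mono; unfold norm_scaleR; rule mult_mono)
        (use A[OF y] B[OF y y'] L M(2)[OF J(2)[OF y']] AB in auto)
    also have "\<dots> = M * (A\<^sup>2 + B) * norm (y - y') * norm v" by (simp add: power2_eq_square algebra_simps)
    also have "\<dots> \<le> M * (1 + A + A\<^sup>2 + B) * norm (y - y') * norm v"
      using M0 AB by (intro mult_right_mono mult_left_mono) auto
    finally show "norm (D y v *\<^sub>R \<psi>' (\<rho> y) - D y' v *\<^sub>R \<psi>' (\<rho> y')) \<le> M * (1 + A + A\<^sup>2 + B) * norm (y - y') * norm v" .
  qed
  then show ?thesis by (auto simp: c11_def)
qed

section \<open>Taylor remainders in the test norm\<close>

lemma vector_mean_value_bound:
  fixes g :: "real \<Rightarrow> 'b::real_normed_vector"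
  assumes "\<And>t. t \<in> {0..1} \<Longrightarrow> (g has_vector_derivative g1 t) (at t)"
    and "\<And>t. t \<in> {0..1} \<Longrightarrow> norm (g1 t) \<le> B" and s: "s \<in> {0..1}"
  shows "norm (g s - g 0) \<le> B"
proof -
  have B0: "B \<ge> 0" using assms(2)[OF s] norm_ge_zero order_trans by blast
  have "norm (g s - g 0) \<le> B * norm (s - 0)"
  proof (rule differentiable_bound[of "{0..1}" g "\<lambda>t h. h *\<^sub>R g1 t"])
    show "(g has_derivative (\<lambda>h. h *\<^sub>R g1 t)) (at t within {0..1})" if "t \<in> {0..1}" for t
      using assms(1)[OF that] by (simp add: has_vector_derivative_def has_derivative_at_withinI)
    show "onorm (\<lambda>h. h *\<^sub>R g1 t) \<le> B" if "t \<in> {0..1}" for t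
      using assms(2)[OF that] by (rule onorm_scaleR_left_le)
  qed (use s in auto)
  also have "\<dots> \<le> B * 1" using B0 s by (intro mult_left_mono) auto
  finally show ?thesis by simp
qed

text \<open>Two mean value estimates, first for \<open>f1\<close> and then for
  \<open>t \<mapsto> f t - t * f1 0\<close>; this gives \<open>M\<close> rather than the sharp
  \<open>M / 2\<close>.\<close>

lemma taylor_remainder_bound:
  fixes f :: "real \<Rightarrow> 'b::real_normed_vector"
  assumes 1: "\<And>t. t \<in> {0..1} \<Longrightarrow> (f has_vector_derivative f1 t) (at t)"
    and 2: "\<And>t. t \<in> {0..1} \<Longrightarrow> (f1 has_vector_derivative f2 t) (at t)"
    and M: "\<And>t. t \<in> {0..1} \<Longrightarrow> norm (f2 t) \<le> M"
  shows "norm (f 1 - f 0 - f1 0) \<le> M"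
proof -
  have "norm ((f 1 - 1 *\<^sub>R f1 0) - (f 0 - 0 *\<^sub>R f1 0)) \<le> M"
  proof (rule vector_mean_value_bound[of "\<lambda>t. f t - t *\<^sub>R f1 0" "\<lambda>t. f1 t - f1 0" M 1])
    show "((\<lambda>t. f t - t *\<^sub>R f1 0) has_vector_derivative (f1 t - f1 0)) (at t)" if "t \<in> {0..1}" for t
      using 1[OF that] by (auto intro!: derivative_eq_intros)
    show "norm (f1 t - f1 0) \<le> M" if "t \<in> {0..1}" for t
      using vector_mean_value_bound[of f1 f2 M t] 2 M that by blast
  qed auto
  then show ?thesis by (simp add: algebra_simps)
qed

text \<open>The estimate in \<open>t\<close> is applied to the values, to the derivatives in
  \<open>y\<close> and to differences of these derivatives. Those are the quantities that
  \<open>c11_deriv\<close> bounds, so a bound on the second \<open>t\<close> derivative passes to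
  the remainder.\<close>

lemma taylor_c11:
  fixes f :: "real \<Rightarrow> 'a::euclidean_space \<Rightarrow> complex"
  assumes f: "\<And>t y. t \<in> {0..1} \<Longrightarrow> y \<in> W \<Longrightarrow> ((\<lambda>t. f t y) has_vector_derivative f1 t y) (at t)"
    and f1: "\<And>t y. t \<in> {0..1} \<Longrightarrow> y \<in> W \<Longrightarrow> ((\<lambda>t. f1 t y) has_vector_derivative f2 t y) (at t)"
    and D: "\<And>t y v. t \<in> {0..1} \<Longrightarrow> y \<in> W \<Longrightarrow> ((\<lambda>t. D t y v) has_vector_derivative D1 t y v) (at t)"
    and D1: "\<And>t y v. t \<in> {0..1} \<Longrightarrow> y \<in> W \<Longrightarrow> ((\<lambda>t. D1 t y v) has_vector_derivative D2 t y v) (at t)"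
    and df: "\<And>t y. t \<in> {0..1} \<Longrightarrow> y \<in> W \<Longrightarrow> (f t has_derivative D t y) (at y)"
    and df1: "\<And>y. y \<in> W \<Longrightarrow> (f1 0 has_derivative D1 0 y) (at y)"
    and c: "\<And>t. t \<in> {0..1} \<Longrightarrow> c11_deriv W (f2 t) (D2 t) M"
  shows "c11 W (\<lambda>y. f 1 y - f 0 y - f1 0 y) M"
proof -
  have "c11_deriv W (\<lambda>y. f 1 y - f 0 y - f1 0 y) (\<lambda>y v. D 1 y v - D 0 y v - D1 0 y v) M"
    unfolding c11_deriv_def
  proof (intro ballI conjI allI)
    fix y v assume y: "y \<in> W"
    show "((\<lambda>y. f 1 y - f 0 y - f1 0 y) has_derivative (\<lambda>v. D 1 y v - D 0 y v - D1 0 y v)) (at y)"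
      using y by (intro has_derivative_diff df df1) auto
    show "norm (f 1 y - f 0 y - f1 0 y) \<le> M"
      using taylor_remainder_bound[of "\<lambda>t. f t y" "\<lambda>t. f1 t y" "\<lambda>t. f2 t y" M] f f1 c11_derivD(2)[OF c] y by blast
    show "norm (D 1 y v - D 0 y v - D1 0 y v) \<le> M * norm v"
      using taylor_remainder_bound[of "\<lambda>t. D t y v" "\<lambda>t. D1 t y v" "\<lambda>t. D2 t y v" "M * norm v"]
        D D1 c11_derivD(3)[OF c] y by blast
    fix y' assume y': "y' \<in> W"
    have "norm ((D 1 y v - D 1 y' v) - (D 0 y v - D 0 y' v) - (D1 0 y v - D1 0 y' v)) \<le> M * norm (y - y') * norm v"
      by (rule taylor_remainder_bound[of "\<lambda>t. D t y v - D t y' v" "\<lambda>t. D1 t y v - D1 t y' v" "\<lambda>t. D2 t y v - D2 t y' v"])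
        (use D D1 c11_derivD(4)[OF c] y y' in \<open>auto intro!: has_vector_derivative_diff\<close>)
    then show "norm (D 1 y v - D 0 y v - D1 0 y v - (D 1 y' v - D 0 y' v - D1 0 y' v)) \<le> M * norm (y - y') * norm v"
      by (simp add: algebra_simps)
  qed
  then show ?thesis by (auto simp: c11_def)
qed

lemma abs_inner_le: "\<bar>a \<bullet> b\<bar> \<le> norm a * norm b"
  by (rule Cauchy_Schwarz_ineq2)

lemma has_derivative_norm_shift:
  fixes x y :: "'a::euclidean_space"
  assumes "x \<noteq> y"
  shows "((\<lambda>y. norm (x - y)) has_derivative (\<lambda>v. - (((x - y) /\<^sub>R norm (x - y)) \<bullet> v))) (at y)"
proof -
  have "((\<lambda>y. x - y) has_derivative (\<lambda>v. - v)) (at y)" by (auto intro!: derivative_eq_intros)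
  moreover have "(norm has_derivative (\<lambda>v. sgn (x - y) \<bullet> v)) (at (x - y))"
    using assms has_derivative_norm[of "x - y"] by (simp add: inner_commute)
  ultimately have "((\<lambda>y. norm (x - y)) has_derivative (\<lambda>v. sgn (x - y) \<bullet> (- v))) (at y)"
    by (rule has_derivative_compose)
  then show ?thesis by (simp add: sgn_div_norm)
qed

lemma unit_vector_diff:
  fixes a b :: "'a::real_normed_vector"
  assumes "norm a \<ge> 1" "norm b \<ge> 1"
  shows "norm (a /\<^sub>R norm a - b /\<^sub>R norm b) \<le> 2 * norm (a - b)"
proof -
  have a: "norm a > 0" and b: "norm b > 0" using assms by linarith+
  have e: "a /\<^sub>R norm a - b /\<^sub>R norm b = (a - b) /\<^sub>R norm a + ((norm b - norm a) / (norm a * norm b)) *\<^sub>R b"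
  proof -
    have "inverse (norm a) - inverse (norm b) = (norm b - norm a) / (norm a * norm b)"
      using a b by (simp add: field_simps)
    then have "((norm b - norm a) / (norm a * norm b)) *\<^sub>R b = (inverse (norm a) - inverse (norm b)) *\<^sub>R b"
      by simp
    then show ?thesis by (simp add: algebra_simps)
  qed
  have 1: "norm ((a - b) /\<^sub>R norm a) \<le> norm (a - b)"
  proof -
    have "norm ((a - b) /\<^sub>R norm a) = norm (a - b) / norm a" by (simp add: divide_inverse mult.commute)
    also have "\<dots> \<le> norm (a - b) / 1" using assms by (intro frac_le) auto
    finally show ?thesis by simp
  qed
  have "norm (((norm b - norm a) / (norm a * norm b)) *\<^sub>R b) = \<bar>norm b - norm a\<bar> / norm a"
    using a b by (simp add: abs_mult)
  also have "\<dots> \<le> norm (a - b) / 1"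
    using assms a norm_triangle_ineq3[of a b] by (intro frac_le) (auto simp: abs_minus_commute)
  finally have 2: "norm (((norm b - norm a) / (norm a * norm b)) *\<^sub>R b) \<le> norm (a - b)" by simp
  show ?thesis unfolding e using norm_triangle_mono[OF 1 2] by simp
qed

text \<open>Outside the unit ball around \<open>x\<close> the distance has a gradient of norm 1 with
  Lipschitz constant 2, so the factor is \<open>1 + 1 + 1 + 2\<close>.\<close>

lemma c11_compose_dist:
  fixes \<psi> \<psi>' \<psi>'' :: "real \<Rightarrow> complex" and x :: "'a::euclidean_space"
  assumes W: "convex W" and J: "convex J" "\<And>y. y \<in> W \<Longrightarrow> norm (x - y) \<in> J" "\<And>r. r \<in> J \<Longrightarrow> r \<ge> 1"
    and d: "\<And>r. r \<in> J \<Longrightarrow> (\<psi> has_vector_derivative \<psi>' r) (at r)"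
      "\<And>r. r \<in> J \<Longrightarrow> (\<psi>' has_vector_derivative \<psi>'' r) (at r)"
    and M: "\<And>r. r \<in> J \<Longrightarrow> norm (\<psi> r) \<le> M" "\<And>r. r \<in> J \<Longrightarrow> norm (\<psi>' r) \<le> M" "\<And>r. r \<in> J \<Longrightarrow> norm (\<psi>'' r) \<le> M"
  shows "c11 W (\<lambda>y. \<psi> (norm (x - y))) (5 * M)"
proof -
  have n: "norm (x - y) \<ge> 1" if "y \<in> W" for y using J that by blast
  have "c11 W (\<lambda>y. \<psi> (norm (x - y))) (M * (1 + 1 + 1\<^sup>2 + 2))"
  proof (rule c11_compose_real[OF W _ _ _ _ _ J(1,2) d M])
    show "((\<lambda>y. norm (x - y)) has_derivative (\<lambda>v. - (((x - y) /\<^sub>R norm (x - y)) \<bullet> v))) (at y)" if "y \<in> W" for y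
      using n[OF that] by (intro has_derivative_norm_shift) auto
    show "\<bar>- (((x - y) /\<^sub>R norm (x - y)) \<bullet> v)\<bar> \<le> 1 * norm v" if "y \<in> W" for y v
    proof -
      have "norm (x - y) \<noteq> 0" using n[OF that] by linarith
      then have "norm ((x - y) /\<^sub>R norm (x - y)) = 1" by simp
      then show ?thesis using abs_inner_le[of "(x - y) /\<^sub>R norm (x - y)" v] by simp
    qed
    show "\<bar>- (((x - y) /\<^sub>R norm (x - y)) \<bullet> v) - - (((x - y') /\<^sub>R norm (x - y')) \<bullet> v)\<bar> \<le> 2 * norm (y - y') * norm v"
      if "y \<in> W" "y' \<in> W" for y y' v
    proof -
      have "\<bar>- (((x - y) /\<^sub>R norm (x - y)) \<bullet> v) - - (((x - y') /\<^sub>R norm (x - y')) \<bullet> v)\<bar> =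
         \<bar>((x - y') /\<^sub>R norm (x - y') - (x - y) /\<^sub>R norm (x - y)) \<bullet> v\<bar>"
        by (simp add: inner_diff_left)
      also have "\<dots> \<le> norm ((x - y') /\<^sub>R norm (x - y') - (x - y) /\<^sub>R norm (x - y)) * norm v"
        by (rule abs_inner_le)
      also have "\<dots> \<le> (2 * norm ((x - y') - (x - y))) * norm v"
        by (intro mult_right_mono unit_vector_diff n that) auto
      finally show ?thesis by simp
    qed
  qed auto
  then show ?thesis by (simp add: mult.commute)
qed

lemma c11_cong:
  assumes "c11 W f M" "open W" "\<And>y. y \<in> W \<Longrightarrow> f y = g y"
  shows "c11 W g M"
proof -
  obtain D where D: "c11_deriv W f D M" using assms(1) by (auto simp: c11_def)
  have "(g has_derivative D y) (at y)" if "y \<in> W" for y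
    using has_derivative_transform_within_open[OF c11_derivD(1)[OF D that] assms(2) that assms(3)] by simp
  then have "c11_deriv W g D M" using D assms(3) by (simp add: c11_deriv_def)
  then show ?thesis by (auto simp: c11_def)
qed

lemma c11_inner:
  assumes "\<And>y. y \<in> W \<Longrightarrow> norm (x - y) \<le> S" "S \<ge> 1"
  shows "c11 W (\<lambda>y. complex_of_real ((x - y) \<bullet> v)) (S * norm v)"
proof -
  have "c11_deriv W (\<lambda>y. complex_of_real ((x - y) \<bullet> v)) (\<lambda>y w. of_real (- (w \<bullet> v))) (S * norm v)"
    unfolding c11_deriv_def
  proof (intro ballI conjI allI)
    fix y w assume y: "y \<in> W"
    show "((\<lambda>y. complex_of_real ((x - y) \<bullet> v)) has_derivative (\<lambda>w. of_real (- (w \<bullet> v)))) (at y)"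
      by (auto intro!: derivative_eq_intros)
    show "norm (complex_of_real ((x - y) \<bullet> v)) \<le> S * norm v"
      using abs_inner_le[of "x - y" v] mult_right_mono[OF assms(1)[OF y], of "norm v"] by simp
    have "\<bar>w \<bullet> v\<bar> \<le> norm w * norm v" by (rule abs_inner_le)
    also have "\<dots> \<le> S * (norm w * norm v)" using mult_right_mono[OF assms(2), of "norm w * norm v"] by simp
    finally show "norm (complex_of_real (- (w \<bullet> v))) \<le> S * norm v * norm w" by (simp add: mult_ac)
    fix y' assume "y' \<in> W"
    show "norm (complex_of_real (- (w \<bullet> v)) - complex_of_real (- (w \<bullet> v))) \<le> S * norm v * norm (y - y') * norm w"
      using assms(2) by simp
  qed
  then show ?thesis by (auto simp: c11_def)
qed

section \<open>Kernels that depend on the squared norm\<close>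

locale radial_kernel =
  fixes G :: "'a::euclidean_space \<Rightarrow> complex" and \<Phi> :: "nat \<Rightarrow> real \<Rightarrow> complex"
  assumes G_eq: "x \<noteq> 0 \<Longrightarrow> G x = \<Phi> 0 (x \<bullet> x)"
    and \<Phi>_deriv: "q > 0 \<Longrightarrow> (\<Phi> j has_vector_derivative \<Phi> (Suc j) q) (at q)"
begin

definition DG :: "'a \<Rightarrow> 'a \<Rightarrow> complex" where
  "DG z v = 2 * \<Phi> 1 (z \<bullet> z) * of_real (z \<bullet> v)"

lemma \<Phi>_has_derivative:
  assumes "z \<noteq> 0"
  shows "((\<lambda>z. \<Phi> j (z \<bullet> z)) has_derivative (\<lambda>w. 2 * of_real (z \<bullet> w) * \<Phi> (Suc j) (z \<bullet> z))) (at z)"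
proof -
  have "((\<lambda>z. z \<bullet> z) has_derivative (\<lambda>w. 2 * (z \<bullet> w))) (at z)"
    by (auto intro!: derivative_eq_intros simp: inner_commute)
  from has_derivative_compose[OF this \<Phi>_deriv[of "z \<bullet> z" j, unfolded has_vector_derivative_def]] assms
  show ?thesis by (simp add: scaleR_conv_of_real)
qed

lemma G_has_derivative:
  assumes "z \<noteq> 0"
  shows "(G has_derivative DG z) (at z)"
proof -
  have "((\<lambda>z. \<Phi> 0 (z \<bullet> z)) has_derivative DG z) (at z)"
    using \<Phi>_has_derivative[OF assms, of 0] by (simp add: DG_def[abs_def] mult_ac)
  then show ?thesis
    by (rule has_derivative_transform_within_open[of _ _ _ _ "- {0}"]) (use assms G_eq in auto)
qed

lemma \<Phi>_shift_has_derivative: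
  assumes "x \<noteq> y"
  shows "((\<lambda>y. \<Phi> j ((x - y) \<bullet> (x - y))) has_derivative
     (\<lambda>w. - 2 * of_real ((x - y) \<bullet> w) * \<Phi> (Suc j) ((x - y) \<bullet> (x - y)))) (at y)"
proof -
  have "((\<lambda>y. x - y) has_derivative (\<lambda>v. - v)) (at y)" by (auto intro!: derivative_eq_intros)
  from has_derivative_compose[OF this \<Phi>_has_derivative[of "x - y" j]] assms show ?thesis by simp
qed

lemma \<Phi>_line_has_derivative:
  assumes "x + t *\<^sub>R v - y \<noteq> 0"
  shows "((\<lambda>t. \<Phi> j ((x + t *\<^sub>R v - y) \<bullet> (x + t *\<^sub>R v - y))) has_vector_derivative
     2 * of_real ((x + t *\<^sub>R v - y) \<bullet> v) * \<Phi> (Suc j) ((x + t *\<^sub>R v - y) \<bullet> (x + t *\<^sub>R v - y))) (at t)"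
proof -
  have "((\<lambda>t. x + t *\<^sub>R v - y) has_derivative (\<lambda>h. h *\<^sub>R v)) (at t)" by (auto intro!: derivative_eq_intros)
  from has_derivative_compose[OF this \<Phi>_has_derivative[OF assms, of j]] show ?thesis
    unfolding has_vector_derivative_def by (simp add: scaleR_conv_of_real mult_ac)
qed

lemma inner_line_has_derivative:
  "((\<lambda>t. complex_of_real ((x + t *\<^sub>R v - y) \<bullet> w)) has_vector_derivative of_real (v \<bullet> w)) (at t)"
  unfolding has_vector_derivative_def
  by (auto intro!: derivative_eq_intros simp: scaleR_conv_of_real)

lemma inner_shift_has_derivative:
  "((\<lambda>y. complex_of_real ((x - y) \<bullet> v)) has_derivative (\<lambda>w. - of_real (v \<bullet> w))) (at y)"
  by (auto intro!: derivative_eq_intros simp: inner_commute)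

text \<open>The arguments stay in the compact interval from 1 to \<open>S\<^sup>2\<close>, so a
  single constant serves all admissible \<open>x\<close>; the Taylor estimate needs this uniformity
  along a segment.\<close>

lemma c11_\<Phi>:
  assumes W: "convex W" and S: "S \<ge> 1"
  shows "\<exists>K. \<forall>x::'a. (\<forall>y\<in>W. 1 \<le> norm (x - y) \<and> norm (x - y) \<le> S) \<longrightarrow>
     c11 W (\<lambda>y. \<Phi> j ((x - y) \<bullet> (x - y))) K"
proof -
  have "\<exists>B. \<forall>q\<in>{1..S\<^sup>2}. norm (\<Phi> i q) \<le> B" for i
  proof -
    have "continuous_on {1..S\<^sup>2} (\<Phi> i)"
      by (rule continuous_on_vector_derivative[OF has_vector_derivative_at_within[OF \<Phi>_deriv]]) auto
    then have "compact (\<Phi> i ` {1..S\<^sup>2})" by (intro compact_continuous_image) auto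
    then show ?thesis by (meson bounded_iff compact_imp_bounded imageI)
  qed
  then obtain B where B: "\<And>i q. q \<in> {1..S\<^sup>2} \<Longrightarrow> norm (\<Phi> i q) \<le> B i" by metis
  define M where "M = max (B j) (max (B (Suc j)) (B (Suc (Suc j))))"
  have "c11 W (\<lambda>y. \<Phi> j ((x - y) \<bullet> (x - y))) (M * (1 + 2 * S + (2 * S)\<^sup>2 + 2))"
    if x: "\<forall>y\<in>W. 1 \<le> norm (x - y) \<and> norm (x - y) \<le> S" for x :: 'a
  proof (rule c11_compose_real[OF W, where J = "{1..S\<^sup>2}" and D = "\<lambda>y v. - 2 * ((x - y) \<bullet> v)"])
    show "((\<lambda>y. (x - y) \<bullet> (x - y)) has_derivative (\<lambda>v. - 2 * ((x - y) \<bullet> v))) (at y)" for y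
      by (auto intro!: derivative_eq_intros simp: inner_commute algebra_simps)
    show "\<bar>- 2 * ((x - y) \<bullet> v)\<bar> \<le> 2 * S * norm v" if "y \<in> W" for y v
      using abs_inner_le[of "x - y" v] mult_right_mono[of "norm (x - y)" S "norm v"] x that by (auto simp: abs_mult)
    show "\<bar>- 2 * ((x - y) \<bullet> v) - - 2 * ((x - y') \<bullet> v)\<bar> \<le> 2 * norm (y - y') * norm v" for y y' v
    proof -
      have "- 2 * ((x - y) \<bullet> v) - - 2 * ((x - y') \<bullet> v) = 2 * ((y - y') \<bullet> v)" by (simp add: inner_diff_left)
      then show ?thesis using abs_inner_le[of "y - y'" v] by (simp add: abs_mult)
    qed
    show "(x - y) \<bullet> (x - y) \<in> {1..S\<^sup>2}" if "y \<in> W" for y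
      using x that S by (auto simp: power2_norm_eq_inner[symmetric] intro!: power_mono)
    show "(\<Phi> j has_vector_derivative \<Phi> (Suc j) r) (at r)" "(\<Phi> (Suc j) has_vector_derivative \<Phi> (Suc (Suc j)) r) (at r)"
      if "r \<in> {1..S\<^sup>2}" for r using \<Phi>_deriv that by auto
    show "norm (\<Phi> j r) \<le> M" "norm (\<Phi> (Suc j) r) \<le> M" "norm (\<Phi> (Suc (Suc j)) r) \<le> M"
      if "r \<in> {1..S\<^sup>2}" for r using B[OF that] unfolding M_def by (auto intro: max.coboundedI1 max.coboundedI2)
  qed (use S in auto)
  then show ?thesis by blast
qed

lemma c11_DG:
  assumes W: "convex W" and S: "S \<ge> 1"
  shows "\<exists>K. \<forall>x::'a. (\<forall>y\<in>W. 1 \<le> norm (x - y) \<and> norm (x - y) \<le> S) \<longrightarrow>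
     (\<forall>v. c11 W (\<lambda>y. DG (x - y) v) (K * norm v))"
proof -
  obtain K where K: "\<And>x::'a. (\<forall>y\<in>W. 1 \<le> norm (x - y) \<and> norm (x - y) \<le> S) \<Longrightarrow>
     c11 W (\<lambda>y. \<Phi> 1 ((x - y) \<bullet> (x - y))) K" using c11_\<Phi>[OF assms] by blast
  have "c11 W (\<lambda>y. DG (x - y) v) (4 * (4 * norm (2::complex) * K) * (S * norm v))"
    if x: "\<forall>y\<in>W. 1 \<le> norm (x - y) \<and> norm (x - y) \<le> S" for x v
    unfolding DG_def using K[OF x] x S
    by (intro c11_mult c11_cmult c11_inner W) auto
  then have "\<forall>x::'a. (\<forall>y\<in>W. 1 \<le> norm (x - y) \<and> norm (x - y) \<le> S) \<longrightarrow>
     (\<forall>v. c11 W (\<lambda>y. DG (x - y) v) ((4 * (4 * norm (2::complex) * K) * S) * norm v))"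
    by (simp only: mult.assoc) blast
  then show ?thesis by blast
qed

text \<open>Taylor expansion along the segment from \<open>x\<close> to \<open>x + v\<close>: each
  \<open>t\<close> derivative produces one factor \<open>v\<close>, so the second derivative has
  size \<open>(norm v)\<^sup>2\<close> in the test norm.\<close>

lemma c11_remainder:
  assumes W: "convex W" "open W" and S: "S \<ge> 1"
  shows "\<exists>K. \<forall>x v::'a. (\<forall>t\<in>{0..1}. \<forall>y\<in>W. 1 \<le> norm (x + t *\<^sub>R v - y) \<and> norm (x + t *\<^sub>R v - y) \<le> S) \<longrightarrow>
     c11 W (\<lambda>y. G (x + v - y) - G (x - y) - DG (x - y) v) (K * (norm v)\<^sup>2)"
proof -
  obtain K1 where K1: "\<And>x::'a. (\<forall>y\<in>W. 1 \<le> norm (x - y) \<and> norm (x - y) \<le> S) \<Longrightarrow>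
     c11 W (\<lambda>y. \<Phi> 1 ((x - y) \<bullet> (x - y))) K1" using c11_\<Phi>[OF W(1) S] by blast
  obtain K2 where K2: "\<And>x::'a. (\<forall>y\<in>W. 1 \<le> norm (x - y) \<and> norm (x - y) \<le> S) \<Longrightarrow>
     c11 W (\<lambda>y. \<Phi> 2 ((x - y) \<bullet> (x - y))) K2" using c11_\<Phi>[OF W(1) S] by blast
  \<comment> \<open>One factor 4 per use of \<open>c11_mult\<close>; the inner 4 and 2 are the
    coefficients in \<open>f2\<close>, and each \<open>S\<close> bounds an inner product with
    \<open>z t y\<close>.\<close>
  define K where "K = 4 * (4 * 4 * K2) * (4 * S * S) + 4 * (4 * 2 * K1)"
  have "c11 W (\<lambda>y. G (x + v - y) - G (x - y) - DG (x - y) v) (K * (norm v)\<^sup>2)"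
    if x: "\<forall>t\<in>{0..1}. \<forall>y\<in>W. 1 \<le> norm (x + t *\<^sub>R v - y) \<and> norm (x + t *\<^sub>R v - y) \<le> S" for x v
  proof -
    define z where "z t y = x + t *\<^sub>R v - y" for t y
    define f where "f t y = \<Phi> 0 (z t y \<bullet> z t y)" for t y
    define f1 where "f1 t y = 2 * \<Phi> 1 (z t y \<bullet> z t y) * of_real (z t y \<bullet> v)" for t y
    define f2 where "f2 t y = 4 * \<Phi> 2 (z t y \<bullet> z t y) * (of_real (z t y \<bullet> v) * of_real (z t y \<bullet> v)) +
       2 * \<Phi> 1 (z t y \<bullet> z t y) * of_real (v \<bullet> v)" for t y
    \<comment> \<open>\<open>D\<close>, \<open>D1\<close>, \<open>D2\<close> are the derivatives in
      \<open>y\<close> of \<open>f\<close>, \<open>f1\<close>, \<open>f2\<close>; the minus signs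
      arise because \<open>z\<close> contains \<open>- y\<close>.\<close>
    define D where "D t y w = - (2 * \<Phi> 1 (z t y \<bullet> z t y) * of_real (z t y \<bullet> w))" for t y w
    define D1 where "D1 t y w = - (4 * \<Phi> 2 (z t y \<bullet> z t y) * of_real (z t y \<bullet> v) * of_real (z t y \<bullet> w) +
       2 * \<Phi> 1 (z t y \<bullet> z t y) * of_real (v \<bullet> w))" for t y w
    define D2 where "D2 t y w = - (8 * \<Phi> 3 (z t y \<bullet> z t y) * (of_real (z t y \<bullet> v) * of_real (z t y \<bullet> v)) * of_real (z t y \<bullet> w) +
       4 * \<Phi> 2 (z t y \<bullet> z t y) * of_real (v \<bullet> v) * of_real (z t y \<bullet> w) +
       8 * \<Phi> 2 (z t y \<bullet> z t y) * of_real (z t y \<bullet> v) * of_real (v \<bullet> w))" for t y w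
    have nz: "z t y \<noteq> 0" if "t \<in> {0..1}" "y \<in> W" for t y
      using x that by (force simp: z_def)
    have dt: "((\<lambda>t. \<Phi> j (z t y \<bullet> z t y)) has_vector_derivative
        2 * of_real (z t y \<bullet> v) * \<Phi> (Suc j) (z t y \<bullet> z t y)) (at t)" if "t \<in> {0..1}" "y \<in> W" for j t y
      using \<Phi>_line_has_derivative[of x t v y j] nz[OF that] by (simp add: z_def)
    have it: "((\<lambda>t. complex_of_real (z t y \<bullet> w)) has_vector_derivative of_real (v \<bullet> w)) (at t)" for t y w
      unfolding z_def by (rule inner_line_has_derivative)
    have dy: "((\<lambda>y. \<Phi> j (z t y \<bullet> z t y)) has_derivative
        (\<lambda>w. - 2 * of_real (z t y \<bullet> w) * \<Phi> (Suc j) (z t y \<bullet> z t y))) (at y)" if "t \<in> {0..1}" "y \<in> W" for j t y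
      using \<Phi>_shift_has_derivative[of "x + t *\<^sub>R v" y j] nz[OF that] by (simp add: z_def)
    have iy: "((\<lambda>y. complex_of_real (z t y \<bullet> v)) has_derivative (\<lambda>w. - of_real (v \<bullet> w))) (at y)" for t y
      unfolding z_def by (rule inner_shift_has_derivative)
    note vi = has_vector_derivative_minus has_vector_derivative_add has_vector_derivative_mult has_vector_derivative_const
    note di = has_derivative_minus has_derivative_add has_derivative_mult has_derivative_const
    note num = numeral_2_eq_2 numeral_3_eq_3
    have "c11 W (\<lambda>y. f 1 y - f 0 y - f1 0 y) (K * (norm v)\<^sup>2)"
    proof (rule taylor_c11[of W f f1 f2 D D1 D2])
      fix t :: real and y w assume t: "t \<in> {0..1}" and y: "y \<in> W"
      show "((\<lambda>t. f t y) has_vector_derivative f1 t y) (at t)"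
        unfolding f_def f1_def using dt[OF t y, of 0] by (simp add: mult_ac)
      show "((\<lambda>t. f1 t y) has_vector_derivative f2 t y) (at t)"
        unfolding f2_def f1_def
        by (rule has_vector_derivative_eq_rhs, (rule vi dt[OF t y] it)+) (simp add: num algebra_simps)
      show "((\<lambda>t. D t y w) has_vector_derivative D1 t y w) (at t)"
        unfolding D_def D1_def
        by (rule has_vector_derivative_eq_rhs, (rule vi dt[OF t y] it)+) (simp add: num algebra_simps)
      show "((\<lambda>t. D1 t y w) has_vector_derivative D2 t y w) (at t)"
        unfolding D1_def D2_def
        by (rule has_vector_derivative_eq_rhs, (rule vi dt[OF t y] it)+) (simp add: num algebra_simps)
      show "(f t has_derivative D t y) (at y)"
        unfolding f_def[abs_def] D_def[abs_def]
        by (rule has_derivative_eq_rhs, (rule di dy[OF t y] iy)+) (simp add: fun_eq_iff num algebra_simps)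
    next
      fix y assume y: "y \<in> W"
      have t0: "(0::real) \<in> {0..1}" by simp
      show "(f1 0 has_derivative D1 0 y) (at y)"
        unfolding f1_def[abs_def] D1_def[abs_def]
        by (rule has_derivative_eq_rhs, (rule di dy[OF t0 y] iy)+) (simp add: fun_eq_iff num algebra_simps)
    next
      fix t :: real assume t: "t \<in> {0..1}"
      have xt: "\<forall>y\<in>W. 1 \<le> norm ((x + t *\<^sub>R v) - y) \<and> norm ((x + t *\<^sub>R v) - y) \<le> S" using x t by blast
      show "c11_deriv W (f2 t) (D2 t) (K * (norm v)\<^sup>2)"
      proof (rule c11_imp_c11_deriv)
        have c2: "c11 W (\<lambda>y. complex_of_real (v \<bullet> v)) ((norm v)\<^sup>2)"
          by (rule c11_const) (simp add: power2_norm_eq_inner)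
        have "c11 W (f2 t) (4 * (4 * norm (4::complex) * K2) * (4 * (S * norm v) * (S * norm v)) +
            4 * (4 * norm (2::complex) * K1) * (norm v)\<^sup>2)"
          unfolding f2_def[abs_def] z_def using K1[OF xt] K2[OF xt] xt S
          by (intro c11_add c11_mult c11_cmult c11_inner W c2) auto
        then show "c11 W (f2 t) (K * (norm v)\<^sup>2)"
          by (rule c11_mono) (simp add: K_def power2_eq_square algebra_simps)
        show "(f2 t has_derivative D2 t y) (at y)" if y: "y \<in> W" for y
          unfolding f2_def[abs_def] D2_def[abs_def]
          by (rule has_derivative_eq_rhs, (rule di dy[OF t y] iy)+) (simp add: fun_eq_iff num algebra_simps)
      qed
    qed
    then show ?thesis
    proof (rule c11_cong[OF _ W(2)])
      fix y assume y: "y \<in> W"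
      have "G (x + v - y) = f 1 y" "G (x - y) = f 0 y"
        using nz[of 1 y] nz[of 0 y] y G_eq by (simp_all add: f_def z_def)
      then show "f 1 y - f 0 y - f1 0 y = G (x + v - y) - G (x - y) - DG (x - y) v"
        by (simp add: f1_def DG_def z_def)
    qed
  qed
  then show ?thesis by blast
qed

end

section \<open>Potentials of functionals on such functions\<close>

text \<open>The common interface of both potentials: a linear functional on the test space, bounded
  by the test norm. \<open>W\<close> is a ball, hence convex for the mean value estimates and open
  for the derivatives.\<close>

locale c11_functional =
  fixes W :: "'a::euclidean_space set" and R :: real and T :: "('a \<Rightarrow> complex) \<Rightarrow> complex" and C :: real
  assumes R: "R > 0" and W_def: "W = ball 0 R"
    and T_add: "\<And>f g M N. c11 W f M \<Longrightarrow> c11 W g N \<Longrightarrow> T (\<lambda>y. f y + g y) = T f + T g"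
    and T_scale: "\<And>f c M. c11 W f M \<Longrightarrow> T (\<lambda>y. c * f y) = c * T f"
    and T_bound: "\<And>f M. c11 W f M \<Longrightarrow> norm (T f) \<le> C * M"
begin

lemma W: "convex W" "open W" by (auto simp: W_def)

lemma T_diff:
  assumes "c11 W f M" "c11 W g N"
  shows "T (\<lambda>y. f y - g y) = T f - T g"
  using T_add[OF assms(1) c11_cmult[OF assms(2) W(1), of "-1"]] T_scale[OF assms(2), of "-1"] by simp

text \<open>The difference has test bound 0 on \<open>W\<close>, so the functional annihilates
  it.\<close>

lemma T_cong:
  assumes "c11 W f M" "\<And>y. y \<in> W \<Longrightarrow> f y = g y"
  shows "T f = T g"
proof -
  have g: "c11 W g M" by (rule c11_cong[OF assms(1) W(2) assms(2)])
  have "c11 W (\<lambda>_. 0::complex) 0" by (rule c11_const) simp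
  then have "c11 W (\<lambda>y. f y - g y) 0" by (rule c11_cong[OF _ W(2)]) (simp add: assms(2))
  from T_bound[OF this] show ?thesis using T_diff[OF assms(1) g] by simp
qed

lemma C_nonneg: "C \<ge> 0"
proof -
  have "c11 W (\<lambda>_. 0::complex) 1" by (rule c11_const) simp
  from order_trans[OF norm_ge_zero T_bound[OF this]] show ?thesis by simp
qed

end

locale radial_potential = c11_functional W R T C + radial_kernel G \<Phi>
  for W :: "'a::euclidean_space set" and R T C and G :: "'a \<Rightarrow> complex" and \<Phi>
begin

definition potential :: "'a \<Rightarrow> complex" where "potential x = T (\<lambda>y. G (x - y))"

definition Dpotential :: "'a \<Rightarrow> 'a \<Rightarrow> complex" where "Dpotential x v = T (\<lambda>y. DG (x - y) v)"

lemma norm_W: "norm x - R < norm (x - y)" "norm (x - y) < norm x + R" if "y \<in> W" for x y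
  using that norm_triangle_ineq2[of x y] norm_triangle_ineq4[of x y] by (auto simp: W_def)

lemma norm_range:
  assumes "norm x \<ge> R + 1" "y \<in> W"
  shows "1 \<le> norm (x - y)" "norm (x - y) \<le> norm x + R"
  using norm_W[OF assms(2), of x] assms(1) by linarith+

lemma c11_G:
  assumes "norm x \<ge> R + 1"
  shows "\<exists>K. c11 W (\<lambda>y. G (x - y)) K"
proof -
  have S: "norm x + R \<ge> 1" using assms R by linarith
  obtain K where K: "c11 W (\<lambda>y. \<Phi> 0 ((x - y) \<bullet> (x - y))) K"
    using c11_\<Phi>[OF W(1) S, of 0] norm_range[OF assms] by blast
  have "\<Phi> 0 ((x - y) \<bullet> (x - y)) = G (x - y)" if "y \<in> W" for y
    using norm_range(1)[OF assms that] G_eq[of "x - y"] by force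
  then have "c11 W (\<lambda>y. G (x - y)) K" by (rule c11_cong[OF K W(2)])
  then show ?thesis by blast
qed

lemma c11_DG':
  assumes "norm x \<ge> R + 1"
  shows "\<exists>K. \<forall>v. c11 W (\<lambda>y. DG (x - y) v) (K * norm v)"
proof -
  have S: "norm x + R \<ge> 1" using assms R by linarith
  show ?thesis using c11_DG[OF W(1) S] norm_range[OF assms] by blast
qed

lemma bounded_linear_Dpotential:
  assumes "norm x \<ge> R + 1"
  shows "bounded_linear (Dpotential x)"
proof -
  obtain K where K: "\<And>v. c11 W (\<lambda>y. DG (x - y) v) (K * norm v)" using c11_DG'[OF assms] by blast
  show ?thesis
  proof (rule bounded_linear_intro[where K = "C * K"])
    show "Dpotential x (v + w) = Dpotential x v + Dpotential x w" for v w
      unfolding Dpotential_def T_add[OF K K, symmetric]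
      by (rule arg_cong[of _ _ T]) (auto simp: DG_def inner_add_right algebra_simps)
    show "Dpotential x (r *\<^sub>R v) = r *\<^sub>R Dpotential x v" for r v
      unfolding Dpotential_def scaleR_conv_of_real T_scale[OF K, symmetric]
      by (rule arg_cong[of _ _ T]) (auto simp: DG_def)
    show "norm (Dpotential x v) \<le> norm v * (C * K)" for v
      using T_bound[OF K[of v]] by (simp add: Dpotential_def mult_ac)
  qed
qed

text \<open>The functional is applied to the kernel remainder as a whole, so the estimate carries
  over with the factor \<open>C\<close>. The margin \<open>R + 2\<close> keeps
  \<open>x + t *\<^sub>R v\<close> at distance at least 1 from \<open>W\<close> for
  \<open>norm v \<le> 1\<close>, and \<open>X\<close> confines the distances to a compact
  range.\<close>

lemma potential_remainder:
  assumes X: "X \<ge> 0"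
  shows "\<exists>L\<ge>0. \<forall>x v. norm x \<ge> R + 2 \<longrightarrow> norm x \<le> X \<longrightarrow> norm v \<le> 1 \<longrightarrow>
     norm (potential (x + v) - potential x - Dpotential x v) \<le> L * (norm v)\<^sup>2"
proof -
  obtain K where K: "\<And>x v. (\<forall>t\<in>{0..1}. \<forall>y\<in>W. 1 \<le> norm (x + t *\<^sub>R v - y) \<and> norm (x + t *\<^sub>R v - y) \<le> X + 1 + R) \<Longrightarrow>
     c11 W (\<lambda>y. G (x + v - y) - G (x - y) - DG (x - y) v) (K * (norm v)\<^sup>2)"
    using c11_remainder[OF W, of "X + 1 + R"] X R by auto
  have "norm (potential (x + v) - potential x - Dpotential x v) \<le> (C * \<bar>K\<bar>) * (norm v)\<^sup>2"
    if x: "norm x \<ge> R + 2" "norm x \<le> X" and v: "norm v \<le> 1" for x v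
  proof -
    have "1 \<le> norm (x + t *\<^sub>R v - y) \<and> norm (x + t *\<^sub>R v - y) \<le> X + 1 + R" if "t \<in> {0..1}" "y \<in> W" for t y
    proof -
      have "norm (t *\<^sub>R v) \<le> 1" using that v by (simp add: mult_le_one)
      then have "norm (x + t *\<^sub>R v) \<ge> R + 1" "norm (x + t *\<^sub>R v) \<le> X + 1"
        using x norm_triangle_ineq[of x "t *\<^sub>R v"] norm_diff_ineq[of x "t *\<^sub>R v"] by linarith+
      then show ?thesis using norm_range[of "x + t *\<^sub>R v" y] that by auto
    qed
    then have c: "c11 W (\<lambda>y. G (x + v - y) - G (x - y) - DG (x - y) v) (K * (norm v)\<^sup>2)" by (intro K) blast
    have xv: "norm (x + v) \<ge> R + 1" "norm x \<ge> R + 1" using x v norm_diff_ineq[of x v] by linarith+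
    obtain K1 K2 K3 where k: "c11 W (\<lambda>y. G (x + v - y)) K1" "c11 W (\<lambda>y. G (x - y)) K2" "c11 W (\<lambda>y. DG (x - y) v) K3"
      using c11_G[OF xv(1)] c11_G[OF xv(2)] c11_DG'[OF xv(2)] by blast
    have k12: "c11 W (\<lambda>y. G (x + v - y) - G (x - y)) (K1 + 4 * norm (-1::complex) * K2)"
      using c11_add[OF k(1) c11_cmult[OF k(2) W(1), of "-1"]] by simp
    have "T (\<lambda>y. G (x + v - y) - G (x - y) - DG (x - y) v) = potential (x + v) - potential x - Dpotential x v"
      unfolding T_diff[OF k12 k(3)] T_diff[OF k(1,2)] potential_def Dpotential_def ..
    then have "norm (potential (x + v) - potential x - Dpotential x v) \<le> C * (K * (norm v)\<^sup>2)"
      using T_bound[OF c] by simp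
    also have "\<dots> \<le> C * (\<bar>K\<bar> * (norm v)\<^sup>2)"
      using C_nonneg by (intro mult_left_mono mult_right_mono) auto
    finally show ?thesis by (simp add: mult.assoc)
  qed
  then show ?thesis using C_nonneg by (intro exI[of _ "C * \<bar>K\<bar>"]) auto
qed

lemma potential_has_derivative:
  assumes x: "norm x \<ge> R + 2"
  shows "(potential has_derivative Dpotential x) (at x)"
proof -
  obtain L where L: "L \<ge> 0" "\<And>v. norm v \<le> 1 \<Longrightarrow> norm (potential (x + v) - potential x - Dpotential x v) \<le> L * (norm v)\<^sup>2"
    using potential_remainder[of "norm x"] x by auto
  show ?thesis
    unfolding has_derivative_at_alt
  proof (intro conjI allI impI)
    show "bounded_linear (Dpotential x)" using x by (intro bounded_linear_Dpotential) auto
    fix e :: real assume e: "e > 0"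
    define d where "d = min 1 (e / (L + 1))"
    have d: "d > 0" using e L(1) by (simp add: d_def)
    have "norm (potential y - potential x - Dpotential x (y - x)) \<le> e * norm (y - x)" if y: "norm (y - x) < d" for y
    proof -
      have "norm (potential y - potential x - Dpotential x (y - x)) \<le> L * (norm (y - x))\<^sup>2"
        using L(2)[of "y - x"] y by (simp add: d_def)
      also have "\<dots> = (L * norm (y - x)) * norm (y - x)" by (simp add: power2_eq_square)
      also have "\<dots> \<le> e * norm (y - x)"
      proof (rule mult_right_mono)
        have "norm (y - x) * (L + 1) \<le> e" using y L(1) by (simp add: d_def pos_less_divide_eq less_imp_le)
        moreover have "norm (y - x) * (L + 1) = L * norm (y - x) + norm (y - x)" by (simp add: algebra_simps)
        ultimately show "L * norm (y - x) \<le> e" using norm_ge_zero[of "y - x"] by linarith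
      qed auto
      finally show ?thesis .
    qed
    then show "\<exists>d>0. \<forall>y. norm (y - x) < d \<longrightarrow> norm (potential y - potential x - Dpotential x (y - x)) \<le> e * norm (y - x)"
      using d by blast
  qed
qed

text \<open>A first order Taylor expansion with locally uniform quadratic remainder makes the derivative
  Lipschitz: expand the value at \<open>x + \<delta> + h\<close> both at \<open>x\<close> and at \<open>x + \<delta>\<close>.\<close>

lemma Dpotential_lipschitz:
  assumes X: "X \<ge> 0"
  shows "\<exists>L\<ge>0. \<forall>x \<delta> v. norm x \<ge> R + 2 \<longrightarrow> norm (x + \<delta>) \<ge> R + 2 \<longrightarrow> norm x \<le> X \<longrightarrow> norm \<delta> \<le> 1 / 2 \<longrightarrow>
     norm (Dpotential (x + \<delta>) v - Dpotential x v) \<le> L * norm \<delta> * norm v"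
proof -
  obtain L where L: "L \<ge> 0" "\<And>x v. norm x \<ge> R + 2 \<Longrightarrow> norm x \<le> X + 1 \<Longrightarrow> norm v \<le> 1 \<Longrightarrow>
     norm (potential (x + v) - potential x - Dpotential x v) \<le> L * (norm v)\<^sup>2"
    using potential_remainder[of "X + 1"] X by auto
  have "norm (Dpotential (x + \<delta>) v - Dpotential x v) \<le> (6 * L) * norm \<delta> * norm v"
    if x: "norm x \<ge> R + 2" "norm (x + \<delta>) \<ge> R + 2" "norm x \<le> X" and \<delta>: "norm \<delta> \<le> 1 / 2" for x \<delta> v
  proof (cases "v = 0 \<or> \<delta> = 0")
    case True
    interpret a: bounded_linear "Dpotential x" using x by (intro bounded_linear_Dpotential) auto
    interpret b: bounded_linear "Dpotential (x + \<delta>)" using x by (intro bounded_linear_Dpotential) auto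
    show ?thesis using True by (auto simp: a.zero b.zero)
  next
    case False
    interpret a: bounded_linear "Dpotential x" using x by (intro bounded_linear_Dpotential) auto
    interpret b: bounded_linear "Dpotential (x + \<delta>)" using x by (intro bounded_linear_Dpotential) auto
    \<comment> \<open>Rescaling \<open>v\<close> to the length of \<open>\<delta>\<close> makes all
      three remainders of order \<open>(norm \<delta>)\<^sup>2\<close>; undoing the scaling leaves
      one factor \<open>norm \<delta>\<close>.\<close>
    define h where "h = (norm \<delta> / norm v) *\<^sub>R v"
    have h: "norm h = norm \<delta>" using False by (simp add: h_def)
    have s: "norm (\<delta> + h) \<le> 2 * norm \<delta>" using norm_triangle_ineq[of \<delta> h] h by simp
    have 1: "norm (potential (x + \<delta> + h) - potential (x + \<delta>) - Dpotential (x + \<delta>) h) \<le> L * (norm \<delta>)\<^sup>2"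
    proof -
      have "norm (x + \<delta>) \<le> X + 1" using x \<delta> norm_triangle_ineq[of x \<delta>] by linarith
      then show ?thesis using L(2)[of "x + \<delta>" h] x \<delta> unfolding h by simp
    qed
    have 2: "norm (potential (x + (\<delta> + h)) - potential x - Dpotential x (\<delta> + h)) \<le> L * (2 * norm \<delta>)\<^sup>2"
    proof -
      have "norm (potential (x + (\<delta> + h)) - potential x - Dpotential x (\<delta> + h)) \<le> L * (norm (\<delta> + h))\<^sup>2"
        using x s \<delta> by (intro L(2)) auto
      also have "\<dots> \<le> L * (2 * norm \<delta>)\<^sup>2" using s L(1) by (intro mult_left_mono power_mono) auto
      finally show ?thesis .
    qed
    have 3: "norm (potential (x + \<delta>) - potential x - Dpotential x \<delta>) \<le> L * (norm \<delta>)\<^sup>2"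
      using L(2)[of x \<delta>] x \<delta> by simp
    have D: "Dpotential (x + \<delta>) h - Dpotential x h =
       (potential (x + (\<delta> + h)) - potential x - Dpotential x (\<delta> + h)) -
       (potential (x + \<delta>) - potential x - Dpotential x \<delta>) -
       (potential (x + \<delta> + h) - potential (x + \<delta>) - Dpotential (x + \<delta>) h)"
      by (simp add: a.add algebra_simps)
    have "norm (Dpotential (x + \<delta>) h - Dpotential x h) \<le> L * (2 * norm \<delta>)\<^sup>2 + L * (norm \<delta>)\<^sup>2 + L * (norm \<delta>)\<^sup>2"
      unfolding D by (rule order_trans[OF norm_triangle_ineq4 add_mono[OF order_trans[OF norm_triangle_ineq4 add_mono[OF 2 3]] 1]])
    also have "\<dots> = 6 * L * (norm \<delta>)\<^sup>2" by (simp add: power2_eq_square)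
    finally have "norm (Dpotential (x + \<delta>) h - Dpotential x h) \<le> 6 * L * (norm \<delta>)\<^sup>2" .
    moreover have "Dpotential (x + \<delta>) h - Dpotential x h = (norm \<delta> / norm v) *\<^sub>R (Dpotential (x + \<delta>) v - Dpotential x v)"
      by (simp add: h_def a.scaleR b.scaleR scaleR_diff_right)
    ultimately have "(norm \<delta> / norm v) * norm (Dpotential (x + \<delta>) v - Dpotential x v) \<le> (norm \<delta> / norm v) * (6 * L * norm \<delta> * norm v)"
      using False by (simp add: power2_eq_square mult_ac)
    then show ?thesis using False by (subst (asm) mult_le_cancel_left_pos) auto
  qed
  then show ?thesis using L(1) by (intro exI[of _ "6 * L"]) auto
qed

lemma C1_on_potential: "C1_on (- cball 0 (R + 2)) potential"
  unfolding C1_on_def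
proof (intro exI[of _ "\<lambda>x. Blinfun (Dpotential x)"] conjI ballI)
  have bl: "blinfun_apply (Blinfun (Dpotential x)) = Dpotential x" if "norm x > R + 2" for x
    using that by (intro bounded_linear_Blinfun_apply bounded_linear_Dpotential) auto
  fix x :: 'a assume "x \<in> - cball 0 (R + 2)"
  then show "(potential has_derivative blinfun_apply (Blinfun (Dpotential x))) (at x)"
    using potential_has_derivative[of x] bl[of x] by auto
next
  have bl: "blinfun_apply (Blinfun (Dpotential x)) = Dpotential x" if "norm x > R + 2" for x
    using that by (intro bounded_linear_Blinfun_apply bounded_linear_Dpotential) auto
  show "continuous_on (- cball 0 (R + 2)) (\<lambda>x. Blinfun (Dpotential x))"
    unfolding continuous_on_iff
  proof (intro ballI allI impI)
    fix x :: 'a and e :: real assume x: "x \<in> - cball 0 (R + 2)" and e: "e > 0"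
    obtain L where L: "L \<ge> 0" "\<And>\<delta> v. norm (x + \<delta>) \<ge> R + 2 \<Longrightarrow> norm \<delta> \<le> 1 / 2 \<Longrightarrow>
        norm (Dpotential (x + \<delta>) v - Dpotential x v) \<le> L * norm \<delta> * norm v"
      using Dpotential_lipschitz[of "norm x"] x by auto
    define d where "d = min (1 / 2) (e / (L + 1))"
    have d: "d > 0" using e L(1) by (simp add: d_def)
    have "dist (Blinfun (Dpotential x')) (Blinfun (Dpotential x)) < e"
      if x': "x' \<in> - cball 0 (R + 2)" "dist x' x < d" for x'
    proof -
      have dd: "norm (x' - x) < d" using x' by (simp add: dist_norm)
      have "norm (Blinfun (Dpotential x') - Blinfun (Dpotential x)) \<le> L * norm (x' - x)"
      proof (rule norm_blinfun_bound)
        show "norm (blinfun_apply (Blinfun (Dpotential x') - Blinfun (Dpotential x)) v) \<le> L * norm (x' - x) * norm v" for v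
          using L(2)[of "x' - x" v] bl[of x] bl[of x'] x x' dd by (auto simp: blinfun.diff_left d_def)
      qed (use L(1) in auto)
      also have "\<dots> < e"
      proof (cases "x' = x")
        case False
        have "norm (x' - x) * (L + 1) < e" using dd L(1) by (simp add: d_def pos_less_divide_eq)
        moreover have "norm (x' - x) * (L + 1) = L * norm (x' - x) + norm (x' - x)" by (simp add: algebra_simps)
        ultimately show ?thesis using norm_ge_zero[of "x' - x"] by linarith
      qed (use e in auto)
      finally show ?thesis by (simp add: dist_norm)
    qed
    then show "\<exists>d>0. \<forall>x'\<in>- cball 0 (R + 2). dist x' x < d \<longrightarrow> dist (Blinfun (Dpotential x')) (Blinfun (Dpotential x)) < e"
      using d by blast
  qed
qed

end

section \<open>The radiation condition\<close>

locale radiating_potential = radial_potential W R T C G \<Phi>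
  for W :: "'a::euclidean_space set" and R T C and G :: "'a \<Rightarrow> complex" and \<Phi> +
  fixes k :: complex and \<sigma> :: "nat \<Rightarrow> real \<Rightarrow> complex" and p :: real
  assumes k: "Im k \<ge> 0" and p: "p \<ge> 0"
    and G_symbol: "x \<noteq> 0 \<Longrightarrow> G x = exp (\<i> * k * of_real (norm x)) * \<sigma> 0 (norm x)"
    and \<sigma>_deriv: "r > 0 \<Longrightarrow> (\<sigma> j has_vector_derivative \<sigma> (Suc j) r) (at r)"
    and \<sigma>_bound: "\<exists>K. \<forall>r\<ge>1. norm (\<sigma> j r) \<le> K * r powr (- p - real j)"
begin

definition wave :: "real \<Rightarrow> complex" where "wave r = exp (\<i> * k * of_real r)"

lemma wave_deriv: "(wave has_vector_derivative (\<i> * k * wave r)) (at r)"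
proof -
  have "((\<lambda>z. exp (\<i> * k * z)) has_field_derivative (\<i> * k * exp (\<i> * k * of_real r))) (at (of_real r))"
    by (auto intro!: derivative_eq_intros)
  from has_vector_derivative_real_field[OF this] show ?thesis
    by (simp add: wave_def[abs_def])
qed

lemma norm_wave: "norm (wave r) = exp (- Im k * r)"
  by (simp add: wave_def)

text \<open>\<open>DG\<close> was computed from the squared norm. By uniqueness of derivatives it
  agrees with the derivative of the symbol form, which displays the cosine between \<open>z\<close>
  and the direction as a separate factor.\<close>

lemma DG_symbol:
  assumes z: "z \<noteq> 0"
  shows "DG z v = of_real ((z \<bullet> v) / norm z) * (wave (norm z) * (\<i> * k * \<sigma> 0 (norm z) + \<sigma> 1 (norm z)))"
proof -
  have n: "norm z > 0" using z by simp
  have "((\<lambda>r. wave r * \<sigma> 0 r) has_vector_derivative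
      (wave (norm z) * \<sigma> (Suc 0) (norm z) + \<i> * k * wave (norm z) * \<sigma> 0 (norm z))) (at (norm z))"
    by (rule has_vector_derivative_mult[OF wave_deriv \<sigma>_deriv[OF n]])
  then have d: "((\<lambda>r. wave r * \<sigma> 0 r) has_derivative
      (\<lambda>h. h *\<^sub>R (wave (norm z) * (\<i> * k * \<sigma> 0 (norm z) + \<sigma> 1 (norm z))))) (at (norm z))"
    by (simp add: has_vector_derivative_def algebra_simps)
  have "(norm has_derivative (\<lambda>v. sgn z \<bullet> v)) (at z)"
    using has_derivative_norm[OF z] by (simp add: inner_commute)
  from has_derivative_compose[OF this d]
  have "((\<lambda>z. wave (norm z) * \<sigma> 0 (norm z)) has_derivative
     (\<lambda>v. (sgn z \<bullet> v) *\<^sub>R (wave (norm z) * (\<i> * k * \<sigma> 0 (norm z) + \<sigma> 1 (norm z))))) (at z)" .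
  then have "(G has_derivative (\<lambda>v. (sgn z \<bullet> v) *\<^sub>R (wave (norm z) * (\<i> * k * \<sigma> 0 (norm z) + \<sigma> 1 (norm z))))) (at z)"
    by (rule has_derivative_transform_within_open[of _ _ _ _ "- {0}"]) (use z G_symbol in \<open>auto simp: wave_def\<close>)
  from has_derivative_unique[OF G_has_derivative[OF z] this]
  have "DG z v = (sgn z \<bullet> v) *\<^sub>R (wave (norm z) * (\<i> * k * \<sigma> 0 (norm z) + \<sigma> 1 (norm z)))"
    by (rule fun_cong)
  then show ?thesis by (simp add: sgn_div_norm scaleR_conv_of_real divide_inverse mult_ac)
qed

text \<open>The function is the cosine of the angle between \<open>x - y\<close> and
  \<open>x\<close>, minus 1. In the numerator, \<open>norm x - norm (x - y)\<close> and the inner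
  product with the unit vector are bounded in terms of \<open>R\<close>; the denominator provides
  \<open>1 / norm x\<close>. The constant is \<open>4 * (5 + 1) * (R + 1) * 10\<close>.\<close>

lemma c11_direction_defect:
  assumes x: "norm x \<ge> 2 * R + 4"
  shows "c11 W (\<lambda>y. (of_real (norm x - norm (x - y)) + of_real ((0 - y) \<bullet> (x /\<^sub>R norm x))) * complex_of_real (1 / norm (x - y)))
     (240 * (R + 1) / norm x)"
proof -
  define X where "X = norm x"
  define J where "J = {X - R<..<X + R}"
  have X: "X \<ge> 2 * R + 4" using x by (simp add: X_def)
  have J: "convex J" "\<And>y. y \<in> W \<Longrightarrow> norm (x - y) \<in> J" using norm_W[of _ x] by (auto simp: J_def X_def)
  have Jr: "r \<ge> X / 2" "r \<ge> 2" "\<bar>X - r\<bar> \<le> R" if "r \<in> J" for r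
    using that X R by (auto simp: J_def)
  have c1: "c11 W (\<lambda>y. complex_of_real (X - norm (x - y))) (5 * (R + 1))"
  proof (rule c11_compose_dist[OF W(1) J, of "\<lambda>r. of_real (X - r)" "\<lambda>_. -1" "\<lambda>_. 0"])
    show "((\<lambda>r. complex_of_real (X - r)) has_vector_derivative - 1) (at r)" for r
      unfolding has_vector_derivative_def by (auto intro!: derivative_eq_intros simp: scaleR_conv_of_real)
    show "norm (complex_of_real (X - r)) \<le> R + 1" if "r \<in> J" for r
      unfolding norm_of_real using Jr(3)[OF that] by linarith
  qed (use Jr R in force)+
  have c2: "c11 W (\<lambda>y. complex_of_real ((0 - y) \<bullet> (x /\<^sub>R norm x))) ((R + 1) * norm (x /\<^sub>R norm x))"
    by (rule c11_inner) (use R in \<open>auto simp: W_def\<close>)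
  have "norm x \<noteq> 0" using x R by linarith
  then have n1: "norm (x /\<^sub>R norm x) = 1" by simp
  have c3: "c11 W (\<lambda>y. complex_of_real (1 / norm (x - y))) (5 * (2 / X))"
  proof (rule c11_compose_dist[OF W(1) J, of "\<lambda>r. of_real (1 / r)" "\<lambda>r. of_real (- 1 / r ^ 2)" "\<lambda>r. of_real (2 / r ^ 3)"])
    fix r assume r: "r \<in> J"
    have r0: "r > 0" "X > 0" using Jr[OF r] X R by auto
    have d1: "((\<lambda>r. 1 / r) has_real_derivative - 1 / r ^ 2) (at r)"
      using r0 by (auto intro!: derivative_eq_intros simp: power2_eq_square)
    have d2: "((\<lambda>r. - 1 / r ^ 2) has_real_derivative 2 / r ^ 3) (at r)"
      using r0 by (auto intro!: derivative_eq_intros simp: field_simps power2_eq_square power3_eq_cube)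
    show "((\<lambda>r. complex_of_real (1 / r)) has_vector_derivative of_real (- 1 / r ^ 2)) (at r)"
      by (rule has_vector_derivative_of_real[OF d1])
    show "((\<lambda>r. complex_of_real (- 1 / r ^ 2)) has_vector_derivative of_real (2 / r ^ 3)) (at r)"
      by (rule has_vector_derivative_of_real[OF d2])
    have i: "1 / r \<le> 2 / X" using Jr[OF r] r0 by (simp add: field_simps)
    show "norm (complex_of_real (1 / r)) \<le> 2 / X" unfolding norm_of_real using i r0 by simp
    have "1 / r ^ 2 \<le> 1 / r"
      using Jr[OF r] r0 by (intro divide_left_mono) (auto simp: power2_eq_square)
    then show "norm (complex_of_real (- 1 / r ^ 2)) \<le> 2 / X" unfolding norm_of_real using i r0 by simp
    have "2 / r ^ 3 \<le> 1 / r"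
    proof -
      have "2 * 1 \<le> r * r" using Jr[OF r] by (intro mult_mono) auto
      then show ?thesis using r0 by (simp add: field_simps power3_eq_cube)
    qed
    then show "norm (complex_of_real (2 / r ^ 3)) \<le> 2 / X" unfolding norm_of_real using i r0 by simp
    show "r \<ge> 1" using Jr[OF r] by simp
  qed
  from c11_mult[OF c11_add[OF c1 c2[unfolded n1]] c3 W(1)]
  show ?thesis unfolding X_def[symmetric] by (rule c11_mono) (simp add: field_simps)
qed

theorem defect_bound:
  "\<exists>B. \<forall>x. norm x \<ge> 2 * R + 4 \<longrightarrow>
     norm (Dpotential x (x /\<^sub>R norm x) - \<i> * k * potential x) \<le> B * (exp (- Im k * norm x) * norm x powr (- p - 1))"
proof -
  obtain K where K: "\<And>j r. r \<ge> 1 \<Longrightarrow> norm (\<sigma> j r) \<le> K j * r powr (- p - real j)"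
    using \<sigma>_bound by metis
  \<comment> \<open>The power of 2 is the price for replacing \<open>r\<close> by
    \<open>norm x\<close>, since \<open>r \<ge> norm x / 2\<close> for all distances that
    occur.\<close>
  define S where "S j = \<bar>K j\<bar> * 2 powr (p + real j)" for j
  define S3 where "S3 = S 0 + S 1 + S 2 + S 3"
  have S0: "S j \<ge> 0" for j by (simp add: S_def)
  have S3: "S j \<le> S3" if "j \<le> 3" for j
  proof -
    have "j = 0 \<or> j = 1 \<or> j = 2 \<or> j = 3" using that by auto
    then show ?thesis using S0[of 0] S0[of 1] S0[of 2] S0[of 3] unfolding S3_def by auto
  qed
  \<comment> \<open>The exponential accounts for \<open>norm (x - y) \<ge> norm x - R\<close>; the
    square dominates 1, \<open>norm k\<close> and \<open>norm k * norm k\<close>, the factors of the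
    wave and its first two derivatives.\<close>
  define M where "M = (1 + norm k)\<^sup>2 * exp (Im k * R)"
  define Q where "Q = 100 * S3 + 80 * (4 * norm (\<i> * k) * (5 * S3) + 5 * S3) * (240 * (R + 1))"
  define B where "B = M * Q"
  have "norm (Dpotential x (x /\<^sub>R norm x) - \<i> * k * potential x) \<le> (C * B) * (exp (- Im k * norm x) * norm x powr (- p - 1))"
    if x: "norm x \<ge> 2 * R + 4" for x
  proof -
    define X where "X = norm x"
    define J where "J = {X - R<..<X + R}"
    define \<theta> where "\<theta> = x /\<^sub>R norm x"
    have X: "X \<ge> 2 * R + 4" using x by (simp add: X_def)
    have J: "convex J" "\<And>y. y \<in> W \<Longrightarrow> norm (x - y) \<in> J" using norm_W[of _ x] by (auto simp: J_def X_def)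
    have Jr: "r \<ge> X / 2" "r \<ge> 2" "r \<ge> X - R" if "r \<in> J" for r
      using that X R by (auto simp: J_def)
    have Jr1: "r \<ge> 1" if "r \<in> J" for r using Jr(2)[OF that] by simp
    have \<sigma>b: "norm (\<sigma> j r) \<le> S3 * X powr (- p - real i)" if "r \<in> J" "j \<le> 3" "i \<le> j" for i j r
    proof -
      have "norm (\<sigma> j r) \<le> K j * r powr (- p - real j)" using K Jr1[OF that(1)] by blast
      also have "\<dots> \<le> \<bar>K j\<bar> * (X / 2) powr (- p - real j)"
        using Jr[OF that(1)] X R p by (intro mult_mono powr_mono2') auto
      also have "(X / 2) powr (- p - real j) = 2 powr (p + real j) * X powr (- p - real j)"
        using X R by (simp add: powr_divide powr_diff powr_minus powr_add field_simps)
      also have "\<bar>K j\<bar> * \<dots> = S j * X powr (- p - real j)" by (simp add: S_def)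
      also have "\<dots> \<le> S3 * X powr (- p - real i)"
        using S3[OF that(2)] S0[of j] that(3) X R by (intro mult_mono powr_mono) auto
      finally show ?thesis .
    qed
    define Me where "Me = (1 + norm k)\<^sup>2 * exp (- Im k * (X - R))"
    have ce: "c11 W (\<lambda>y. wave (norm (x - y))) (5 * Me)"
    proof (rule c11_compose_dist[OF W(1) J Jr1, of wave "\<lambda>r. \<i> * k * wave r" "\<lambda>r. \<i> * k * (\<i> * k * wave r)"])
      show "((\<lambda>r. \<i> * k * wave r) has_vector_derivative \<i> * k * (\<i> * k * wave r)) (at r)" for r
        by (rule has_vector_derivative_mult_right[OF wave_deriv])
      fix r assume r: "r \<in> J"
      have w: "norm (wave r) \<le> exp (- Im k * (X - R))"
        unfolding norm_wave using Jr(3)[OF r] k by (simp add: mult_left_mono)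
      have q: "a * norm (wave r) \<le> Me" if "a \<le> (1 + norm k)\<^sup>2" for a
        unfolding Me_def using that w by (intro mult_mono) auto
      have "1 \<le> (1 + norm k)\<^sup>2" "norm k \<le> (1 + norm k)\<^sup>2" "norm k * norm k \<le> (1 + norm k)\<^sup>2"
        using zero_le_power2[of "norm k"] by (simp_all add: power2_eq_square algebra_simps)
      from this[THEN q] show "norm (wave r) \<le> Me" "norm (\<i> * k * wave r) \<le> Me" "norm (\<i> * k * (\<i> * k * wave r)) \<le> Me"
        by (simp_all add: norm_mult mult.assoc)
    qed (use wave_deriv in auto)
    have cs0: "c11 W (\<lambda>y. \<sigma> 0 (norm (x - y))) (5 * (S3 * X powr (- p)))"
      by (rule c11_compose_dist[OF W(1) J Jr1, of "\<sigma> 0" "\<sigma> 1" "\<sigma> 2"])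
        (use \<sigma>b[of _ _ 0] \<sigma>_deriv[of _ 0] \<sigma>_deriv[of _ 1] Jr1 in \<open>force simp: numeral_2_eq_2\<close>)+
    have cs1: "c11 W (\<lambda>y. \<sigma> 1 (norm (x - y))) (5 * (S3 * X powr (- p - 1)))"
      by (rule c11_compose_dist[OF W(1) J Jr1, of "\<sigma> 1" "\<sigma> 2" "\<sigma> 3"])
        (use \<sigma>b[of _ _ 1] \<sigma>_deriv[of _ 1] \<sigma>_deriv[of _ 2] Jr1 in \<open>force simp: numeral_2_eq_2 numeral_3_eq_3\<close>)+
    have pw: "X powr (- p - 1) = X powr (- p) / X" using X R by (simp add: powr_diff)
    have Xp: "X powr (- p - 1) \<le> X powr (- p)" using X R by (intro powr_mono) auto
    \<comment> \<open>The faster decay is weakened so that \<open>\<sigma> 1\<close> can be added to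
      the term with \<open>\<sigma> 0\<close>; in that summand the gain comes from \<open>m\<close>
      instead.\<close>
    have cs1': "c11 W (\<lambda>y. \<sigma> 1 (norm (x - y))) (5 * (S3 * X powr (- p)))"
      using cs1 by (rule c11_mono) (use Xp S3[of 0] S0[of 0] in \<open>simp add: mult_left_mono\<close>)
    define m where "m y = (of_real (X - norm (x - y)) + of_real ((0 - y) \<bullet> \<theta>)) * complex_of_real (1 / norm (x - y))" for y
    have cm: "c11 W m (240 * (R + 1) / X)"
      using c11_direction_defect[OF x] unfolding m_def[abs_def] X_def \<theta>_def .
    \<comment> \<open>The cosine is \<open>1 + m\<close>, so the leading term
      \<open>\<i> * k * \<sigma> 0\<close> cancels in the defect. Each remaining term contains
      \<open>\<sigma> 1\<close> or \<open>m\<close>, both better by one power of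
      \<open>norm x\<close>.\<close>
    define E where "E y = wave (norm (x - y)) * \<sigma> 1 (norm (x - y)) +
       (wave (norm (x - y)) * (\<i> * k * \<sigma> 0 (norm (x - y)) + \<sigma> 1 (norm (x - y)))) * m y" for y
    have cE: "c11 W E (4 * (5 * Me) * (5 * (S3 * X powr (- p - 1))) +
       4 * (4 * (5 * Me) * (4 * norm (\<i> * k) * (5 * (S3 * X powr (- p))) + 5 * (S3 * X powr (- p)))) * (240 * (R + 1) / X))"
      unfolding E_def[abs_def] by (intro c11_add c11_mult c11_cmult ce cs0 cs1 cs1' cm W)
    have Ey: "DG (x - y) \<theta> - \<i> * k * G (x - y) = E y" if y: "y \<in> W" for y
    proof -
      have n: "norm (x - y) > 0" "x - y \<noteq> 0" using norm_range(1)[OF _ y, of x] x R by auto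
      have "norm x \<noteq> 0" using x R by linarith
      then have "x \<bullet> \<theta> = X" by (simp add: \<theta>_def X_def dot_square_norm power2_eq_square)
      then have e: "(x - y) \<bullet> \<theta> = norm (x - y) + ((X - norm (x - y)) + (0 - y) \<bullet> \<theta>)"
        by (simp add: inner_diff_left)
      have gen: "(s + a) / s = 1 + a * (1 / s)" if "s > 0" for s a :: real
        using that by (simp add: add_divide_distrib)
      have "((x - y) \<bullet> \<theta>) / norm (x - y) = 1 + ((X - norm (x - y)) + (0 - y) \<bullet> \<theta>) * (1 / norm (x - y))"
        unfolding e by (rule gen[OF n(1)])
      then have "of_real (((x - y) \<bullet> \<theta>) / norm (x - y)) = 1 + m y"
        unfolding m_def by (simp only: of_real_add of_real_mult of_real_1)
      then have "DG (x - y) \<theta> = (1 + m y) * (wave (norm (x - y)) * (\<i> * k * \<sigma> 0 (norm (x - y)) + \<sigma> 1 (norm (x - y))))"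
        unfolding DG_symbol[OF n(2)] by simp
      moreover have "G (x - y) = wave (norm (x - y)) * \<sigma> 0 (norm (x - y))"
        using G_symbol[OF n(2)] by (simp add: wave_def)
      ultimately show ?thesis by (simp add: E_def algebra_simps)
    qed
    have xr: "norm x \<ge> R + 1" using x R by linarith
    obtain K1 K2 where g: "c11 W (\<lambda>y. G (x - y)) K1" and dg: "c11 W (\<lambda>y. DG (x - y) \<theta>) K2"
      using c11_G[OF xr] c11_DG'[OF xr] by blast
    have "T E = T (\<lambda>y. DG (x - y) \<theta> - \<i> * k * G (x - y))"
      by (rule T_cong[OF cE]) (rule Ey[symmetric])
    also have "\<dots> = Dpotential x \<theta> - \<i> * k * potential x"
      unfolding T_diff[OF dg c11_cmult[OF g W(1)]] T_scale[OF g] Dpotential_def potential_def ..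
    finally have "norm (Dpotential x \<theta> - \<i> * k * potential x) \<le> C * (4 * (5 * Me) * (5 * (S3 * X powr (- p - 1))) +
       4 * (4 * (5 * Me) * (4 * norm (\<i> * k) * (5 * (S3 * X powr (- p))) + 5 * (S3 * X powr (- p)))) * (240 * (R + 1) / X))"
      using T_bound[OF cE] by simp
    also have "4 * (5 * Me) * (5 * (S3 * X powr (- p - 1))) +
       4 * (4 * (5 * Me) * (4 * norm (\<i> * k) * (5 * (S3 * X powr (- p))) + 5 * (S3 * X powr (- p)))) * (240 * (R + 1) / X) =
       Me * Q * X powr (- p - 1)"
      unfolding pw Q_def by (simp add: algebra_simps add_divide_distrib)
    also have "Me = M * exp (- Im k * X)"
      unfolding Me_def M_def by (simp add: algebra_simps flip: exp_add)
    also have "C * (M * exp (- Im k * X) * Q * X powr (- p - 1)) = (C * B) * (exp (- Im k * X) * X powr (- p - 1))"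
      unfolding B_def by (simp only: mult_ac)
    finally show ?thesis unfolding \<theta>_def X_def .
  qed
  then show ?thesis by blast
qed

text \<open>The limsup bound is the defect bound multiplied out. As \<open>Im k \<ge> 0\<close>, the
  exponential weight is at least 1, so the radiation condition follows at rate
  \<open>1 / norm x\<close>. Only the values of \<open>u\<close> far out are tied to the potential,
  since a layer potential may have arbitrary values on the boundary.\<close>

theorem radiates:
  assumes p_eq: "p = (real DIM('a) - 1) / 2" and u: "\<And>x. norm x > R + 2 \<Longrightarrow> u x = potential x"
  shows "outgoing_radiation k u"
    and "Limsup at_infinity (\<lambda>x. ereal (norm x * exp (Im k * norm x) * norm x powr ((real DIM('a) - 1) / 2)
       * cmod (frechet_derivative u (at x) (x /\<^sub>R norm x) - \<i> * k * u x))) < \<infinity>"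
proof -
  have du: "(u has_derivative Dpotential x) (at x)" if "norm x > R + 2" for x
    by (rule has_derivative_transform_within_open[OF potential_has_derivative, of x "- cball 0 (R + 2)"])
      (use that u in auto)
  obtain B where B: "\<And>x. norm x \<ge> 2 * R + 4 \<Longrightarrow>
     norm (Dpotential x (x /\<^sub>R norm x) - \<i> * k * potential x) \<le> B * (exp (- Im k * norm x) * norm x powr (- p - 1))"
    using defect_bound by blast
  have defect: "norm x * exp (Im k * norm x) * norm x powr p * norm (radiation_defect k u x) \<le> B" if x: "norm x \<ge> 2 * R + 4" for x
  proof -
    have x2: "norm x > R + 2" "norm x > 0" using x R by linarith+
    have "radiation_defect k u x = Dpotential x (x /\<^sub>R norm x) - \<i> * k * potential x"
      unfolding radiation_defect_def frechet_derivative_at[OF du[OF x2(1)], symmetric] u[OF x2(1)] ..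
    then have "norm x * exp (Im k * norm x) * norm x powr p * norm (radiation_defect k u x) \<le>
       norm x * exp (Im k * norm x) * norm x powr p * (B * (exp (- Im k * norm x) * norm x powr (- p - 1)))"
      using B[OF x] by (intro mult_left_mono) auto
    also have "\<dots> = B * ((exp (Im k * norm x) * exp (- Im k * norm x)) * (norm x * (norm x powr p * norm x powr (- p - 1))))"
      by (simp only: mult_ac)
    also have "norm x powr p * norm x powr (- p - 1) = 1 / norm x"
      using x2 by (simp add: powr_add[symmetric] powr_minus_divide)
    also have "exp (Im k * norm x) * exp (- Im k * norm x) = 1" by (simp flip: exp_add)
    finally show ?thesis using x2 by simp
  qed
  have ev: "\<forall>\<^sub>F x::'a in at_infinity. norm x \<ge> 2 * R + 4"
    unfolding eventually_at_infinity by blast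
  show "outgoing_radiation k u"
    unfolding outgoing_radiation_def
  proof (intro conjI exI[of _ "cball 0 (R + 2)"])
    obtain D where D: "continuous_on (- cball 0 (R + 2)) D"
      "\<And>x. x \<in> - cball 0 (R + 2) \<Longrightarrow> (potential has_derivative blinfun_apply (D x)) (at x)"
      using C1_on_potential unfolding C1_on_def by blast
    have "(u has_derivative blinfun_apply (D x)) (at x)" if "x \<in> - cball 0 (R + 2)" for x
      by (rule has_derivative_transform_within_open[OF D(2)[OF that], of "- cball 0 (R + 2)"])
        (use that u in auto)
    with D(1) show "C1_on (- cball 0 (R + 2)) u" unfolding C1_on_def by blast
    show "((\<lambda>x. of_real (norm x powr ((real DIM('a) - 1) / 2)) * radiation_defect k u x) \<longlongrightarrow> 0) at_infinity"
    proof (rule Lim_null_comparison)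
      show "\<forall>\<^sub>F x in at_infinity. norm (of_real (norm x powr ((real DIM('a) - 1) / 2)) * radiation_defect k u x) \<le> B * inverse (norm x)"
        using ev
      proof eventually_elim
        case (elim x)
        have x0: "norm x > 0" using elim R by linarith
        have "1 \<le> exp (Im k * norm x)" using k by simp
        then have "norm x * (norm x powr p * norm (radiation_defect k u x)) \<le>
            exp (Im k * norm x) * (norm x * (norm x powr p * norm (radiation_defect k u x)))"
          using mult_right_mono[of 1 "exp (Im k * norm x)" "norm x * (norm x powr p * norm (radiation_defect k u x))"] by simp
        also have "\<dots> \<le> B" using defect[OF elim] by (simp only: mult_ac)
        finally have "norm x powr p * norm (radiation_defect k u x) \<le> B / norm x"
          using x0 by (simp add: field_simps)
        moreover have "norm (of_real (norm x powr ((real DIM('a) - 1) / 2)) * radiation_defect k u x) =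
            norm x powr p * norm (radiation_defect k u x)"
          by (simp add: norm_mult p_eq)
        ultimately show ?case by (simp only: divide_inverse)
      qed
      have "((\<lambda>x::'a. inverse (norm x)) \<longlongrightarrow> 0) at_infinity"
        by (rule tendsto_inverse_0_at_top[OF filterlim_norm_at_top])
      then show "((\<lambda>x::'a. B * inverse (norm x)) \<longlongrightarrow> 0) at_infinity" by (rule tendsto_mult_right_zero)
    qed
  qed simp
  have "Limsup at_infinity (\<lambda>x. ereal (norm x * exp (Im k * norm x) * norm x powr ((real DIM('a) - 1) / 2)
       * cmod (frechet_derivative u (at x) (x /\<^sub>R norm x) - \<i> * k * u x))) \<le> ereal B"
  proof (rule Limsup_bounded)
    show "\<forall>\<^sub>F x in at_infinity. ereal (norm x * exp (Im k * norm x) * norm x powr ((real DIM('a) - 1) / 2)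
       * cmod (frechet_derivative u (at x) (x /\<^sub>R norm x) - \<i> * k * u x)) \<le> ereal B"
      using ev by eventually_elim (use defect in \<open>simp add: radiation_defect_def p_eq\<close>)
  qed
  then show "Limsup at_infinity (\<lambda>x. ereal (norm x * exp (Im k * norm x) * norm x powr ((real DIM('a) - 1) / 2)
       * cmod (frechet_derivative u (at x) (x /\<^sub>R norm x) - \<i> * k * u x))) < \<infinity>"
    using order.strict_trans1[of _ "ereal B" \<infinity>] by simp
qed

end

section \<open>Graph coordinates and the outward normal\<close>

lemma holder_on_imp_continuous_on:
  assumes "holder_on \<alpha> S f" "\<alpha> > 0"
  shows "continuous_on S f"
proof -
  obtain C where C: "\<And>x y. x \<in> S \<Longrightarrow> y \<in> S \<Longrightarrow> norm (f x - f y) \<le> C * dist x y powr \<alpha>"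
    using assms(1) by (auto simp: holder_on_def)
  show ?thesis
    unfolding continuous_on_def
  proof
    fix x assume x: "x \<in> S"
    have "((\<lambda>y. C * dist y x powr \<alpha>) \<longlongrightarrow> C * 0 powr \<alpha>) (at x within S)"
      by (rule tendsto_mult[OF tendsto_const], rule tendsto_powr') (use assms(2) in \<open>auto intro!: tendsto_eq_intros\<close>)
    then have l: "((\<lambda>y. C * dist y x powr \<alpha>) \<longlongrightarrow> 0) (at x within S)" by simp
    have "((\<lambda>y. f y - f x) \<longlongrightarrow> 0) (at x within S)"
      by (rule Lim_null_comparison[OF _ l]) (use C x in \<open>auto simp: eventually_at_filter\<close>)
    then show "(f \<longlongrightarrow> f x) (at x within S)" by (rule LIM_zero_cancel)
  qed
qed

lemma holder_on_bounded:
  assumes "holder_on \<alpha> S f" "bounded S" "\<alpha> > 0"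
  shows "\<exists>B. \<forall>x\<in>S. norm (f x) \<le> B"
proof (cases "S = {}")
  case False
  then obtain a where a: "a \<in> S" by blast
  obtain C where C: "\<And>x y. x \<in> S \<Longrightarrow> y \<in> S \<Longrightarrow> norm (f x - f y) \<le> C * dist x y powr \<alpha>"
    using assms(1) by (auto simp: holder_on_def)
  obtain d where d: "\<And>x y. x \<in> S \<Longrightarrow> y \<in> S \<Longrightarrow> dist x y \<le> d"
    using assms(2) bounded_two_points by metis
  have "norm (f x) \<le> norm (f a) + \<bar>C\<bar> * d powr \<alpha>" if x: "x \<in> S" for x
  proof -
    have "norm (f x - f a) \<le> C * dist x a powr \<alpha>" by (rule C[OF x a])
    also have "\<dots> \<le> \<bar>C\<bar> * d powr \<alpha>" using d[OF x a] assms(3) by (intro mult_mono powr_mono2) auto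
    finally show ?thesis using norm_triangle_ineq2[of "f x" "f a"] by linarith
  qed
  then show ?thesis by blast
qed simp

lemma perp_simps:
  assumes "norm e = 1"
  shows "perp e x \<bullet> e = 0" "norm (perp e x) \<le> norm x" "perp e (perp e x) = perp e x" "perp e e = 0"
    "perp e (x + y) = perp e x + perp e y" "perp e (c *\<^sub>R x) = c *\<^sub>R perp e x"
    "perp e (x - y) = perp e x - perp e y" "perp e x + (x \<bullet> e) *\<^sub>R e = x"
proof -
  have e: "e \<bullet> e = 1" using assms by (simp add: dot_square_norm)
  show 1: "perp e x \<bullet> e = 0" for x by (simp add: perp_def inner_diff_left e)
  have "(norm x)\<^sup>2 = (norm (perp e x))\<^sup>2 + (x \<bullet> e)\<^sup>2"
    unfolding power2_norm_eq_inner by (simp add: perp_def inner_diff_left inner_diff_right e power2_eq_square inner_commute algebra_simps)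
  then have "(norm (perp e x))\<^sup>2 \<le> (norm x)\<^sup>2" by simp
  then show "norm (perp e x) \<le> norm x" by simp
  show "perp e (perp e x) = perp e x" using 1[of x] by (simp add: perp_def[of e "perp e x"])
  show "perp e e = 0" by (simp add: perp_def e)
  show "perp e (x + y) = perp e x + perp e y" "perp e (c *\<^sub>R x) = c *\<^sub>R perp e x" "perp e (x - y) = perp e x - perp e y"
    by (simp_all add: perp_def inner_add_left inner_diff_left algebra_simps)
  show "perp e x + (x \<bullet> e) *\<^sub>R e = x" by (simp add: perp_def)
qed

lemma bounded_linear_perp: "bounded_linear (perp e)"
  unfolding perp_def by (intro bounded_linear_sub bounded_linear_ident bounded_linear_scaleR_const bounded_linear_inner_left)

text \<open>A real supremum is informative only over a nonempty family with an upper bound, so a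
  norm built from suprema has to be estimated together with the boundedness of the family.\<close>

lemma SUP_bounds:
  fixes f :: "'c \<Rightarrow> real"
  assumes "A \<noteq> {}" "\<And>x. x \<in> A \<Longrightarrow> 0 \<le> f x" "\<And>x. x \<in> A \<Longrightarrow> f x \<le> B"
  shows "0 \<le> (SUP x\<in>A. f x)" "(SUP x\<in>A. f x) \<le> B"
proof -
  obtain a where a: "a \<in> A" using assms(1) by blast
  have "bdd_above (f ` A)" using assms(3) by (auto intro!: bdd_aboveI[of _ B])
  then show "0 \<le> (SUP x\<in>A. f x)" using assms(2)[OF a] cSUP_upper2[of f A a 0] a by blast
  show "(SUP x\<in>A. f x) \<le> B" by (rule cSUP_least[OF assms(1,3)])
qed

locale hypograph =
  fixes \<alpha> :: real and \<Omega> :: "'a::euclidean_space set" and p e :: 'a and r \<delta> :: real and \<gamma> :: "'a \<Rightarrow> real"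
    and D :: "'a \<Rightarrow> 'a \<Rightarrow>\<^sub>L real"
  assumes hyp: "local_hypograph \<alpha> \<Omega> p e r \<delta> \<gamma>" and open_\<Omega>: "open \<Omega>" and \<alpha>: "0 < \<alpha>" "\<alpha> < 1"
    and D: "C1alpha_deriv \<alpha> (ball 0 r) (\<lambda>x. \<gamma> (perp e x)) D"
begin

lemma basic: "norm e = 1" "0 < r" "0 < \<delta>" "\<gamma> 0 = 0"
    "\<And>h. h \<bullet> e = 0 \<Longrightarrow> norm h \<le> r \<Longrightarrow> \<bar>\<gamma> h\<bar> < \<delta>"
    "\<And>h s. h \<bullet> e = 0 \<Longrightarrow> norm h < r \<Longrightarrow> \<bar>s\<bar> < \<delta> \<Longrightarrow> p + h + s *\<^sub>R e \<in> \<Omega> \<longleftrightarrow> s < \<gamma> h"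
  using hyp unfolding local_hypograph_def by blast+

lemma closure_ball_r: "closure (ball 0 r) = cball (0::'a) r"
  using basic(2) by simp

lemma D_deriv: "x \<in> ball 0 r \<Longrightarrow> ((\<lambda>x. \<gamma> (perp e x)) has_derivative D x) (at x)"
  and D_holder: "holder_on \<alpha> (cball 0 r) D"
  and cont_\<gamma>: "continuous_on (cball 0 r) (\<lambda>x. \<gamma> (perp e x))"
  using D unfolding C1alpha_deriv_def closure_ball_r by auto

definition graph :: "'a \<Rightarrow> 'a" where "graph x = p + perp e x + \<gamma> (perp e x) *\<^sub>R e"

text \<open>Points just below the graph lie in \<open>\<Omega>\<close> and points on it do not, so a
  graph point is in the closure of the open set but outside the set.\<close>

lemma graph_frontier_open:
  assumes x: "norm x < r"
  shows "graph x \<in> frontier \<Omega>"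
proof -
  define h where "h = perp e x"
  have h: "h \<bullet> e = 0" "norm h < r" using perp_simps(1,2)[OF basic(1), of x] x unfolding h_def by linarith+
  have g: "\<bar>\<gamma> h\<bar> < \<delta>" using basic(5)[OF h(1)] h(2) by simp
  have "graph x \<notin> \<Omega>" unfolding graph_def h_def[symmetric] using basic(6)[OF h g] by simp
  moreover have "graph x \<in> closure \<Omega>"
  proof -
    have ev: "\<forall>\<^sub>F t in at_right 0. graph x - t *\<^sub>R e \<in> \<Omega>"
    proof -
      have "\<forall>\<^sub>F t in at_right (0::real). t < \<delta> - \<bar>\<gamma> h\<bar>" using g by (intro eventually_at_right_real[THEN eventually_mono, of 0 "\<delta> - \<bar>\<gamma> h\<bar>"]) auto
      then show ?thesis
        using eventually_at_right_less[of "0::real"]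
      proof eventually_elim
        case (elim t)
        then have "p + h + (\<gamma> h - t) *\<^sub>R e \<in> \<Omega>" using basic(6)[OF h, of "\<gamma> h - t"] g by auto
        then show ?case by (simp add: graph_def h_def[symmetric] algebra_simps)
      qed
    qed
    have "((\<lambda>t. graph x - t *\<^sub>R e) \<longlongrightarrow> graph x - 0 *\<^sub>R e) (at_right 0)" by (intro tendsto_intros)
    then have "((\<lambda>t. graph x - t *\<^sub>R e) \<longlongrightarrow> graph x) (at_right 0)" by simp
    then show ?thesis
      by (rule Lim_in_closed_set[OF closed_closure, rotated 2])
        (use ev closure_subset[of \<Omega>] in \<open>auto elim: eventually_mono\<close>)
  qed
  ultimately show ?thesis using open_\<Omega> by (simp add: frontier_def interior_open)
qed

lemma continuous_perp: "continuous_on S (perp e)"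
  using bounded_linear_perp by (rule linear_continuous_on)

lemma continuous_graph: "continuous_on (cball 0 r) graph"
  unfolding graph_def by (intro continuous_intros continuous_perp cont_\<gamma>)

text \<open>The hypograph description covers only the open base of the cylinder; continuity carries
  it to the closed ball, where the Hoelder condition on the differential is posed.\<close>

lemma graph_frontier:
  assumes "norm x \<le> r"
  shows "graph x \<in> frontier \<Omega>"
proof -
  have "graph ` closure (ball 0 r) \<subseteq> frontier \<Omega>"
    by (rule image_closure_subset) (use continuous_graph graph_frontier_open closure_ball_r in auto)
  then show ?thesis unfolding closure_ball_r using assms by auto
qed

definition Dgraph :: "'a \<Rightarrow> 'a \<Rightarrow> 'a" where "Dgraph x v = perp e v + D x v *\<^sub>R e"

lemma bounded_linear_Dgraph: "bounded_linear (Dgraph x)"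
  unfolding Dgraph_def
  by (intro bounded_linear_add bounded_linear_perp bounded_linear_scaleR_const blinfun.bounded_linear_right)

lemma graph_has_derivative:
  assumes "x \<in> ball 0 r"
  shows "(graph has_derivative Dgraph x) (at x)"
proof -
  have "(perp e has_derivative perp e) (at x)"
    by (rule bounded_linear_imp_has_derivative[OF bounded_linear_perp])
  then show ?thesis unfolding graph_def[abs_def] Dgraph_def[abs_def]
    by (auto intro!: derivative_eq_intros D_deriv[OF assms])
qed

lemma Dgraph_bounds:
  shows "\<exists>L\<ge>0. (\<forall>x\<in>cball 0 r. \<forall>v. norm (Dgraph x v) \<le> L * norm v) \<and>
    (\<forall>x\<in>cball 0 r. \<forall>y\<in>cball 0 r. \<forall>v. norm (Dgraph x v - Dgraph y v) \<le> L * dist x y powr \<alpha> * norm v) \<and>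
    (\<forall>x\<in>cball 0 r. \<forall>y\<in>cball 0 r. norm (graph x - graph y) \<le> L * norm (x - y))"
proof -
  obtain B where B: "\<And>x. x \<in> cball 0 r \<Longrightarrow> norm (D x) \<le> B"
    using holder_on_bounded[OF D_holder bounded_cball \<alpha>(1)] by blast
  obtain H where H: "\<And>x y. x \<in> cball 0 r \<Longrightarrow> y \<in> cball 0 r \<Longrightarrow> norm (D x - D y) \<le> H * dist x y powr \<alpha>"
    using D_holder unfolding holder_on_def by blast
  define L where "L = 1 + \<bar>B\<bar> + \<bar>H\<bar>"
  have L0: "L \<ge> 0" by (simp add: L_def)
  have 1: "norm (Dgraph x v) \<le> L * norm v" if x: "x \<in> cball 0 r" for x v :: 'a
  proof -
    have "norm (Dgraph x v) \<le> norm (perp e v) + norm (D x v *\<^sub>R e)" unfolding Dgraph_def by (rule norm_triangle_ineq)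
    also have "\<dots> \<le> norm v + \<bar>B\<bar> * norm v"
    proof (rule add_mono)
      have "norm (D x v) \<le> norm (D x) * norm v" by (rule norm_blinfun)
      also have "\<dots> \<le> \<bar>B\<bar> * norm v" using B[OF x] by (intro mult_right_mono) auto
      finally show "norm (D x v *\<^sub>R e) \<le> \<bar>B\<bar> * norm v" using basic(1) by simp
    qed (rule perp_simps(2)[OF basic(1)])
    also have "\<dots> = (1 + \<bar>B\<bar>) * norm v" by (simp add: algebra_simps)
    also have "\<dots> \<le> L * norm v" by (intro mult_right_mono) (auto simp: L_def)
    finally show ?thesis .
  qed
  have 2: "norm (Dgraph x v - Dgraph y v) \<le> L * dist x y powr \<alpha> * norm v" if "x \<in> cball 0 r" "y \<in> cball 0 r" for x y v :: 'a
  proof -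
    have "Dgraph x v - Dgraph y v = ((D x - D y) v) *\<^sub>R e" by (simp add: Dgraph_def blinfun.diff_left algebra_simps)
    then have "norm (Dgraph x v - Dgraph y v) = norm ((D x - D y) v)" using basic(1) by simp
    also have "\<dots> \<le> norm (D x - D y) * norm v" by (rule norm_blinfun)
    also have "\<dots> \<le> (H * dist x y powr \<alpha>) * norm v" using H[OF that] by (intro mult_right_mono) auto
    also have "\<dots> \<le> (L * dist x y powr \<alpha>) * norm v" by (intro mult_right_mono) (auto simp: L_def)
    finally show ?thesis .
  qed
  have "L-lipschitz_on (ball 0 r) graph"
  proof (rule lipschitz_onI)
    fix x y :: 'a assume xy: "x \<in> ball 0 r" "y \<in> ball 0 r"
    have "norm (graph x - graph y) \<le> L * norm (x - y)"
    proof (rule differentiable_bound[of "ball 0 r" graph Dgraph])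
      show "onorm (Dgraph x) \<le> L" if "x \<in> ball 0 r" for x :: 'a
        using 1[of x] that L0 by (intro onorm_bound) auto
    qed (use xy graph_has_derivative in \<open>auto intro: has_derivative_at_withinI\<close>)
    then show "dist (graph x) (graph y) \<le> L * dist x y" by (simp add: dist_norm)
  qed (rule L0)
  then have "L-lipschitz_on (closure (ball 0 r)) graph"
    by (rule lipschitz_on_closure) (simp add: closure_ball_r continuous_graph)
  then have 3: "norm (graph x - graph y) \<le> L * norm (x - y)" if "x \<in> cball 0 r" "y \<in> cball 0 r" for x y :: 'a
    using that lipschitz_onD[of L "cball 0 r" graph x y] by (simp add: closure_ball_r dist_norm)
  show ?thesis using L0 1 2 3 by blast
qed

lemma C1alpha_graph_bound:
  assumes W: "frontier \<Omega> \<subseteq> W"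
  shows "\<exists>c. \<forall>f M. c11 W (f :: 'a \<Rightarrow> complex) M \<longrightarrow> C1alpha \<alpha> (ball 0 r) (\<lambda>x. f (graph x)) \<and>
     0 \<le> C1alpha_norm \<alpha> (ball 0 r) (\<lambda>x. f (graph x)) \<and> C1alpha_norm \<alpha> (ball 0 r) (\<lambda>x. f (graph x)) \<le> c * M"
proof -
  obtain L where L: "L \<ge> 0" "\<And>x v. x \<in> cball 0 r \<Longrightarrow> norm (Dgraph x v) \<le> L * norm v"
    "\<And>x y v. x \<in> cball 0 r \<Longrightarrow> y \<in> cball 0 r \<Longrightarrow> norm (Dgraph x v - Dgraph y v) \<le> L * dist x y powr \<alpha> * norm v"
    "\<And>x y. x \<in> cball 0 r \<Longrightarrow> y \<in> cball 0 r \<Longrightarrow> norm (graph x - graph y) \<le> L * norm (x - y)"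
    using Dgraph_bounds by blast
  \<comment> \<open>In a ball of diameter \<open>2 * r\<close> a distance \<open>d\<close> is at
    most \<open>(2 * r) powr (1 - \<alpha>) * d powr \<alpha>\<close>. This turns the Lipschitz
    part, from the derivative of \<open>f\<close>, into a Hoelder bound; the last \<open>L\<close>
    is the Hoelder part from \<open>graph\<close>.\<close>
  define H where "H = L * L * (2 * r) powr (1 - \<alpha>) + L"
  have "C1alpha \<alpha> (ball 0 r) (\<lambda>x. f (graph x)) \<and> 0 \<le> C1alpha_norm \<alpha> (ball 0 r) (\<lambda>x. f (graph x)) \<and>
      C1alpha_norm \<alpha> (ball 0 r) (\<lambda>x. f (graph x)) \<le> (1 + L + H) * M" if c: "c11 W f M" for f :: "'a \<Rightarrow> complex" and M
  proof -
    obtain Df where Df: "c11_deriv W f Df M" using c by (auto simp: c11_def)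
    have gW: "graph x \<in> W" if "x \<in> cball 0 r" for x using graph_frontier[of x] that W by auto
    have M0: "M \<ge> 0" using c11_derivD(5)[OF Df gW[of 0]] basic(2) by simp
    define E where "E x v = Df (graph x) (Dgraph x v)" for x v
    have blE: "bounded_linear (E x)" if "x \<in> cball 0 r" for x :: 'a
      unfolding E_def using has_derivative_bounded_linear[OF c11_derivD(1)[OF Df gW[OF that]]] bounded_linear_Dgraph
      by (rule bounded_linear_compose)
    have dE: "((\<lambda>x. f (graph x)) has_derivative E x) (at x)" if x: "x \<in> ball 0 r" for x :: 'a
    proof -
      have "x \<in> cball 0 r" using x by simp
      from has_derivative_compose[OF graph_has_derivative[OF x] c11_derivD(1)[OF Df gW[OF this]]]
      show ?thesis by (simp add: E_def[abs_def])
    qed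
    have bE: "norm (E x v) \<le> M * L * norm v" if x: "x \<in> cball 0 r" for x v :: 'a
    proof -
      have "norm (E x v) \<le> M * norm (Dgraph x v)" unfolding E_def by (rule c11_derivD(3)[OF Df gW[OF x]])
      also have "\<dots> \<le> M * (L * norm v)" using L(2)[OF x] M0 by (intro mult_left_mono) auto
      finally show ?thesis by (simp add: mult.assoc)
    qed
    have hE: "norm (E x v - E y v) \<le> M * H * dist x y powr \<alpha> * norm v" if x: "x \<in> cball 0 r" and y: "y \<in> cball 0 r" for x y v :: 'a
    proof -
      have lin: "Df (graph y) (Dgraph x v) - Df (graph y) (Dgraph y v) = Df (graph y) (Dgraph x v - Dgraph y v)"
        using has_derivative_bounded_linear[OF c11_derivD(1)[OF Df gW[OF y]]]
        by (simp add: bounded_linear.linear linear_diff)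
      have d: "norm (x - y) \<le> (2 * r) powr (1 - \<alpha>) * dist x y powr \<alpha>"
      proof (cases "x = y")
        case False
        have "dist x y \<le> 2 * r" using x y dist_triangle2[of x y 0] by (simp add: dist_commute)
        then have "dist x y powr (1 - \<alpha>) \<le> (2 * r) powr (1 - \<alpha>)" using \<alpha> by (intro powr_mono2) auto
        then have "dist x y powr (1 - \<alpha>) * dist x y powr \<alpha> \<le> (2 * r) powr (1 - \<alpha>) * dist x y powr \<alpha>"
          by (intro mult_right_mono) auto
        then show ?thesis using False by (simp add: powr_add[symmetric] dist_norm)
      qed (use \<alpha> in simp)
      have "E x v - E y v = (Df (graph x) (Dgraph x v) - Df (graph y) (Dgraph x v)) + Df (graph y) (Dgraph x v - Dgraph y v)"
        unfolding E_def lin[symmetric] by simp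
      also have "norm \<dots> \<le> M * norm (graph x - graph y) * norm (Dgraph x v) + M * norm (Dgraph x v - Dgraph y v)"
        by (intro norm_triangle_mono c11_derivD(4)[OF Df gW gW] c11_derivD(3)[OF Df gW] x y)
      also have "\<dots> \<le> M * (L * ((2 * r) powr (1 - \<alpha>) * dist x y powr \<alpha>)) * (L * norm v) + M * (L * dist x y powr \<alpha> * norm v)"
        using L(2)[OF x, of v] L(3)[OF x y, of v] order_trans[OF L(4)[OF x y] mult_left_mono[OF d L(1)]] M0 L(1)
        by (intro add_mono mult_mono mult_left_mono) auto
      also have "\<dots> = M * H * dist x y powr \<alpha> * norm v" by (simp add: H_def algebra_simps)
      finally show ?thesis .
    qed
    have app: "blinfun_apply (Blinfun (E x)) = E x" if "x \<in> cball 0 r" for x :: 'a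
      using bounded_linear_Blinfun_apply[OF blE[OF that]] .
    have H0: "H \<ge> 0" using L(1) by (simp add: H_def)
    have "C1alpha_deriv \<alpha> (ball 0 r) (\<lambda>x. f (graph x)) (\<lambda>x. Blinfun (E x))"
      unfolding C1alpha_deriv_def closure_ball_r
    proof (intro conjI ballI)
      have cf: "continuous_on W f"
        using c11_derivD(1)[OF Df] has_derivative_continuous by (metis continuous_at_imp_continuous_on)
      show "continuous_on (cball 0 r) (\<lambda>x. f (graph x))"
        by (rule continuous_on_compose2[OF cf continuous_graph]) (use gW in auto)
      show "((\<lambda>x. f (graph x)) has_derivative blinfun_apply (Blinfun (E x))) (at x)" if "x \<in> ball 0 r" for x :: 'a
        using dE[OF that] app[of x] that by simp
      show "holder_on \<alpha> (cball 0 r) (\<lambda>x. Blinfun (E x))"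
        unfolding holder_on_def
      proof (intro exI[of _ "M * H"] ballI)
        fix x y assume x: "x \<in> cball (0::'a) r" and y: "y \<in> cball (0::'a) r"
        show "norm (Blinfun (E x) - Blinfun (E y)) \<le> M * H * dist x y powr \<alpha>"
          by (rule norm_blinfun_bound) (use hE[OF x y] M0 H0 in \<open>auto simp: blinfun.diff_left app[OF x] app[OF y]\<close>)
      qed
    qed
    then have 1: "C1alpha \<alpha> (ball 0 r) (\<lambda>x. f (graph x))" unfolding C1alpha_def by blast
    have fr: "frechet_derivative (\<lambda>x. f (graph x)) (at x) = E x" if "x \<in> ball 0 r" for x :: 'a
      using frechet_derivative_at[OF dE[OF that]] by simp
    have ne: "ball (0::'a) r \<noteq> {}" using basic(2) by simp
    have s1: "0 \<le> (SUP x\<in>ball 0 r. norm (f (graph x)))" "(SUP x\<in>ball 0 r. norm (f (graph x))) \<le> M"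
      by (rule SUP_bounds[OF ne, where B = "M"]; use c11_derivD(2)[OF Df gW] in auto)+
    have o: "0 \<le> onorm (E x)" "onorm (E x) \<le> M * L" if "x \<in> ball 0 r" for x :: 'a
      using that onorm_pos_le[OF blE[of x]] bE[of x] M0 L(1) by (auto intro!: onorm_bound)
    have s2: "0 \<le> (SUP x\<in>ball 0 r. onorm (frechet_derivative (\<lambda>x. f (graph x)) (at x)))"
      "(SUP x\<in>ball 0 r. onorm (frechet_derivative (\<lambda>x. f (graph x)) (at x))) \<le> M * L"
      by (rule SUP_bounds[OF ne, where B = "M * L"]; use o fr in auto)+
    define P where "P = {(x, y). x \<in> ball 0 r \<and> y \<in> ball 0 r \<and> x \<noteq> (y::'a)}"
    define q where "q = (\<lambda>(x, y). onorm (\<lambda>h. frechet_derivative (\<lambda>x. f (graph x)) (at x) h - frechet_derivative (\<lambda>x. f (graph x)) (at y) h)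
          / dist x y powr \<alpha>)"
    have Pne: "P \<noteq> {}"
    proof -
      obtain b :: 'a where b: "b \<in> Basis" using nonempty_Basis by blast
      have "(0, (r / 2) *\<^sub>R b) \<in> P" using b basic(2) by (auto simp: P_def nonzero_Basis)
      then show ?thesis by blast
    qed
    have q: "0 \<le> q z" "q z \<le> M * H" if z: "z \<in> P" for z
    proof -
      obtain x y where xy: "z = (x, y)" "x \<in> ball 0 r" "y \<in> ball 0 r" "x \<noteq> y" using z by (auto simp: P_def)
      have qz: "q z = onorm (\<lambda>h. E x h - E y h) / dist x y powr \<alpha>" using xy fr by (simp add: q_def)
      have bl: "bounded_linear (\<lambda>h. E x h - E y h)" using blE[of x] blE[of y] xy by (intro bounded_linear_sub) auto
      show "0 \<le> q z" unfolding qz using onorm_pos_le[OF bl] by simp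
      have "onorm (\<lambda>h. E x h - E y h) \<le> M * H * dist x y powr \<alpha>"
        using hE[of x y] xy M0 H0 by (intro onorm_bound) auto
      then show "q z \<le> M * H" unfolding qz using xy by (simp add: divide_le_eq)
    qed
    have s3: "0 \<le> (SUP z\<in>P. q z)" "(SUP z\<in>P. q z) \<le> M * H"
      by (rule SUP_bounds[OF Pne, where B = "M * H"]; use q in auto)+
    have "C1alpha_norm \<alpha> (ball 0 r) (\<lambda>x. f (graph x)) = (SUP x\<in>ball 0 r. norm (f (graph x))) +
       (SUP x\<in>ball 0 r. onorm (frechet_derivative (\<lambda>x. f (graph x)) (at x))) + (SUP z\<in>P. q z)"
      unfolding C1alpha_norm_def P_def q_def ..
    then show ?thesis using 1 s1 s2 s3 by (simp add: algebra_simps)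
  qed
  then show ?thesis by blast
qed

text \<open>The gradient of \<open>height\<close>, not normalised: \<open>e\<close> minus the
  gradient of \<open>\<gamma>\<close> composed with the projection.\<close>

definition graph_normal :: "'a \<Rightarrow> 'a" where
  "graph_normal x = e - (\<Sum>b\<in>Basis. D x b *\<^sub>R b)"

lemma D_eq_inner: "D x v = (\<Sum>b\<in>Basis. D x b *\<^sub>R b) \<bullet> v"
proof -
  have "D x v = D x (\<Sum>b\<in>Basis. (v \<bullet> b) *\<^sub>R b)" by (simp only: euclidean_representation)
  also have "\<dots> = (\<Sum>b\<in>Basis. (v \<bullet> b) * D x b)" by (simp add: blinfun.sum_right blinfun.scaleR_right)
  also have "\<dots> = (\<Sum>b\<in>Basis. D x b *\<^sub>R b) \<bullet> v"
    unfolding inner_sum_left by (simp add: inner_commute mult.commute)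
  finally show ?thesis .
qed

lemma graph_normal_inner: "graph_normal x \<bullet> v = e \<bullet> v - D x v"
  by (simp add: graph_normal_def inner_diff_left D_eq_inner[of x v])

lemma D_e:
  assumes x: "x \<in> ball 0 r"
  shows "D x e = 0" "D x (perp e v) = D x v"
proof -
  have "((\<lambda>t. x + t *\<^sub>R e) has_derivative (\<lambda>t. t *\<^sub>R e)) (at 0)" by (auto intro!: derivative_eq_intros)
  moreover have "((\<lambda>x. \<gamma> (perp e x)) has_derivative D x) (at (x + 0 *\<^sub>R e))" using D_deriv[OF x] by simp
  ultimately have "((\<lambda>t. \<gamma> (perp e (x + t *\<^sub>R e))) has_derivative (\<lambda>t. D x (t *\<^sub>R e))) (at 0)"
    by (rule has_derivative_compose)
  moreover have "(\<lambda>t. \<gamma> (perp e (x + t *\<^sub>R e))) = (\<lambda>t. \<gamma> (perp e x))"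
    by (simp add: perp_simps[OF basic(1)])
  ultimately have "(\<lambda>t::real. D x (t *\<^sub>R e)) = (\<lambda>t. 0)"
    using has_derivative_unique has_derivative_const by metis
  then have "D x (1 *\<^sub>R e) = 0" by (rule fun_cong)
  then show 0: "D x e = 0" by simp
  have "D x v = D x (perp e v + (v \<bullet> e) *\<^sub>R e)" by (simp only: perp_simps(8)[OF basic(1)])
  also have "\<dots> = D x (perp e v)" by (simp add: blinfun.add_right blinfun.scaleR_right 0)
  finally show "D x (perp e v) = D x v" by simp
qed

lemma graph_normal_nz: "x \<in> ball 0 r \<Longrightarrow> graph_normal x \<noteq> 0"
  using graph_normal_inner[of x e] D_e(1)[of x] basic(1) by (auto simp: dot_square_norm)

section \<open>A defining function near a boundary point, and the outward normal\<close>

definition height :: "'a \<Rightarrow> real" where "height z = (z - p) \<bullet> e - \<gamma> (perp e (z - p))"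

definition cylinder :: "'a set" where "cylinder = {z. norm (perp e (z - p)) < r \<and> \<bar>(z - p) \<bullet> e\<bar> < \<delta>}"

lemma open_cylinder: "open cylinder"
proof -
  have "continuous_on UNIV (\<lambda>z. perp e (z - p))"
    by (rule continuous_on_compose2[OF continuous_perp[of UNIV]]) (auto intro!: continuous_intros)
  then show ?thesis unfolding cylinder_def
    by (intro open_Collect_conj open_Collect_less continuous_intros) auto
qed

lemma p_cylinder: "p \<in> cylinder"
  using basic(2,3) by (simp add: cylinder_def perp_def)

lemma height_continuous: "continuous_on cylinder height"
proof -
  have "continuous_on cylinder (\<lambda>z. \<gamma> (perp e (perp e (z - p))))"
    by (rule continuous_on_compose2[OF cont_\<gamma>], rule continuous_on_compose2[OF continuous_perp[of UNIV]])
      (auto simp: cylinder_def intro!: continuous_intros)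
  then show ?thesis unfolding height_def
    by (intro continuous_intros) (simp add: perp_simps(3)[OF basic(1)])
qed

text \<open>Points of the cylinder with positive height form an open set disjoint from
  \<open>\<Omega>\<close>, hence from its closure; points of negative height belong to
  \<open>\<Omega>\<close>. On the frontier only height 0 is left.\<close>

lemma cylinder_iff:
  assumes z: "z \<in> cylinder"
  shows "z \<in> \<Omega> \<longleftrightarrow> height z < 0" "z \<in> closure \<Omega> \<Longrightarrow> height z \<le> 0"
    "z \<in> frontier \<Omega> \<Longrightarrow> height z = 0" "z \<in> frontier \<Omega> \<Longrightarrow> z = graph (perp e (z - p))"
proof -
  have in\<Omega>: "z \<in> \<Omega> \<longleftrightarrow> height z < 0" if z: "z \<in> cylinder" for z
  proof -
    have "p + perp e (z - p) + ((z - p) \<bullet> e) *\<^sub>R e = z"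
      using perp_simps(8)[OF basic(1), of "z - p"] by (simp add: algebra_simps)
    then show ?thesis
      using basic(6)[OF perp_simps(1)[OF basic(1)], of "z - p" "(z - p) \<bullet> e"] z by (simp add: cylinder_def height_def)
  qed
  show 1: "z \<in> \<Omega> \<longleftrightarrow> height z < 0" by (rule in\<Omega>[OF z])
  show 2: "height z \<le> 0" if c: "z \<in> closure \<Omega>"
  proof (rule ccontr)
    assume n: "\<not> height z \<le> 0"
    have "open (height -` {0<..} \<inter> cylinder)"
      using continuous_on_open_vimage[OF open_cylinder, THEN iffD1, OF height_continuous] by simp
    moreover have "z \<in> height -` {0<..} \<inter> cylinder" using n z by auto
    ultimately obtain w where "w \<in> height -` {0<..} \<inter> cylinder" "w \<in> \<Omega>"
      using c open_Int_closure_eq_empty[of "height -` {0<..} \<inter> cylinder" \<Omega>] by blast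
    then show False using in\<Omega>[of w] by auto
  qed
  show 3: "height z = 0" if "z \<in> frontier \<Omega>"
    using that 1 2 open_\<Omega> by (auto simp: frontier_def interior_open)
  show "z = graph (perp e (z - p))" if "z \<in> frontier \<Omega>"
  proof -
    have "p + perp e (z - p) + ((z - p) \<bullet> e) *\<^sub>R e = z"
      using perp_simps(8)[OF basic(1), of "z - p"] by (simp add: algebra_simps)
    then show ?thesis using 3[OF that] by (simp add: graph_def height_def perp_simps(3)[OF basic(1)])
  qed
qed

lemma height_has_derivative:
  assumes z: "z \<in> cylinder"
  shows "(height has_derivative (\<lambda>v. graph_normal (perp e (z - p)) \<bullet> v)) (at z)"
proof -
  have x: "perp e (z - p) \<in> ball 0 r" using z by (simp add: cylinder_def)
  have "((\<lambda>z. perp e (z - p)) has_derivative (\<lambda>v. perp e v)) (at z)"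
    by (rule has_derivative_compose[of "\<lambda>z. z - p" "\<lambda>v. v" z UNIV "perp e" "perp e"])
      (auto intro!: derivative_eq_intros bounded_linear_imp_has_derivative[OF bounded_linear_perp])
  from has_derivative_compose[OF this D_deriv[OF x]]
  have "((\<lambda>z. \<gamma> (perp e (z - p))) has_derivative (\<lambda>v. D (perp e (z - p)) v)) (at z)"
    by (simp add: perp_simps(3)[OF basic(1)] D_e(2)[OF x])
  then show ?thesis unfolding height_def graph_normal_inner
    by (auto intro!: derivative_eq_intros simp: inner_commute)
qed

text \<open>Along a curve in the frontier \<open>height\<close> is constant, so its differential
  annihilates the velocity. Conversely \<open>t \<mapsto> graph (x + t *\<^sub>R w)\<close> has
  velocity \<open>perp e w + D x w *\<^sub>R e\<close>, which is \<open>w\<close> exactly when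
  \<open>D x w = w \<bullet> e\<close>.\<close>

lemma tangent_vectors_frontier:
  assumes z: "z \<in> cylinder" "z \<in> frontier \<Omega>"
  shows "tangent_vectors (frontier \<Omega>) z = {w. graph_normal (perp e (z - p)) \<bullet> w = 0}"
proof (intro equalityI subsetI)
  fix w assume "w \<in> tangent_vectors (frontier \<Omega>) z"
  then obtain c :: "real \<Rightarrow> 'a" where c: "c 0 = z" "\<forall>\<^sub>F t in at 0. c t \<in> frontier \<Omega>" "(c has_vector_derivative w) (at 0)"
    by (auto simp: tangent_vectors_def)
  have "isCont c 0" using c(3) has_vector_derivative_continuous by blast
  then have "(c \<longlongrightarrow> z) (at 0)" using c(1) by (simp add: isCont_def)
  then have "\<forall>\<^sub>F t in at 0. c t \<in> cylinder" using topological_tendstoD open_cylinder z(1) by blast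
  with c(2) have ev: "\<forall>\<^sub>F t in at 0. 0 = height (c t)"
    by eventually_elim (simp add: cylinder_iff(3))
  have "((\<lambda>t. height (c t)) has_derivative (\<lambda>t. graph_normal (perp e (z - p)) \<bullet> (t *\<^sub>R w))) (at 0)"
    by (rule has_derivative_compose[OF c(3)[unfolded has_vector_derivative_def]])
      (use height_has_derivative[OF z(1)] c(1) in simp)
  moreover have "((\<lambda>t. height (c t)) has_derivative (\<lambda>t. 0)) (at 0)"
    by (rule has_derivative_transform_eventually[OF has_derivative_const ev])
      (use cylinder_iff(3)[OF z] c(1) in auto)
  ultimately have "(\<lambda>t::real. graph_normal (perp e (z - p)) \<bullet> (t *\<^sub>R w)) = (\<lambda>t. 0)"
    by (rule has_derivative_unique)
  then have "graph_normal (perp e (z - p)) \<bullet> (1 *\<^sub>R w) = 0" by (rule fun_cong)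
  then show "w \<in> {w. graph_normal (perp e (z - p)) \<bullet> w = 0}" by simp
next
  fix w assume "w \<in> {w. graph_normal (perp e (z - p)) \<bullet> w = 0}"
  then have w: "D (perp e (z - p)) w = w \<bullet> e" by (simp add: graph_normal_inner inner_commute[of w])
  define x where "x = perp e (z - p)"
  have x: "x \<in> ball 0 r" using z by (simp add: cylinder_def x_def)
  define c where "c t = graph (x + t *\<^sub>R w)" for t
  have "c 0 = z" using cylinder_iff(4)[OF z] by (simp add: c_def x_def)
  moreover have "\<forall>\<^sub>F t in at 0. c t \<in> frontier \<Omega>"
  proof -
    have "((\<lambda>t. x + t *\<^sub>R w) \<longlongrightarrow> x + 0 *\<^sub>R w) (at 0)" by (intro tendsto_intros)
    then have "\<forall>\<^sub>F t in at 0. x + t *\<^sub>R w \<in> ball 0 r" using x by (intro topological_tendstoD) auto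
    then show ?thesis by eventually_elim (simp add: c_def graph_frontier_open)
  qed
  moreover have "(c has_vector_derivative w) (at 0)"
  proof -
    have "((\<lambda>t. x + t *\<^sub>R w) has_derivative (\<lambda>t. t *\<^sub>R w)) (at 0)" by (auto intro!: derivative_eq_intros)
    moreover have "(graph has_derivative Dgraph x) (at (x + 0 *\<^sub>R w))" using graph_has_derivative[OF x] by simp
    ultimately have "(c has_derivative (\<lambda>t. Dgraph x (t *\<^sub>R w))) (at 0)"
      unfolding c_def by (rule has_derivative_compose)
    moreover have "Dgraph x (t *\<^sub>R w) = t *\<^sub>R w" for t
    proof -
      have "Dgraph x w = w" unfolding Dgraph_def using w perp_simps(8)[OF basic(1), of w] by (simp add: x_def)
      then show ?thesis using bounded_linear_Dgraph by (simp add: bounded_linear.linear linear_scale)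
    qed
    ultimately show ?thesis by (simp add: has_vector_derivative_def)
  qed
  ultimately show "w \<in> tangent_vectors (frontier \<Omega>) z" by (auto simp: tangent_vectors_def)
qed

text \<open>The tangent vectors fill a hyperplane, so a unit normal is \<open>\<nu>\<close> or
  \<open>- \<nu>\<close>; the one-sided condition selects the sign because \<open>height\<close>
  increases along its gradient.\<close>

lemma outward_normal_eq:
  assumes z: "z \<in> cylinder" "z \<in> frontier \<Omega>"
  shows "outward_normal \<Omega> z = graph_normal (perp e (z - p)) /\<^sub>R norm (graph_normal (perp e (z - p)))"
proof -
  define n where "n = graph_normal (perp e (z - p))"
  define \<nu> where "\<nu> = n /\<^sub>R norm n"
  have n0: "n \<noteq> 0" unfolding n_def using z by (intro graph_normal_nz) (simp add: cylinder_def)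
  have \<nu>1: "norm \<nu> = 1" using n0 by (simp add: \<nu>_def)
  have n\<nu>: "n = norm n *\<^sub>R \<nu>" using n0 by (simp add: \<nu>_def)
  have T: "w \<in> tangent_vectors (frontier \<Omega>) z \<longleftrightarrow> \<nu> \<bullet> w = 0" for w
    unfolding tangent_vectors_frontier[OF z] n_def[symmetric] using n0 by (simp add: \<nu>_def)
  \<comment> \<open>The sign \<open>s\<close> covers both sides at once: \<open>s = 1\<close> for
    leaving the closure, \<open>s = -1\<close> for entering \<open>\<Omega>\<close>.\<close>
  have side: "\<forall>\<^sub>F t in at_right 0. z + t *\<^sub>R v \<in> cylinder \<and> s * height (z + t *\<^sub>R v) > 0" if v: "s * (n \<bullet> v) > 0" for v s
  proof -
    have d: "((\<lambda>t. z + t *\<^sub>R v) has_derivative (\<lambda>t. t *\<^sub>R v)) (at 0)" by (auto intro!: derivative_eq_intros)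
    have "((\<lambda>t. z + t *\<^sub>R v) \<longlongrightarrow> z + 0 *\<^sub>R v) (at_right 0)" by (intro tendsto_intros)
    then have 1: "\<forall>\<^sub>F t in at_right 0. z + t *\<^sub>R v \<in> cylinder"
      using z(1) open_cylinder by (intro topological_tendstoD) auto
    have "(height has_derivative (\<lambda>v. n \<bullet> v)) (at (z + 0 *\<^sub>R v))"
      using height_has_derivative[OF z(1)] by (simp add: n_def)
    from has_derivative_compose[OF d this]
    have "((\<lambda>t. s * height (z + t *\<^sub>R v)) has_real_derivative s * (n \<bullet> v)) (at 0)"
      unfolding has_field_derivative_def by (auto intro!: derivative_eq_intros simp: mult_ac)
    from DERIV_pos_inc_right[OF this v] obtain d where d: "d > 0" "\<And>h. 0 < h \<Longrightarrow> h < d \<Longrightarrow> s * height (z + h *\<^sub>R v) > 0"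
      using cylinder_iff(3)[OF z] by auto
    have "\<forall>\<^sub>F t in at_right 0. s * height (z + t *\<^sub>R v) > 0"
      unfolding eventually_at_right_field using d by (intro exI[of _ d]) auto
    with 1 show ?thesis by (rule eventually_conj)
  qed
  have n\<nu>pos: "n \<bullet> \<nu> > 0" using n0 by (simp add: \<nu>_def dot_square_norm power2_eq_square)
  show ?thesis unfolding outward_normal_def n_def[symmetric] \<nu>_def[symmetric]
  proof (rule the_equality)
    have a: "\<forall>\<^sub>F t in at_right 0. z - t *\<^sub>R \<nu> \<in> \<Omega>"
      using side[of "-1" "-\<nu>"] n\<nu>pos by (auto elim!: eventually_mono simp: cylinder_iff(1))
    have b: "\<forall>\<^sub>F t in at_right 0. z + t *\<^sub>R \<nu> \<notin> closure \<Omega>"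
      using side[of 1 \<nu>] n\<nu>pos cylinder_iff(2) by (auto elim!: eventually_mono) force
    show "norm \<nu> = 1 \<and> (\<forall>w\<in>tangent_vectors (frontier \<Omega>) z. \<nu> \<bullet> w = 0) \<and>
        (\<forall>\<^sub>F t in at_right 0. z - t *\<^sub>R \<nu> \<in> \<Omega> \<and> z + t *\<^sub>R \<nu> \<notin> closure \<Omega>)"
      using \<nu>1 T eventually_conj[OF a b] by blast
    fix \<nu>' assume "norm \<nu>' = 1 \<and> (\<forall>w\<in>tangent_vectors (frontier \<Omega>) z. \<nu>' \<bullet> w = 0) \<and>
        (\<forall>\<^sub>F t in at_right 0. z - t *\<^sub>R \<nu>' \<in> \<Omega> \<and> z + t *\<^sub>R \<nu>' \<notin> closure \<Omega>)"
    then have \<nu>': "norm \<nu>' = 1" "\<And>w. \<nu> \<bullet> w = 0 \<Longrightarrow> \<nu>' \<bullet> w = 0"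
      "\<forall>\<^sub>F t in at_right 0. z - t *\<^sub>R \<nu>' \<in> \<Omega>"
      using T by (auto elim: eventually_mono)
    define c where "c = \<nu> \<bullet> \<nu>'"
    \<comment> \<open>The component of \<open>\<nu>'\<close> orthogonal to \<open>\<nu>\<close> is
      tangent, hence orthogonal to \<open>\<nu>'\<close> as well, and therefore to itself.\<close>
    define w where "w = \<nu>' - c *\<^sub>R \<nu>"
    have w0: "\<nu> \<bullet> w = 0" using \<nu>1 by (simp add: w_def c_def inner_diff_right dot_square_norm)
    then have "w \<bullet> w = 0" using \<nu>'(2)[OF w0] by (simp add: w_def[THEN arg_cong, of "\<lambda>u. u \<bullet> w"] inner_diff_left)
    then have eq: "\<nu>' = c *\<^sub>R \<nu>" by (simp add: w_def)
    then have c1: "\<bar>c\<bar> = 1" using \<nu>'(1) \<nu>1 by simp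
    have "c \<noteq> -1"
    proof
      assume "c = -1"
      then have "\<forall>\<^sub>F t in at_right 0. z + t *\<^sub>R \<nu> \<in> \<Omega>" using \<nu>'(3) eq by simp
      with b have "\<forall>\<^sub>F t in at_right (0::real). False"
        by eventually_elim (use closure_subset in blast)
      then show False by simp
    qed
    then have "c = 1" using c1 by linarith
    then show "\<nu>' = \<nu>" using eq by simp
  qed
qed

text \<open>Every boundary point is the base point of some chart, so continuity at the base point
  \<open>p\<close> is enough to cover the frontier.\<close>

lemma continuous_outward_normal: "continuous (at p within frontier \<Omega>) (outward_normal \<Omega>)"
proof -
  define N where "N z = graph_normal (perp e (z - p)) /\<^sub>R norm (graph_normal (perp e (z - p)))" for z
  have cD: "continuous_on (cball 0 r) D" by (rule holder_on_imp_continuous_on[OF D_holder \<alpha>(1)])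
  have cp: "continuous_on cylinder (\<lambda>z. perp e (z - p))"
    by (rule continuous_on_compose2[OF continuous_perp[of UNIV]]) (auto intro!: continuous_intros)
  have "continuous_on cylinder (\<lambda>z. D (perp e (z - p)))"
    by (rule continuous_on_compose2[OF cD cp]) (auto simp: cylinder_def)
  then have "continuous_on cylinder (\<lambda>z. graph_normal (perp e (z - p)))"
    unfolding graph_normal_def by (intro continuous_intros)
  then have "continuous_on cylinder N"
    unfolding N_def by (intro continuous_intros) (auto simp: cylinder_def intro!: graph_normal_nz)
  then have "continuous_on (cylinder \<inter> frontier \<Omega>) N" by (rule continuous_on_subset) auto
  then have "continuous_on (cylinder \<inter> frontier \<Omega>) (outward_normal \<Omega>)"
    by (rule continuous_on_eq) (simp add: N_def outward_normal_eq)
  moreover have "p \<in> frontier \<Omega>"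
    using graph_frontier[of 0] basic by (simp add: graph_def perp_def)
  ultimately have "continuous (at p within cylinder \<inter> frontier \<Omega>) (outward_normal \<Omega>)"
    using p_cylinder by (auto simp: continuous_on_eq_continuous_within)
  moreover have "at p within cylinder \<inter> frontier \<Omega> = at p within frontier \<Omega>"
    by (rule at_within_nhd[OF p_cylinder open_cylinder]) auto
  ultimately show ?thesis by simp
qed

end

section \<open>The two layer potentials\<close>

lemma hypograph_exists:
  assumes "local_hypograph \<alpha> \<Omega> p e r \<delta> \<gamma>" "open \<Omega>" "0 < \<alpha>" "\<alpha> < 1"
  shows "\<exists>D. hypograph \<alpha> \<Omega> p e r \<delta> \<gamma> D"
  using assms unfolding hypograph_def local_hypograph_def C1alpha_def by blast

lemma continuous_on_outward_normal:
  assumes "class_C1alpha \<alpha> \<Omega>" "open \<Omega>" "0 < \<alpha>" "\<alpha> < 1"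
  shows "continuous_on (frontier \<Omega>) (outward_normal \<Omega>)"
  unfolding continuous_on_eq_continuous_within
proof
  fix p assume "p \<in> frontier \<Omega>"
  then obtain e r \<delta> \<gamma> where "local_hypograph \<alpha> \<Omega> p e r \<delta> \<gamma>"
    using assms(1) by (auto simp: class_C1alpha_def)
  then obtain D where "hypograph \<alpha> \<Omega> p e r \<delta> \<gamma> D" using hypograph_exists assms by blast
  then show "continuous (at p within frontier \<Omega>) (outward_normal \<Omega>)"
    by (rule hypograph.continuous_outward_normal)
qed

lemma norm_outward_normal:
  assumes "class_C1alpha \<alpha> \<Omega>" "open \<Omega>" "0 < \<alpha>" "\<alpha> < 1" "p \<in> frontier \<Omega>"
  shows "norm (outward_normal \<Omega> p) = 1"
proof -
  obtain e r \<delta> \<gamma> where "local_hypograph \<alpha> \<Omega> p e r \<delta> \<gamma>"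
    using assms(1,5) by (auto simp: class_C1alpha_def)
  then obtain D where "hypograph \<alpha> \<Omega> p e r \<delta> \<gamma> D" using hypograph_exists assms by blast
  then interpret hypograph \<alpha> \<Omega> p e r \<delta> \<gamma> D .
  have "perp e (p - p) \<in> ball 0 r" using p_cylinder by (simp add: cylinder_def)
  from graph_normal_nz[OF this] show ?thesis
    by (simp add: outward_normal_eq[OF p_cylinder assms(5)])
qed

lemma boundary_patch_bound:
  assumes P: "boundary_patch \<alpha> \<Omega> r \<Phi>" and \<Omega>: "open \<Omega>" "0 < \<alpha>" "\<alpha> < 1" and W: "frontier \<Omega> \<subseteq> W"
  shows "\<exists>c. \<forall>f M. c11 W (f :: 'a::euclidean_space \<Rightarrow> complex) M \<longrightarrow> C1alpha \<alpha> (ball 0 r) (\<lambda>x. f (\<Phi> x)) \<and>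
     0 \<le> C1alpha_norm \<alpha> (ball 0 r) (\<lambda>x. f (\<Phi> x)) \<and> C1alpha_norm \<alpha> (ball 0 r) (\<lambda>x. f (\<Phi> x)) \<le> c * M"
proof -
  obtain p e \<delta> \<gamma> where h: "local_hypograph \<alpha> \<Omega> p e r \<delta> \<gamma>" and \<Phi>: "\<Phi> = (\<lambda>x. p + perp e x + \<gamma> (perp e x) *\<^sub>R e)"
    using P by (auto simp: boundary_patch_def)
  obtain D where "hypograph \<alpha> \<Omega> p e r \<delta> \<gamma> D" using hypograph_exists[OF h \<Omega>] by blast
  then interpret hypograph \<alpha> \<Omega> p e r \<delta> \<gamma> D .
  have "\<Phi> = graph" by (simp add: \<Phi> graph_def fun_eq_iff)
  then show ?thesis using C1alpha_graph_bound[OF W] by simp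
qed

lemma c11_imp_C1alpha_boundary:
  assumes "c11 W f M" "open \<Omega>" "0 < \<alpha>" "\<alpha> < 1" "frontier \<Omega> \<subseteq> W"
  shows "f \<in> C1alpha_boundary \<alpha> \<Omega>"
  unfolding C1alpha_boundary_def using boundary_patch_bound[OF _ assms(2-5)] assms(1) by blast

text \<open>Each patch of the finite atlas bounds its share of the boundary norm by a multiple of
  the test bound, and the shares are summed. The absolute value enters because the continuity
  constant in the dual carries no sign.\<close>

lemma C1alpha_dual_c11_functional:
  fixes T :: "('a::euclidean_space \<Rightarrow> complex) \<Rightarrow> complex"
  assumes T: "T \<in> C1alpha_dual \<alpha> \<Omega>" and \<Omega>: "open \<Omega>" "0 < \<alpha>" "\<alpha> < 1"
    and R: "R > 0" "frontier \<Omega> \<subseteq> ball 0 R"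
  shows "\<exists>C. c11_functional (ball 0 R) R T C"
proof -
  obtain A C where A: "boundary_atlas \<alpha> \<Omega> A"
    and C: "\<And>f. f \<in> C1alpha_boundary \<alpha> \<Omega> \<Longrightarrow> cmod (T f) \<le> C * C1alpha_boundary_norm \<alpha> A f"
    using T unfolding C1alpha_dual_def by blast
  have "\<forall>z\<in>A. \<exists>c. \<forall>f M. c11 (ball 0 R) (f :: 'a \<Rightarrow> complex) M \<longrightarrow>
     0 \<le> C1alpha_norm \<alpha> (ball 0 (fst z)) (\<lambda>x. f (snd z x)) \<and> C1alpha_norm \<alpha> (ball 0 (fst z)) (\<lambda>x. f (snd z x)) \<le> c * M"
  proof
    fix z assume "z \<in> A"
    then have "boundary_patch \<alpha> \<Omega> (fst z) (snd z)" using A by (auto simp: boundary_atlas_def)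
    from boundary_patch_bound[OF this \<Omega> R(2)]
    show "\<exists>c. \<forall>f M. c11 (ball 0 R) (f :: 'a \<Rightarrow> complex) M \<longrightarrow>
     0 \<le> C1alpha_norm \<alpha> (ball 0 (fst z)) (\<lambda>x. f (snd z x)) \<and> C1alpha_norm \<alpha> (ball 0 (fst z)) (\<lambda>x. f (snd z x)) \<le> c * M"
      by blast
  qed
  then obtain c where c: "\<And>z f M. z \<in> A \<Longrightarrow> c11 (ball 0 R) (f :: 'a \<Rightarrow> complex) M \<Longrightarrow>
     0 \<le> C1alpha_norm \<alpha> (ball 0 (fst z)) (\<lambda>x. f (snd z x)) \<and> C1alpha_norm \<alpha> (ball 0 (fst z)) (\<lambda>x. f (snd z x)) \<le> c z * M"
    by metis
  have mem: "f \<in> C1alpha_boundary \<alpha> \<Omega>" if "c11 (ball 0 R) f M" for f M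
    by (rule c11_imp_C1alpha_boundary[OF that \<Omega> R(2)])
  have "c11_functional (ball 0 R) R T (\<bar>C\<bar> * (\<Sum>z\<in>A. c z))"
  proof unfold_locales
    fix f g :: "'a \<Rightarrow> complex" and M N and a :: complex
    assume f: "c11 (ball 0 R) f M"
    show "T (\<lambda>y. f y + g y) = T f + T g" if "c11 (ball 0 R) g N"
      using T mem[OF f] mem[OF that] by (simp add: C1alpha_dual_def)
    show "T (\<lambda>y. a * f y) = a * T f" using T mem[OF f] by (simp add: C1alpha_dual_def)
    have N: "C1alpha_boundary_norm \<alpha> A f = (\<Sum>z\<in>A. C1alpha_norm \<alpha> (ball 0 (fst z)) (\<lambda>x. f (snd z x)))"
      by (simp add: C1alpha_boundary_norm_def case_prod_unfold)
    have "0 \<le> C1alpha_boundary_norm \<alpha> A f" unfolding N using c[OF _ f] by (intro sum_nonneg) blast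
    moreover have "C1alpha_boundary_norm \<alpha> A f \<le> (\<Sum>z\<in>A. c z) * M"
      unfolding N sum_distrib_right using c[OF _ f] by (intro sum_mono) blast
    ultimately have "C * C1alpha_boundary_norm \<alpha> A f \<le> \<bar>C\<bar> * ((\<Sum>z\<in>A. c z) * M)"
      by (intro mult_mono) auto
    with C[OF mem[OF f]] show "cmod (T f) \<le> \<bar>C\<bar> * (\<Sum>z\<in>A. c z) * M" by simp
  qed (use R in auto)
  then show ?thesis by blast
qed

section \<open>The double layer potential as a functional of the kernel\<close>

lemma space_surface_measure: "space (surface_measure \<Omega>) = frontier \<Omega>"
  by (simp add: surface_measure_def hausdorff_measure_def space_restrict_space space_measure_of_conv)

lemma borel_measurable_surface_measure:
  fixes f :: "'a::euclidean_space \<Rightarrow> complex"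
  assumes "continuous_on (frontier \<Omega>) f"
  shows "f \<in> borel_measurable (surface_measure \<Omega>)"
proof -
  have s: "sets (hausdorff_measure m :: 'a measure) = sets borel" for m
    unfolding hausdorff_measure_def by (simp add: sets.sigma_sets_eq[of borel, simplified])
  have "f \<in> borel_measurable (restrict_space borel (frontier \<Omega>))"
    by (rule borel_measurable_continuous_on_restrict[OF assms])
  then have "f \<in> borel_measurable (restrict_space (hausdorff_measure (DIM('a) - 1)) (frontier \<Omega>))"
    using measurable_cong_sets[OF sets_restrict_space_cong[OF s] refl] by blast
  then show ?thesis unfolding surface_measure_def by (rule measurable_completion)
qed

text \<open>Applied to \<open>y \<mapsto> fund_sol k (x - y)\<close> with \<open>x\<close> off the
  boundary this is the double layer potential: differentiation in \<open>y\<close> produces the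
  minus sign of the double layer kernel.\<close>

definition normal_functional ::
    "'a::euclidean_space set \<Rightarrow> ('a \<Rightarrow> complex) \<Rightarrow> ('a \<Rightarrow> complex) \<Rightarrow> complex" where
  "normal_functional \<Omega> \<mu> f =
     (LINT y|surface_measure \<Omega>. frechet_derivative f (at y) (outward_normal \<Omega> y) * \<mu> y)"

text \<open>The normal is a continuous unit field, so the normal derivative of a test function is
  continuous on the frontier and bounded by \<open>M\<close>; its product with the density is
  integrable with the stated bound.\<close>

lemma normal_c11_functional:
  fixes \<mu> :: "'a::euclidean_space \<Rightarrow> complex"
  assumes \<Omega>: "class_C1alpha \<alpha> \<Omega>" "open \<Omega>" "0 < \<alpha>" "\<alpha> < 1"
    and R: "R > 0" "frontier \<Omega> \<subseteq> ball 0 R" and \<mu>: "integrable (surface_measure \<Omega>) \<mu>"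
  shows "c11_functional (ball 0 R) R (normal_functional \<Omega> \<mu>) (LINT y|surface_measure \<Omega>. cmod (\<mu> y))"
proof -
  define N where "N = outward_normal \<Omega>"
  define I where "I f y = frechet_derivative f (at y) (N y) * \<mu> y" for f :: "'a \<Rightarrow> complex" and y
  have N1: "norm (N y) = 1" if "y \<in> frontier \<Omega>" for y
    unfolding N_def by (rule norm_outward_normal[OF \<Omega> that])
  have cN: "continuous_on (frontier \<Omega>) N" unfolding N_def by (rule continuous_on_outward_normal[OF \<Omega>])
  \<comment> \<open>Additivity of the functional rests on both facts: the integral of a
    non-integrable function is 0 by convention, and \<open>frechet_derivative\<close> is additive
    only where the functions are differentiable.\<close>
  have *: "integrable (surface_measure \<Omega>) (I f) \<and> (\<forall>y\<in>frontier \<Omega>. cmod (I f y) \<le> M * cmod (\<mu> y)) \<and>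
      (\<forall>y\<in>frontier \<Omega>. f differentiable (at y))" if c: "c11 (ball 0 R) f M" for f M
  proof -
    obtain D where D: "c11_deriv (ball 0 R) f D M" using c by (auto simp: c11_def)
    have inW: "y \<in> ball 0 R" if "y \<in> frontier \<Omega>" for y using that R(2) by blast
    have fd: "frechet_derivative f (at y) = D y" if "y \<in> frontier \<Omega>" for y
      using frechet_derivative_at[OF c11_derivD(1)[OF D inW[OF that]]] by simp
    have "continuous_on (frontier \<Omega>) (\<lambda>y. D y (N y))"
      unfolding continuous_on_def
    proof
      fix y assume y: "y \<in> frontier \<Omega>"
      have N: "(N \<longlongrightarrow> N y) (at y within frontier \<Omega>)" using cN y by (auto simp: continuous_on_def)
      have M0: "M \<ge> 0" using c11_derivD(5)[OF D inW[OF y]] .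
      have bl: "linear (D y)"
        using has_derivative_linear[OF c11_derivD(1)[OF D inW[OF y]]] .
      have b: "norm (D z (N z) - D y (N y)) \<le> M * norm (z - y) * 1 + M * norm (N z - N y)" if z: "z \<in> frontier \<Omega>" for z
      proof -
        have "D z (N z) - D y (N y) = (D z (N z) - D y (N z)) + D y (N z - N y)"
          using linear_diff[OF bl] by simp
        also have "norm \<dots> \<le> M * norm (z - y) * norm (N z) + M * norm (N z - N y)"
          by (intro norm_triangle_mono c11_derivD(4)[OF D inW inW] c11_derivD(3)[OF D inW] y z)
        finally show ?thesis using N1[OF z] by simp
      qed
      have "((\<lambda>z. M * norm (z - y) * 1 + M * norm (N z - N y)) \<longlongrightarrow> M * norm (y - y) * 1 + M * norm (N y - N y)) (at y within frontier \<Omega>)"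
        by (intro tendsto_intros N)
      then have l: "((\<lambda>z. M * norm (z - y) * 1 + M * norm (N z - N y)) \<longlongrightarrow> 0) (at y within frontier \<Omega>)" by simp
      have "((\<lambda>z. D z (N z) - D y (N y)) \<longlongrightarrow> 0) (at y within frontier \<Omega>)"
        by (rule Lim_null_comparison[OF _ l]) (use b in \<open>auto simp: eventually_at_filter\<close>)
      then show "((\<lambda>z. D z (N z)) \<longlongrightarrow> D y (N y)) (at y within frontier \<Omega>)" by (rule LIM_zero_cancel)
    qed
    then have m: "(\<lambda>y. D y (N y)) \<in> borel_measurable (surface_measure \<Omega>)"
      by (rule borel_measurable_surface_measure)
    have "(\<lambda>y. D y (N y) * \<mu> y) \<in> borel_measurable (surface_measure \<Omega>)"
      using m borel_measurable_integrable[OF \<mu>] by (rule borel_measurable_times)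
    then have m2: "I f \<in> borel_measurable (surface_measure \<Omega>)"
      by (rule measurable_cong[THEN iffD1, rotated]) (simp add: space_surface_measure I_def fd)
    have b: "cmod (I f y) \<le> M * cmod (\<mu> y)" if "y \<in> frontier \<Omega>" for y
      using c11_derivD(3)[OF D inW[OF that], of "N y"] N1[OF that]
      by (simp add: I_def fd[OF that] norm_mult mult_right_mono)
    have "integrable (surface_measure \<Omega>) (I f)"
    proof (rule Bochner_Integration.integrable_bound[OF integrable_mult_right[OF integrable_norm[OF \<mu>], of M] m2])
      show "AE y in surface_measure \<Omega>. cmod (I f y) \<le> norm (M * cmod (\<mu> y))"
        by (rule AE_I2) (use b in \<open>auto simp: space_surface_measure intro: order_trans[OF _ abs_ge_self]\<close>)
    qed
    moreover have "f differentiable (at y)" if "y \<in> frontier \<Omega>" for y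
      using c11_derivD(1)[OF D inW[OF that]] by (auto simp: differentiable_def)
    ultimately show ?thesis using b by blast
  qed
  have T: "normal_functional \<Omega> \<mu> f = integral\<^sup>L (surface_measure \<Omega>) (I f)" for f
    by (simp add: normal_functional_def I_def[abs_def] N_def)
  show ?thesis
  proof unfold_locales
    fix f g :: "'a \<Rightarrow> complex" and M M' and a :: complex
    assume f: "c11 (ball 0 R) f M"
    show "normal_functional \<Omega> \<mu> (\<lambda>y. f y + g y) = normal_functional \<Omega> \<mu> f + normal_functional \<Omega> \<mu> g"
      if g: "c11 (ball 0 R) g M'"
    proof -
      have "normal_functional \<Omega> \<mu> (\<lambda>y. f y + g y) = (LINT y|surface_measure \<Omega>. I f y + I g y)"
        unfolding T
      proof (rule Bochner_Integration.integral_cong[OF refl])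
        fix y assume "y \<in> space (surface_measure \<Omega>)"
        then have y: "y \<in> frontier \<Omega>" by (simp add: space_surface_measure)
        have "f differentiable (at y)" "g differentiable (at y)" using *[OF f] *[OF g] y by auto
        then have "((\<lambda>y. f y + g y) has_derivative (\<lambda>v. frechet_derivative f (at y) v + frechet_derivative g (at y) v)) (at y)"
          by (intro has_derivative_add) (simp_all add: frechet_derivative_works)
        from frechet_derivative_at[OF this, symmetric] show "I (\<lambda>y. f y + g y) y = I f y + I g y"
          by (simp add: I_def algebra_simps)
      qed
      also have "\<dots> = normal_functional \<Omega> \<mu> f + normal_functional \<Omega> \<mu> g"
        unfolding T using *[OF f] *[OF g] by (intro Bochner_Integration.integral_add) auto
      finally show ?thesis .
    qed
    have "normal_functional \<Omega> \<mu> (\<lambda>y. a * f y) = (LINT y|surface_measure \<Omega>. a * I f y)"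
      unfolding T
    proof (rule Bochner_Integration.integral_cong[OF refl])
      fix y assume "y \<in> space (surface_measure \<Omega>)"
      then have y: "y \<in> frontier \<Omega>" by (simp add: space_surface_measure)
      have "f differentiable (at y)" using *[OF f] y by auto
      then have "((\<lambda>y. a * f y) has_derivative (\<lambda>v. a * frechet_derivative f (at y) v)) (at y)"
        by (intro has_derivative_mult_right) (simp add: frechet_derivative_works)
      from frechet_derivative_at[OF this, symmetric] show "I (\<lambda>y. a * f y) y = a * I f y"
        by (simp add: I_def algebra_simps)
    qed
    then show "normal_functional \<Omega> \<mu> (\<lambda>y. a * f y) = a * normal_functional \<Omega> \<mu> f" by (simp add: T)
    have "norm (normal_functional \<Omega> \<mu> f) \<le> (LINT y|surface_measure \<Omega>. M * cmod (\<mu> y))"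
      unfolding T using *[OF f] \<mu>
      by (intro Bochner_Integration.integral_norm_bound_integral) (auto simp: space_surface_measure)
    then show "norm (normal_functional \<Omega> \<mu> f) \<le> (LINT y|surface_measure \<Omega>. cmod (\<mu> y)) * M"
      by (simp add: mult.commute)
  qed (use R in auto)
qed

theorem theorem6p20:
  fixes k :: complex and \<alpha> :: real and Omega :: "'a::euclidean_space set"
  assumes "DIM('a) \<ge> 2"
    and "k \<notin> \<real>\<^sub>\<le>\<^sub>0" and "Im k \<ge> 0"
    and "0 < \<alpha>" and "\<alpha> < 1"
    and "bounded Omega" and "open Omega" and "class_C1alpha \<alpha> Omega"
  shows
    "(\<forall>\<mu> \<in> V_minus1 \<alpha> Omega.
        outgoing_radiation k (single_layer k \<mu>) \<and>
        Limsup at_infinity (\<lambda>x::'a. ereal (norm x * exp (Im k * norm x)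
          * norm x powr ((real DIM('a) - 1) / 2)
          * cmod (frechet_derivative (single_layer k \<mu>) (at x) (x /\<^sub>R norm x)
                    - \<i> * k * single_layer k \<mu> x))) < \<infinity>)
   \<and> (\<forall>\<mu> :: 'a \<Rightarrow> complex. integrable (surface_measure Omega) \<mu> \<longrightarrow>
        outgoing_radiation k (double_layer k Omega \<mu>) \<and>
        Limsup at_infinity (\<lambda>x::'a. ereal (norm x * exp (Im k * norm x)
          * norm x powr ((real DIM('a) - 1) / 2)
          * cmod (frechet_derivative (double_layer k Omega \<mu>) (at x) (x /\<^sub>R norm x)
                    - \<i> * k * double_layer k Omega \<mu> x))) < \<infinity>)"
proof -
  define p where "p = (real DIM('a) - 1) / 2"
  have p: "- (real DIM('a) - 1) / 2 = - p" by (simp only: p_def minus_divide_left)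
  have p0: "p \<ge> 0" using assms(1) by (simp add: p_def)
  obtain \<sigma> where \<sigma>:
      "\<And>x::'a. x \<noteq> 0 \<Longrightarrow> fund_sol k x = exp (\<i> * k * of_real (norm x)) * \<sigma> 0 (norm x)"
      "\<And>j r. r > 0 \<Longrightarrow> (\<sigma> j has_vector_derivative \<sigma> (Suc j) r) (at r)"
      "\<And>j. \<exists>K. \<forall>r\<ge>1. norm (\<sigma> j r) \<le> K * r powr (- p - real j)"
    using fund_sol_symbol[OF assms(2,3,1)] unfolding p by blast
  obtain \<Phi> where \<Phi>: "\<And>x::'a. x \<noteq> 0 \<Longrightarrow> fund_sol k x = \<Phi> 0 (x \<bullet> x)"
      "\<And>j q. q > 0 \<Longrightarrow> (\<Phi> j has_vector_derivative \<Phi> (Suc j) q) (at q)"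
    using fund_sol_smooth[OF assms(2,3)] by blast
  have "bounded (frontier Omega)" 
    using bounded_subset[OF bounded_closure[OF assms(6)]] by (auto simp: frontier_def)
  then obtain R where Rb: "R > 0" "frontier Omega \<subseteq> ball 0 R"
    using bounded_subset_ballD by blast
  have rad: "radiating_potential (ball 0 R) R T C (fund_sol k :: 'a \<Rightarrow> complex) \<Phi> k \<sigma> p" if "c11_functional (ball 0 R) R T C" for T C
  proof -
    interpret c11_functional "ball 0 R" R T C by fact
    show ?thesis by unfold_locales (use \<sigma> \<Phi> p0 assms(3) in auto)
  qed
  show ?thesis
  proof (intro conjI ballI allI impI)
    fix \<mu> :: "('a \<Rightarrow> complex) \<Rightarrow> complex" assume "\<mu> \<in> V_minus1 \<alpha> Omega"
    then have "\<mu> \<in> C1alpha_dual \<alpha> Omega" by (simp add: V_minus1_def)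
    then obtain C where "c11_functional (ball 0 R) R \<mu> C"
      using C1alpha_dual_c11_functional[OF _ assms(7,4,5) Rb] by blast
    from rad[OF this] interpret radiating_potential "ball 0 R" R \<mu> C "fund_sol k" \<Phi> k \<sigma> p .
    have u: "single_layer k \<mu> x = potential x" for x
      by (simp add: single_layer_def potential_def)
    show "outgoing_radiation k (single_layer k \<mu>)"
      and "Limsup at_infinity (\<lambda>x::'a. ereal (norm x * exp (Im k * norm x)
          * norm x powr ((real DIM('a) - 1) / 2)
          * cmod (frechet_derivative (single_layer k \<mu>) (at x) (x /\<^sub>R norm x)
                    - \<i> * k * single_layer k \<mu> x))) < \<infinity>"
      by (rule radiates[OF p_def u])+
  next
    fix \<mu> :: "'a \<Rightarrow> complex" assume \<mu>: "integrable (surface_measure Omega) \<mu>"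
    from rad[OF normal_c11_functional[OF assms(8,7,4,5) Rb \<mu>]]
    interpret radiating_potential "ball 0 R" R "normal_functional Omega \<mu>"
      "LINT y|surface_measure Omega. cmod (\<mu> y)" "fund_sol k" \<Phi> k \<sigma> p .
    \<comment> \<open>For the single layer the identification is immediate from the definitions.
      Here it compares derivatives at \<open>x - y\<close> and at \<open>y\<close>, which exist
      because \<open>x\<close> is far from the frontier and so \<open>x - y\<close> is
      nonzero.\<close>
    have u: "double_layer k Omega \<mu> x = potential x" if x: "norm x > R + 2" for x
      unfolding double_layer_def potential_def normal_functional_def
    proof (rule Bochner_Integration.integral_cong[OF refl])
      fix y assume "y \<in> space (surface_measure Omega)"
      then have "y \<in> ball 0 R" using Rb(2) by (auto simp: space_surface_measure)
      then have "x - y \<noteq> 0" using x by auto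
      note d = G_has_derivative[OF this]
      have "((\<lambda>y. x - y) has_derivative (\<lambda>v. - v)) (at y)" by (auto intro!: derivative_eq_intros)
      from has_derivative_compose[OF this d]
      have "((\<lambda>y. fund_sol k (x - y)) has_derivative (\<lambda>v. - DG (x - y) v)) (at y)"
        by (simp add: DG_def)
      from frechet_derivative_at[OF this, symmetric] frechet_derivative_at[OF d, symmetric]
      show "- frechet_derivative (fund_sol k) (at (x - y)) (outward_normal Omega y) * \<mu> y =
        frechet_derivative (\<lambda>y. fund_sol k (x - y)) (at y) (outward_normal Omega y) * \<mu> y" by simp
    qed
    show "outgoing_radiation k (double_layer k Omega \<mu>)"
      and "Limsup at_infinity (\<lambda>x::'a. ereal (norm x * exp (Im k * norm x)
          * norm x powr ((real DIM('a) - 1) / 2)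
          * cmod (frechet_derivative (double_layer k Omega \<mu>) (at x) (x /\<^sub>R norm x)
                    - \<i> * k * double_layer k Omega \<mu> x))) < \<infinity>"
      by (rule radiates[OF p_def u]; assumption)+
  qed
qed

end
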